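(* Let $L$ be a finite dimensional simple $\mathfrak{gl}(m|n)$-module whose highest weight $\lambda_{st}$ with respect to the standard choice of simple roots $\pi_{st}$ lies in $\mathbb P^+$. Then $L$ is a KW-module if and only if $\lambda_{st}$ is totally connected.
   Context: $\mathfrak g=\mathfrak{gl}(m|n)$ over $\mathbb C$, $\mathfrak h$ the diagonal Cartan subalgebra, $\{\varepsilon_1,\dots,\varepsilon_m;\delta_1,\dots,\delta_n\}$ the basis of $\mathfrak h^*$ dual to the diagonal matrix units, with $(\varepsilon_i,\varepsilon_j)=\delta_{ij}=-(\delta_i,\delta_j)$, $(\varepsilon_i,\delta_j)=0$. Even roots $\Delta_{\bar0}=\{\varepsilon_i-\varepsilon_j\}_{i\ne j}\cup\{\delta_k-\delta_l\}_{k\ne l}$, odd roots $\Delta_{\bar1}=\{\pm(\varepsilon_i-\delta_k)\}$. All sets of simple roots $\pi$ considered have positive even roots $\Delta_{\bar0}^+=\{\varepsilon_i-\varepsilon_j\}_{i<j}\cup\{\delta_k-\delta_l\}_{k<l}$. The standard choice is $\pi_{st}=\{\varepsilon_1-\varepsilon_2,\dots,\varepsilon_{m-1}-\varepsilon_m,\varepsilon_m-\delta_1,\delta_1-\delta_2,\dots,\delta_{n-1}-\delta_n\}$. $\rho_\pi=\frac12\sum_{\alpha\in\Delta^+_{\bar0}}\alpha-\frac12\sum_{\alpha\in\Delta^+_{\bar1}}\alpha$, $\lambda^\rho=\lambda^\rho_\pi=\lambda+\rho_\pi$, and $L_\pi(\lambda)$ is the simple highest weight module of highest weight $\lambda$ with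 respect to $\pi$. $P^+$ is the set of weights $\mu$ with $2(\mu,\alpha)/(\alpha,\alpha)\in\mathbb Z_{\ge0}$ for all $\alpha\in\Delta^+_{\bar0}$, and $\mathbb P^+=\{\mu\in P^+\mid(\mu^\rho_\pi,\varepsilon_i)\in\mathbb Z,\ (\mu^\rho_\pi,\delta_j)\in\mathbb Z \text{ for all } i,j\}$ (independent of $\pi$). A $\lambda^\rho$-maximal isotropic set is a set of linearly independent roots $\{\beta_1,\dots,\beta_r\}$ with $(\beta_i,\beta_j)=0=(\lambda^\rho,\beta_i)$ for all $i,j$, of maximal possible cardinality (possibly empty). A finite dimensional simple module $L$ is a KW-module if $L\cong L_\pi(\lambda)$ for some choice of simple roots $\pi$ (and weight $\lambda$) such that $\pi$ contains a $\lambda^\rho$-maximal isotropic set. Interval property: write $\lambda^\rho=\sum_i a_i\varepsilon_i-\sum_j b_j\delta_j$, and let $S_\lambda=\{\varepsilon_{m_i}-\delta_{n_i}\}_{i=1}^r$ (up to signs of the roots) be a $\lambda^\rho$-maximal isotropic set ordered so that $a_{m_1}\le\dots\le a_{m_r}$. Then $\lambda^\rho$ satisfies the interval property if all integers between $a_{m_1}$ and $a_{m_r}$ lie in $\{a_1,\dots,a_m,b_1,\dots,b_n\}$ (vacuous if $r=0$). A weight $\lambda_{st}\in\mathbb P^+$ is totally connected if $\lambda_{st}+\rho_{\pi_{st}}$ satisfies the interval property. *)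

theory Defs
  imports "HOL-Analysis.Analysis" "HOL-Library.Z2"
begin

text \<open>
  The Lie superalgebra gl(m|n): the even indices form a finite linearly ordered type \<open>'m\<close>
  (\<open>m = CARD('m)\<close>), the odd ones a finite linearly ordered type \<open>'n\<close> (\<open>n = CARD('n)\<close>).
  Parities live in \<open>bit\<close>, the field with two elements.
\<close>

type_synonym ('m, 'n) gl = "complex ^ ('m + 'n) ^ ('m + 'n)"

text \<open>A weight is given by its coordinates in the basis dual to the diagonal matrix units.\<close>

type_synonym ('m, 'n) weight = "complex ^ ('m + 'n)"

fun parity :: "'m + 'n \<Rightarrow> bit" where
  "parity (Inl i) = 0"
| "parity (Inr j) = 1"

definition gl_part :: "bit \<Rightarrow> ('m::finite, 'n::finite) gl set" where
  "gl_part p = {X. \<forall>i j. X $ i $ j \<noteq> 0 \<longrightarrow> parity i + parity j = p}"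

text \<open>The superbracket of \<open>X\<close> of parity \<open>p\<close> and \<open>Y\<close> of parity \<open>q\<close>.\<close>

definition sbracket ::
    "bit \<Rightarrow> bit \<Rightarrow> ('m::finite, 'n::finite) gl \<Rightarrow> ('m, 'n) gl \<Rightarrow> ('m, 'n) gl" where
  "sbracket p q X Y = (if p = 1 \<and> q = 1 then X ** Y + Y ** X else X ** Y - Y ** X)"

definition cartan :: "('m::finite, 'n::finite) gl set" where
  "cartan = {H. \<forall>i j. i \<noteq> j \<longrightarrow> H $ i $ j = 0}"

definition weight_eval :: "('m::finite, 'n::finite) weight \<Rightarrow> ('m, 'n) gl \<Rightarrow> complex" where
  "weight_eval \<mu> H = (\<Sum>i\<in>UNIV. \<mu> $ i * H $ i $ i)"

definition eps :: "'m::finite \<Rightarrow> ('m, 'n::finite) weight" where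
  "eps i = axis (Inl i) 1"

definition del :: "'n::finite \<Rightarrow> ('m::finite, 'n) weight" where
  "del j = axis (Inr j) 1"

definition form :: "('m::finite, 'n::finite) weight \<Rightarrow> ('m, 'n) weight \<Rightarrow> complex" where
  "form \<mu> \<nu> = (\<Sum>i\<in>UNIV. \<mu> $ Inl i * \<nu> $ Inl i) - (\<Sum>j\<in>UNIV. \<mu> $ Inr j * \<nu> $ Inr j)"

definition even_roots :: "('m::finite, 'n::finite) weight set" where
  "even_roots = {eps i - eps j | i j. i \<noteq> j} \<union> {del k - del l | k l. k \<noteq> l}"

definition odd_roots :: "('m::finite, 'n::finite) weight set" where
  "odd_roots = {eps i - del k | i k. True} \<union> {- (eps i - del k) | i k. True}"

definition roots :: "('m::finite, 'n::finite) weight set" where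
  "roots = even_roots \<union> odd_roots"

definition even_pos_roots :: "('m::{finite,linorder}, 'n::{finite,linorder}) weight set" where
  "even_pos_roots = {eps i - eps j | i j. i < j} \<union> {del k - del l | k l. k < l}"

definition root_space :: "('m::finite, 'n::finite) weight \<Rightarrow> ('m, 'n) gl set" where
  "root_space \<alpha> = {X. \<forall>H\<in>cartan. H ** X - X ** H = map_matrix ((*) (weight_eval \<alpha> H)) X}"

definition nat_combs :: "('m::finite, 'n::finite) weight set \<Rightarrow> ('m, 'n) weight set" where
  "nat_combs B = {\<Sum>\<beta>\<in>B. of_nat (c \<beta>) *s \<beta> | c :: ('m, 'n) weight \<Rightarrow> nat. True}"

definition pos_roots :: "('m::finite, 'n::finite) weight set \<Rightarrow> ('m, 'n) weight set" where
  "pos_roots B = roots \<inter> nat_combs B"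

text \<open>Sets of simple roots whose positive even roots are the fixed ones.\<close>

definition simple_roots :: "('m::{finite,linorder}, 'n::{finite,linorder}) weight set \<Rightarrow> bool" where
  "simple_roots B \<longleftrightarrow>
     B \<subseteq> roots \<and> vec.independent B \<and>
     (\<forall>\<alpha>\<in>roots. \<alpha> \<in> nat_combs B \<or> - \<alpha> \<in> nat_combs B) \<and>
     even_roots \<inter> pos_roots B = even_pos_roots"

definition pi_st :: "('m::{finite,linorder}, 'n::{finite,linorder}) weight set" where
  "pi_st = {eps i - eps j | i j. i < j \<and> {i<..<j} = {}}
         \<union> {eps (Max UNIV) - del (Min UNIV)}
         \<union> {del k - del l | k l. k < l \<and> {k<..<l} = {}}"

definition rho :: "('m::finite, 'n::finite) weight set \<Rightarrow> ('m, 'n) weight" where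
  "rho B = (1/2) *s (\<Sum>\<alpha>\<in>even_roots \<inter> pos_roots B. \<alpha>)
         - (1/2) *s (\<Sum>\<alpha>\<in>odd_roots \<inter> pos_roots B. \<alpha>)"

definition P_plus :: "('m::{finite,linorder}, 'n::{finite,linorder}) weight set" where
  "P_plus = {\<mu>. \<forall>\<alpha>\<in>even_pos_roots. 2 * form \<mu> \<alpha> / form \<alpha> \<alpha> \<in> \<nat>}"

definition PP_plus ::
    "('m::{finite,linorder}, 'n::{finite,linorder}) weight set \<Rightarrow> ('m, 'n) weight set" where
  "PP_plus B = {\<mu>\<in>P_plus. (\<forall>i. form (\<mu> + rho B) (eps i) \<in> \<int>) \<and>
                          (\<forall>j. form (\<mu> + rho B) (del j) \<in> \<int>)}"

definition isotropic_set ::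
    "('m::finite, 'n::finite) weight \<Rightarrow> ('m, 'n) weight set \<Rightarrow> bool" where
  "isotropic_set \<nu> S \<longleftrightarrow>
     S \<subseteq> roots \<and> vec.independent S \<and>
     (\<forall>\<beta>\<in>S. form \<nu> \<beta> = 0) \<and> (\<forall>\<beta>\<in>S. \<forall>\<gamma>\<in>S. form \<beta> \<gamma> = 0)"

definition maximal_isotropic_set ::
    "('m::finite, 'n::finite) weight \<Rightarrow> ('m, 'n) weight set \<Rightarrow> bool" where
  "maximal_isotropic_set \<nu> S \<longleftrightarrow>
     isotropic_set \<nu> S \<and> (\<forall>T. isotropic_set \<nu> T \<longrightarrow> card T \<le> card S)"

definition a_coeff :: "('m::finite, 'n::finite) weight \<Rightarrow> 'm \<Rightarrow> complex" where
  "a_coeff \<nu> i = \<nu> $ Inl i"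

definition b_coeff :: "('m::finite, 'n::finite) weight \<Rightarrow> 'n \<Rightarrow> complex" where
  "b_coeff \<nu> j = - \<nu> $ Inr j"

text \<open>
  The list \<open>ps\<close> enumerates the index pairs \<open>(m\<^sub>i, n\<^sub>i)\<close>. Every maximal isotropic set consists of
  odd roots and stays maximal isotropic when signs of its elements change, so it is enough to
  consider the sets of roots \<open>eps i - del j\<close>. For weights in \<open>PP_plus\<close> the coefficients are integers, which
  is why they can be compared through \<open>Re\<close>. When the \<open>a_coeff \<nu> i\<close> are pairwise distinct and so
  are the \<open>b_coeff \<nu> j\<close>, as for \<open>\<nu> = \<Lambda> + rho pi_st\<close> with \<open>\<Lambda>\<close> in \<open>P_plus\<close>, there is only one such
  set, so quantifying over all of them involves no choice.
\<close>

definition interval_property :: "('m::finite, 'n::finite) weight \<Rightarrow> bool" where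
  "interval_property \<nu> \<longleftrightarrow>
     (\<forall>ps. distinct ps \<and> ps \<noteq> [] \<and>
        maximal_isotropic_set \<nu> {eps i - del j | i j. (i, j) \<in> set ps} \<and>
        sorted (map (\<lambda>(i, j). Re (a_coeff \<nu> i)) ps) \<longrightarrow>
        (\<forall>z::int. Re (a_coeff \<nu> (fst (hd ps))) \<le> of_int z \<and>
                  of_int z \<le> Re (a_coeff \<nu> (fst (last ps))) \<longrightarrow>
           of_int z \<in> range (a_coeff \<nu>) \<union> range (b_coeff \<nu>)))"

definition totally_connected :: "('m::{finite,linorder}, 'n::{finite,linorder}) weight \<Rightarrow> bool" where
  "totally_connected \<Lambda> \<longleftrightarrow> \<Lambda> \<in> PP_plus pi_st \<and> interval_property (\<Lambda> + rho pi_st)"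

text \<open>
  A module is a complex vector space carried by the whole type \<open>'v\<close>, with grading
  \<open>V 0 \<oplus> V 1\<close> and an even action of gl(m|n).
\<close>

locale gl_module = vector_space scale
  for scale :: "complex \<Rightarrow> 'v::ab_group_add \<Rightarrow> 'v" +
  fixes V :: "bit \<Rightarrow> 'v set"
    and act :: "('m::{finite,linorder}, 'n::{finite,linorder}) gl \<Rightarrow> 'v \<Rightarrow> 'v"
  assumes subspace_V: "subspace (V p)"
    and V_inter: "V 0 \<inter> V 1 = {0}"
    and V_sum: "\<exists>x\<in>V 0. \<exists>y\<in>V 1. v = x + y"
    and act_add_right: "act X (v + w) = act X v + act X w"
    and act_scale_right: "act X (scale c v) = scale c (act X v)"
    and act_add_left: "act (X + Y) v = act X v + act Y v"
    and act_scale_left: "act (map_matrix ((*) c) X) v = scale c (act X v)"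
    and act_parity: "X \<in> gl_part p \<Longrightarrow> v \<in> V q \<Longrightarrow> act X v \<in> V (p + q)"
    and act_sbracket: "X \<in> gl_part p \<Longrightarrow> Y \<in> gl_part q \<Longrightarrow>
      act (sbracket p q X Y) v =
        (if p = 1 \<and> q = 1 then act X (act Y v) + act Y (act X v)
         else act X (act Y v) - act Y (act X v))"
begin

definition submodule :: "'v set \<Rightarrow> bool" where
  "submodule W \<longleftrightarrow>
     subspace W \<and>
     (\<forall>w\<in>W. \<exists>x\<in>W \<inter> V 0. \<exists>y\<in>W \<inter> V 1. w = x + y) \<and>
     (\<forall>X. \<forall>w\<in>W. act X w \<in> W)"

definition simple :: bool where
  "simple \<longleftrightarrow> (UNIV :: 'v set) \<noteq> {0} \<and> (\<forall>W. submodule W \<longrightarrow> W = {0} \<or> W = UNIV)"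

definition finite_dim :: bool where
  "finite_dim \<longleftrightarrow> (\<exists>B. finite_dimensional_vector_space scale B)"

definition highest_weight_vector ::
    "('m, 'n) weight set \<Rightarrow> ('m, 'n) weight \<Rightarrow> 'v \<Rightarrow> bool" where
  "highest_weight_vector B \<Lambda> v \<longleftrightarrow>
     v \<noteq> 0 \<and> (v \<in> V 0 \<or> v \<in> V 1) \<and>
     (\<forall>H\<in>cartan. act H v = scale (weight_eval \<Lambda> H) v) \<and>
     (\<forall>\<alpha>\<in>pos_roots B. \<forall>X\<in>root_space \<alpha>. act X v = 0)"

definition highest_weight_module :: "('m, 'n) weight set \<Rightarrow> ('m, 'n) weight \<Rightarrow> bool" where
  "highest_weight_module B \<Lambda> \<longleftrightarrow>
     (\<exists>v. highest_weight_vector B \<Lambda> v \<and> (\<forall>W. submodule W \<and> v \<in> W \<longrightarrow> W = UNIV))"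

text \<open>
  The module is (isomorphic, up to a parity shift, to) the simple highest weight module
  \<open>L\<^sub>B(\<Lambda>)\<close>, which is determined up to isomorphism by this property.
\<close>

definition is_L :: "('m, 'n) weight set \<Rightarrow> ('m, 'n) weight \<Rightarrow> bool" where
  "is_L B \<Lambda> \<longleftrightarrow> simple \<and> highest_weight_module B \<Lambda>"

definition KW_module :: bool where
  "KW_module \<longleftrightarrow>
     finite_dim \<and> simple \<and>
     (\<exists>B \<Lambda>. simple_roots B \<and> is_L B \<Lambda> \<and>
        (\<exists>S\<subseteq>B. maximal_isotropic_set (\<Lambda> + rho B) S))"

end

end

theory Submission
  imports Defs
begin

text \<open>
  A set of simple roots \<open>B\<close> amounts to a total order of the indices that extends the given orders of
  the even and of the odd ones; listing the indices in this order and attaching to each index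
  \<open>p\<close> the number \<open>(\<Lambda> + rho B, e\<^sub>p)\<close>, where \<open>e\<^sub>p\<close> is \<open>eps\<close> or \<open>del\<close>, turns a pair of \<open>B\<close> and
  a weight \<open>\<Lambda>\<close> into a word of labelled letters \<open>EpsAt a\<close>, \<open>DelAt b\<close>. The theorem is
  a statement about such words.

  An odd reflection exchanges two neighbouring letters of different type. If their labels
  differ, the labels stay; if they agree, both increase by one (for \<open>eps del \<rightarrow> del eps\<close>) or decrease
  by one (for \<open>del eps \<rightarrow> eps del\<close>). The new word is again that of the highest weight of the same
  simple module (\<open>odd_reflection\<close>, \<open>has_labels_reflect\<close>). Running the reflections backwards moves
  every \<open>del\<close> to the right end; the label lists obtained at the end are computed by the recursive
  function \<open>std_form\<close>. They do not depend on the order of the moves, since \<open>std_form\<close> is invariant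
  under each exchange (\<open>std_form_swap_equal\<close>, \<open>std_form_swap_distinct\<close>). As a highest weight of a simple module is
  unique (\<open>hw_unique\<close>), the words that belong to a module with standard labels \<open>(A, B)\<close> are
  exactly the words with standard form \<open>(A, B)\<close>, one for each order of the indices.

  Up to signs, an isotropic set for the shifted weight is a set of disjoint pairs of letters of
  different type with equal labels, and it is contained in \<open>B\<close> if and only if the letters of each
  pair are neighbours. The largest number of such pairs, neighbouring or not, depends only on the
  number of \<open>eps\<close> and on the multiset of \<open>eps\<close>-labels minus the multiset of \<open>del\<close>-labels. Both are
  invariant under reflections. In the standard word dominance makes the \<open>eps\<close>-labels \<open>A\<close> distinct and
  also the \<open>del\<close>-labels \<open>B\<close>, so this number is \<open>card (A \<inter> B)\<close> (\<open>match_number_std_form\<close>).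

  It remains to show that a word with standard form \<open>(A, B)\<close> and \<open>card (A \<inter> B)\<close> disjoint
  neighbouring pairs exists if and only if the integers between any two elements of \<open>A \<inter> B\<close> lie
  in \<open>A \<union> B\<close>. Both directions follow the recursion of \<open>std_form\<close>. A letter \<open>del\<close> with label \<open>d\<close> that is
  put in front runs down the string \<open>d, d - 1, \<dots>\<close> of consecutive elements of \<open>A\<close> and stops at the
  first integer \<open>e\<close> outside of \<open>A\<close>. A pair with label \<open>d\<close> in front adds such an \<open>e\<close> to both sets, and
  dominance forces \<open>d\<close> to be the maximum of \<open>A\<close> unless \<open>e = d\<close>. In either case the string fills
  the integers from \<open>e\<close> to \<open>d\<close>, and no gap arises (\<open>paired_connected\<close>). Conversely, letters and
  pairs are split off one by one at the extreme labels (\<open>connected_paired\<close>).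
\<close>

section \<open>Words of labelled letters and odd reflections\<close>

text \<open>
  A letter records the type of a basis vector of the dual Cartan subalgebra and its label, the
  value of the form of that vector with the shifted highest weight.
\<close>

datatype letter = EpsAt int | DelAt int

text \<open>
  A \<open>del\<close> with label \<open>d\<close> crosses a row of \<open>eps\<close> with labels \<open>A\<close> from left to right. Each crossing
  is an odd reflection, so a meeting of equal labels lowers both of them by one.
\<close>

fun pass :: "int \<Rightarrow> int list \<Rightarrow> int \<times> int list" where
  "pass d [] = (d, [])"
| "pass d (a # A) =
    (if a = d then (fst (pass (d - 1) A), (d - 1) # snd (pass (d - 1) A))
     else (fst (pass d A), a # snd (pass d A)))"

text \<open>
  The \<open>eps\<close>-labels and the \<open>del\<close>-labels, both from left to right, of the word in which all
  \<open>eps\<close> precede all \<open>del\<close> and which arises from the given word by odd reflections.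
\<close>

fun std_form :: "letter list \<Rightarrow> int list \<times> int list" where
  "std_form [] = ([], [])"
| "std_form (EpsAt a # w) = (a # fst (std_form w), snd (std_form w))"
| "std_form (DelAt d # w) = (snd (pass d (fst (std_form w))), fst (pass d (fst (std_form w))) # snd (std_form w))"

lemma std_form_append_cong: "std_form w = std_form w' \<Longrightarrow> std_form (u @ w) = std_form (u @ w')"
proof (induction u)
  case (Cons x u) then show ?case by (cases x) simp_all
qed simp

text \<open>
  This and the next lemma say that the standard form does not change under odd reflections. Only
  the two recursive steps at the exchanged letters have to be compared.
\<close>

lemma std_form_swap_equal: "std_form (u @ DelAt d # EpsAt d # w) = std_form (u @ EpsAt (d - 1) # DelAt (d - 1) # w)"
  by (rule std_form_append_cong) simp

lemma std_form_swap_distinct: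
  "a \<noteq> d \<Longrightarrow> std_form (u @ DelAt d # EpsAt a # w) = std_form (u @ EpsAt a # DelAt d # w)"
  by (rule std_form_append_cong) simp

text \<open>
  A single crossing can be undone: the two labels are equal afterwards exactly if they were equal
  before, that is, if they were lowered.
\<close>

lemma pass_inj:
  "pass d A = pass d' A' \<Longrightarrow> length A = length A' \<Longrightarrow> d = d' \<and> A = A'"
proof (induction A arbitrary: d d' A')
  case Nil then show ?case by simp
next
  case (Cons a A)
  then obtain a' A1' where A': "A' = a' # A1'" by (cases A') auto
  show ?case
  proof (cases "a = d"; cases "a' = d'")
    assume *: "a = d" "a' = d'"
    then have "pass (d - 1) A = pass (d' - 1) A1'"
      using Cons.prems(1) A' by (auto simp: prod_eq_iff)
    then show ?thesis using Cons.IH[of "d - 1" "d' - 1" A1'] Cons.prems(2) A' * by simp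
  next
    assume *: "a = d" "a' \<noteq> d'"
    then have "pass (d - 1) A = pass d' A1'" "a' = d - 1"
      using Cons.prems(1) A' by (auto simp: prod_eq_iff)
    then show ?thesis using Cons.IH[of "d - 1" d' A1'] Cons.prems(2) A' * by simp
  next
    assume *: "a \<noteq> d" "a' = d'"
    then have "pass d A = pass (d' - 1) A1'" "a = d' - 1"
      using Cons.prems(1) A' by (auto simp: prod_eq_iff)
    then show ?thesis using Cons.IH[of d "d' - 1" A1'] Cons.prems(2) A' * by simp
  next
    assume *: "a \<noteq> d" "a' \<noteq> d'"
    then have "pass d A = pass d' A1'" "a = a'"
      using Cons.prems(1) A' by (auto simp: prod_eq_iff)
    then show ?thesis using Cons.IH[of d d' A1'] Cons.prems(2) A' * by simp
  qed
qed

lemma length_pass [simp]: "length (snd (pass d A)) = length A"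
  by (induction A arbitrary: d) auto

fun is_eps :: "letter \<Rightarrow> bool" where "is_eps (EpsAt _) = True" | "is_eps (DelAt _) = False"

lemma length_std_form:
  "length (fst (std_form w)) = length (filter is_eps w)"
  "length (snd (std_form w)) = length (filter (\<lambda>x. \<not> is_eps x) w)"
  by (induction w rule: std_form.induct) auto

text \<open>
  The order of the types determines the course of the recursion, so only the crossings have to be undone.
\<close>

lemma std_form_inj: "std_form w = std_form w' \<Longrightarrow> map is_eps w = map is_eps w' \<Longrightarrow> w = w'"
proof (induction w arbitrary: w')
  case Nil then show ?case by simp
next
  case (Cons x w)
  then obtain x' w1 where w': "w' = x' # w1" by (cases w') auto
  have shape: "map is_eps w = map is_eps w1" "is_eps x = is_eps x'" using Cons.prems(2) w' by auto
  show ?case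
  proof (cases x)
    case (EpsAt a)
    then obtain a' where "x' = EpsAt a'" using shape by (cases x') auto
    then show ?thesis using Cons.prems(1) Cons.IH[of w1] shape w' EpsAt by (simp add: prod_eq_iff)
  next
    case (DelAt d)
    then obtain d' where x': "x' = DelAt d'" using shape by (cases x') auto
    have cnt: "length (filter is_eps v) = length (filter id (map is_eps v))" for v
      by (simp add: filter_map comp_def)
    have "length (fst (std_form w)) = length (fst (std_form w1))"
      unfolding length_std_form(1) using cnt[of w] cnt[of w1] shape(1) by argo
    then have "d = d' \<and> fst (std_form w) = fst (std_form w1)"
      using pass_inj[of d "fst (std_form w)" d' "fst (std_form w1)"] Cons.prems(1) w' x' DelAt
      by (simp add: prod_eq_iff)
    then show ?thesis using Cons.prems(1) Cons.IH[of w1] shape w' x' DelAt by (simp add: prod_eq_iff)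
  qed
qed

text \<open>
  In a strictly decreasing row the \<open>del\<close> meets \<open>eps\<close> with the labels \<open>d, d - 1, \<dots>, e + 1\<close> one after
  the other and lowers each of them, together with itself, by one. It stops to interact at the first missing
  value \<open>e\<close>, so that the row as a set loses \<open>d\<close> and gains \<open>e\<close>.
\<close>

lemma pass_chain:
  assumes "sorted_wrt (>) A" "e \<le> d" "{e<..d} \<subseteq> set A" "e \<notin> set A"
  shows "fst (pass d A) = e" "sorted_wrt (>) (snd (pass d A))"
    "set (snd (pass d A)) = (if e = d then set A else insert e (set A - {d}))"
proof -
  have "fst (pass d A) = e \<and> sorted_wrt (>) (snd (pass d A)) \<and>
    set (snd (pass d A)) = (if e = d then set A else insert e (set A - {d}))"
    using assms
  proof (induction A arbitrary: d)
    case Nil then show ?case by (cases "e = d") auto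
  next
    case (Cons a A)
    show ?case
    proof (cases "a = d")
      case True
      have "{e<..d - 1} \<subseteq> set A" using Cons.prems(3) True by (auto simp: subset_iff)
      moreover have "e \<le> d - 1" using Cons.prems True by auto
      ultimately have "e \<le> d - 1" and IH: "fst (pass (d-1) A) = e" "sorted_wrt (>) (snd (pass (d-1) A))"
          "set (snd (pass (d-1) A)) = (if e = d-1 then set A else insert e (set A - {d-1}))"
        using Cons.IH[of "d-1"] Cons.prems by auto
      have lt: "\<forall>x\<in>set A. x < d" using Cons.prems True by auto
      have lt': "\<forall>x\<in>set (snd (pass (d - 1) A)). x < d - 1"
      proof
        fix x assume x: "x \<in> set (snd (pass (d - 1) A))"
        show "x < d - 1"
        proof (cases "e = d - 1")
          case True
          then have "x < d" "x \<noteq> d - 1" using x IH(3) lt Cons.prems(4) by auto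
          then show ?thesis by simp
        next
          case False
          then have "x = e \<or> (x < d \<and> x \<noteq> d - 1)" using x IH(3) lt by auto
          then show ?thesis using False \<open>e \<le> d - 1\<close> by linarith
        qed
      qed
      have "d - 1 \<in> set A" if "e \<noteq> d - 1"
        using \<open>{e<..d - 1} \<subseteq> set A\<close> \<open>e \<le> d - 1\<close> that by (auto dest: subsetD[of _ _ "d - 1"])
      then show ?thesis using True IH lt lt' Cons.prems by (auto split: if_splits)
    next
      case False
      show ?thesis
      proof (cases "a < d")
        case True
        then have "d \<notin> set (a # A)" using Cons.prems(1) by auto
        then have "e = d" using Cons.prems(2,3) by force
        then show ?thesis using Cons.IH[of d] Cons.prems False by auto
      next
        case False
        have "sorted_wrt (>) A" "{e<..d} \<subseteq> set A" "e \<notin> set A"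
          using Cons.prems False \<open>a \<noteq> d\<close> by (auto simp: subset_iff)
        then have "fst (pass d A) = e \<and> sorted_wrt (>) (snd (pass d A)) \<and>
            set (snd (pass d A)) = (if e = d then set A else insert e (set A - {d}))"
          using Cons.IH[of d] Cons.prems(2) by blast
        then show ?thesis using False \<open>a \<noteq> d\<close> Cons.prems by (auto split: if_splits)
      qed
    qed
  qed
  then show "fst (pass d A) = e" "sorted_wrt (>) (snd (pass d A))"
    "set (snd (pass d A)) = (if e = d then set A else insert e (set A - {d}))" by auto
qed

lemma run_end_below:
  fixes d :: int assumes "finite A"
  obtains e where "e \<le> d" "{e<..d} \<subseteq> A" "e \<notin> A"
proof -
  obtain b where "\<forall>x\<in>A. b \<le> x"
    using bdd_below_finite[OF assms] by (auto simp: bdd_below_def)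
  then have b: "\<forall>x\<in>A. b - 1 < x" by auto
  define F where "F = {min (b - 1) d..d} - A"
  have "min (b - 1) d \<notin> A" using b by force
  then have "min (b - 1) d \<in> F" by (simp add: F_def)
  then have "F \<noteq> {}" by blast
  have "finite F" by (simp add: F_def)
  with \<open>F \<noteq> {}\<close> have "Max F \<in> F" and mx: "\<forall>x\<in>F. x \<le> Max F" by auto
  moreover have "{Max F<..d} \<subseteq> A"
  proof
    fix x assume x: "x \<in> {Max F<..d}"
    have "x \<notin> F" using mx x by force
    then show "x \<in> A" using x \<open>Max F \<in> F\<close> unfolding F_def by auto
  qed
  ultimately show ?thesis using that[of "Max F"] by (auto simp: F_def)
qed

text \<open>
  Dominance is inherited by the final segments of a word: two \<open>eps\<close>-labels in the wrong order or equal
  stay so when a \<open>del\<close> crosses both of them.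
\<close>

lemma sorted_pass_D: "sorted_wrt (>) (snd (pass d A)) \<Longrightarrow> sorted_wrt (>) A"
proof (induction A arbitrary: d)
  case (Cons a A)
  define d1 where "d1 = (if a = d then d - 1 else d)"
  have s: "sorted_wrt (>) ((if a = d then d - 1 else a) # snd (pass d1 A))"
    using Cons.prems by (auto simp: d1_def split: if_splits)
  then have sA: "sorted_wrt (>) A" using Cons.IH[of d1] by auto
  have "a > x" if "x \<in> set A" for x
  proof (cases A)
    case (Cons b A2)
    have "x \<le> b" using that sA Cons by auto
    moreover have "b < a" using s Cons by (auto simp: d1_def split: if_splits)
    ultimately show ?thesis by simp
  qed (use that in simp)
  then show ?case using sA by simp
qed simp

text \<open>
  Only pairs in the order \<open>eps del\<close> are counted, and \<open>k\<close> need not be maximal. A pair \<open>del eps\<close> with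
  label \<open>y\<close> becomes a pair \<open>eps del\<close> with label \<open>y - 1\<close> by an odd reflection.
\<close>

inductive paired :: "letter list \<Rightarrow> nat \<Rightarrow> bool" where
  Nil: "paired [] 0"
| single: "paired w k \<Longrightarrow> paired (x # w) k"
| pair: "paired w k \<Longrightarrow> paired (EpsAt y # DelAt y # w) (Suc k)"

text \<open>The interval property for the sets of \<open>eps\<close>-labels and \<open>del\<close>-labels.\<close>

definition connected_pair :: "int set \<Rightarrow> int set \<Rightarrow> bool" where
  "connected_pair A B \<longleftrightarrow> (\<forall>x\<in>A \<inter> B. \<forall>y\<in>A \<inter> B. {x..y} \<subseteq> A \<union> B)"

lemma connected_pair_mono:
  "\<lbrakk>connected_pair A B; A' \<inter> B' = A \<inter> B; A \<union> B \<subseteq> A' \<union> B'\<rbrakk> \<Longrightarrow> connected_pair A' B'"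
  unfolding connected_pair_def by (metis order_trans)

text \<open>
  Why a word with enough pairs satisfies the interval property. Reading the word from its end, each
  pair raises \<open>card (A \<inter> B)\<close> by exactly one and each other letter does not lower it. If the number of
  pairs equals \<open>card (A \<inter> B)\<close> at the end, then single letters never raised it: an unpaired \<open>eps\<close> has
  its label outside of \<open>B\<close>, and an unpaired \<open>del\<close> that replaces \<open>d\<close> by \<open>e\<close> in \<open>A\<close> finds \<open>d\<close> in \<open>B\<close>. In the
  latter case the match at \<open>d\<close> moves to \<open>e\<close>, and the integers from \<open>e\<close> to \<open>d\<close> all are labels.
\<close>

lemma paired_connected:
  assumes "paired w k" "std_form w = (A, B)" "sorted_wrt (>) A" "sorted_wrt (<) B"
  shows "k \<le> card (set A \<inter> set B) \<and>
    (k = card (set A \<inter> set B) \<longrightarrow> connected_pair (set A) (set B))"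
  using assms
proof (induction arbitrary: A B rule: paired.induct)
  case Nil then show ?case by (simp add: connected_pair_def)
next
  case (single w k x)
  obtain A0 B0 where std0: "std_form w = (A0, B0)" by force
  show ?case
  proof (cases x)
    case (EpsAt a)
    have AB: "A = a # A0" "B = B0" using single.prems std0 EpsAt by auto
    have a: "a \<notin> set A0" using single.prems AB by auto
    have IH: "k \<le> card (set A0 \<inter> set B0)"
        "k = card (set A0 \<inter> set B0) \<Longrightarrow> connected_pair (set A0) (set B0)"
      using single.IH[OF std0] single.prems AB by auto
    show ?thesis
    proof (cases "a \<in> set B0")
      case True
      then have "card (set A \<inter> set B) = Suc (card (set A0 \<inter> set B0))" using a AB by simp
      then show ?thesis using IH by simp
    next
      case False
      then have eq: "set A \<inter> set B = set A0 \<inter> set B0" using AB by auto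
      have "set A0 \<union> set B0 \<subseteq> set A \<union> set B" using AB by auto
      then have "connected_pair (set A) (set B)" if "k = card (set A0 \<inter> set B0)"
        using connected_pair_mono[OF IH(2)[OF that] eq] by simp
      then show ?thesis using IH(1) eq by presburger
    qed
  next
    case (DelAt d)
    have A: "A = snd (pass d A0)" and B: "B = fst (pass d A0) # B0" using single.prems std0 DelAt by auto
    have sA0: "sorted_wrt (>) A0" using sorted_pass_D single.prems A by blast
    obtain e where e: "e \<le> d" "{e<..d} \<subseteq> set A0" "e \<notin> set A0"
      using run_end_below[of "set A0" d] by auto
    note pc = pass_chain[OF sA0 e]
    have B': "B = e # B0" using B pc by simp
    have eB: "e \<notin> set B0" using single.prems(3) B' by auto
    have IH: "k \<le> card (set A0 \<inter> set B0)"
        "k = card (set A0 \<inter> set B0) \<Longrightarrow> connected_pair (set A0) (set B0)"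
      using single.IH[OF std0 sA0] single.prems B' by auto
    show ?thesis
    proof (cases "e = d")
      case True
      have A': "set A = set A0" using A pc True by simp
      have eq: "set A \<inter> set B = set A0 \<inter> set B0" using A' B' e by auto
      have "set A0 \<union> set B0 \<subseteq> set A \<union> set B" using A' B' by auto
      then have "connected_pair (set A) (set B)" if "k = card (set A0 \<inter> set B0)"
        using connected_pair_mono[OF IH(2)[OF that] eq] by simp
      then show ?thesis using IH(1) eq by presburger
    next
      case False
      have A': "set A = insert e (set A0 - {d})" using A pc False by simp
      have dA: "d \<in> set A0" using e False by auto
      have eq: "set A \<inter> set B = insert e (set A0 \<inter> set B0 - {d})" using A' B' e eB by auto
      show ?thesis
      proof (cases "d \<in> set B0")
        case True
        then have dAB: "d \<in> set A0 \<inter> set B0" using dA by simp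
        have cd: "card (set A \<inter> set B) = card (set A0 \<inter> set B0)"
          unfolding eq using dAB e(3) card_Suc_Diff1[OF _ dAB] by simp
        have "connected_pair (set A) (set B)" if con: "connected_pair (set A0) (set B0)"
          unfolding connected_pair_def eq
        proof (intro ballI subsetI)
          fix x y z assume x: "x \<in> insert e (set A0 \<inter> set B0 - {d})"
            and y: "y \<in> insert e (set A0 \<inter> set B0 - {d})" and z: "z \<in> {x..y}"
          have un: "set A \<union> set B = insert e (set A0 \<union> set B0)" using A' B' True by auto
          consider "z = e" | "e < z" "z \<le> d" | "d < z" | "z < e" by linarith
          then show "z \<in> set A \<union> set B"
          proof cases
            case 3
            then have "z \<in> {d..y}" "y \<in> set A0 \<inter> set B0" using y z e by auto
            then show ?thesis using con dAB un unfolding connected_pair_def by blast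
          next
            case 4
            then have "x \<in> set A0 \<inter> set B0" "z \<in> {x..d}" using x z e by auto
            then show ?thesis using con dAB un unfolding connected_pair_def by blast
          qed (use un e in auto)
        qed
        then show ?thesis using IH cd by simp
      next
        case False
        have "card (set A \<inter> set B) = Suc (card (set A0 \<inter> set B0))"
          unfolding eq using False e by simp
        then show ?thesis using IH by simp
      qed
    qed
  qed
next
  case (pair w k y)
  obtain A0 B0 where std0: "std_form w = (A0, B0)" by force
  have A: "A = y # snd (pass y A0)" and B: "B = fst (pass y A0) # B0" using pair.prems std0 by auto
  have sA0: "sorted_wrt (>) A0" using sorted_pass_D pair.prems A by auto
  obtain e where e: "e \<le> y" "{e<..y} \<subseteq> set A0" "e \<notin> set A0"
    using run_end_below[of "set A0" y] by auto
  note pc = pass_chain[OF sA0 e]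
  have B': "B = e # B0" using B pc by simp
  have eB: "\<forall>b\<in>set B0. e < b" using pair.prems(3) B' by auto
  have IH: "k \<le> card (set A0 \<inter> set B0)"
      "k = card (set A0 \<inter> set B0) \<Longrightarrow> connected_pair (set A0) (set B0)"
    using pair.IH[OF std0 sA0] pair.prems B' by auto
  have A': "set A = insert e (set A0)"
  proof (cases "e = y")
    case False
    then have "y \<in> set A0" using e(1,2) by auto
    then show ?thesis using A pc(3) False by auto
  qed (use A pc(3) in simp)
  have "\<forall>a\<in>set A. a \<le> y" using pair.prems(2) unfolding A by auto
  then have ly: "\<forall>a\<in>set A0. a \<le> y" unfolding A' by auto
  have eq: "set A \<inter> set B = insert e (set A0 \<inter> set B0)" using A' B' eB e by auto
  have cd: "card (set A \<inter> set B) = Suc (card (set A0 \<inter> set B0))"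
    unfolding eq using e by simp
  have "connected_pair (set A) (set B)" if con: "connected_pair (set A0) (set B0)"
    unfolding connected_pair_def eq
  proof (intro ballI subsetI)
    fix u v z assume u: "u \<in> insert e (set A0 \<inter> set B0)"
      and v: "v \<in> insert e (set A0 \<inter> set B0)" and z: "z \<in> {u..v}"
    show "z \<in> set A \<union> set B"
    proof (cases "u = e")
      case True
      have "v \<le> y" using v ly e(1) by auto
      then have "z = e \<or> z \<in> {e<..y}" using z True by auto
      then show ?thesis using A' e(2) by blast
    next
      case False
      then have u': "u \<in> set A0 \<inter> set B0" using u by blast
      then have "e < v" using eB z by fastforce
      then have "v \<in> set A0 \<inter> set B0" using v by blast
      with u' have "z \<in> set A0 \<union> set B0" using con z unfolding connected_pair_def by blast
      then show ?thesis using A' B' by auto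
    qed
  qed
  then show ?case using IH cd by simp
qed

definition std_form_sets :: "letter list \<Rightarrow> int set \<Rightarrow> int set \<Rightarrow> bool" where
  "std_form_sets w A B \<longleftrightarrow> set (fst (std_form w)) = A \<and> set (snd (std_form w)) = B \<and>
    sorted_wrt (>) (fst (std_form w)) \<and> sorted_wrt (<) (snd (std_form w))"

text \<open>
  The converse construction splits off the first letter of the desired word, by induction on the
  number of labels. A maximal \<open>eps\<close>-label outside of \<open>B\<close> and a minimal \<open>del\<close>-label outside of \<open>A\<close>
  cross nothing of equal label and can be put in front as they are. If both extreme labels are matched, \<open>pass_chain\<close> is
  applied backwards to the minimal matched label \<open>x\<close>: either the integers from \<open>x\<close> to the maximum
  \<open>y\<close> of \<open>A\<close> all lie in \<open>A\<close>, and a pair with label \<open>y\<close> creates the match at \<open>x\<close>, or the first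
  missing integer \<open>d\<close> lies in \<open>B\<close>, and a \<open>del\<close> with label \<open>d\<close> moves the match from \<open>d\<close> to \<open>x\<close>.
\<close>

lemma connected_paired:
  assumes "finite A" "finite B" "connected_pair A B"
  shows "\<exists>w. paired w (card (A \<inter> B)) \<and> std_form_sets w A B"
  using assms
proof (induction "card A + card B" arbitrary: A B rule: less_induct)
  case less
  note fin = less.prems(1,2) and con = less.prems(3)
  consider (empty) "A = {}" "B = {}" | (maxA) "A \<noteq> {}" "Max A \<notin> B" | (minB) "B \<noteq> {}" "Min B \<notin> A"
    | (both) "A \<noteq> {}" "B \<noteq> {}" "Max A \<in> B" "Min B \<in> A" by blast
  then show ?case
  proof cases
    case empty
    then show ?thesis by (intro exI[of _ "[]"]) (auto intro: paired.Nil simp: std_form_sets_def)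
  next
    case maxA
    define a where "a = Max A"
    have a: "a \<in> A" "\<forall>x\<in>A. x \<le> a" "a \<notin> B" using maxA fin by (auto simp: a_def)
    have eq: "(A - {a}) \<inter> B = A \<inter> B" using a by auto
    have "connected_pair (A - {a}) B" unfolding connected_pair_def eq
    proof (intro ballI subsetI)
      fix x y z assume x: "x \<in> A \<inter> B" and y: "y \<in> A \<inter> B" and z: "z \<in> {x..y}"
      have "z \<noteq> a" using z y a by (metis Int_iff atLeastAtMost_iff nle_le)
      then show "z \<in> A - {a} \<union> B" using con x y z unfolding connected_pair_def by blast
    qed
    moreover have "card (A - {a}) + card B < card A + card B"
      using a fin by (intro add_strict_right_mono card_Diff1_less)
    ultimately have "\<exists>w. paired w (card ((A - {a}) \<inter> B)) \<and> std_form_sets w (A - {a}) B"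
      using less.hyps[of "A - {a}" B] fin by simp
    then obtain w where w: "paired w (card (A \<inter> B))" "std_form_sets w (A - {a}) B" unfolding eq by blast
    note std = w(2)[unfolded std_form_sets_def]
    show ?thesis
      using w(1) std a
      by (intro exI[of _ "EpsAt a # w"] conjI paired.single) (auto simp: std_form_sets_def le_less)
  next
    case minB
    define b where "b = Min B"
    have b: "b \<in> B" "\<forall>x\<in>B. b \<le> x" "b \<notin> A" using minB fin by (auto simp: b_def)
    have eq: "A \<inter> (B - {b}) = A \<inter> B" using b by auto
    have "connected_pair A (B - {b})" unfolding connected_pair_def eq
    proof (intro ballI subsetI)
      fix x y z assume x: "x \<in> A \<inter> B" and y: "y \<in> A \<inter> B" and z: "z \<in> {x..y}"
      have "z \<noteq> b" using z x b by (metis Int_iff atLeastAtMost_iff nle_le)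
      then show "z \<in> A \<union> (B - {b})" using con x y z unfolding connected_pair_def by blast
    qed
    moreover have "card A + card (B - {b}) < card A + card B"
      using b fin by (intro add_strict_left_mono card_Diff1_less)
    ultimately have "\<exists>w. paired w (card (A \<inter> (B - {b}))) \<and> std_form_sets w A (B - {b})"
      using less.hyps[of A "B - {b}"] fin by simp
    then obtain w where w: "paired w (card (A \<inter> B))" "std_form_sets w A (B - {b})" unfolding eq by blast
    note std = w(2)[unfolded std_form_sets_def]
    have pc: "fst (pass b (fst (std_form w))) = b" "sorted_wrt (>) (snd (pass b (fst (std_form w))))"
       "set (snd (pass b (fst (std_form w)))) = A"
      using pass_chain[of "fst (std_form w)" b b] std b by simp_all
    show ?thesis
      using w(1) std b pc
      by (intro exI[of _ "DelAt b # w"] conjI paired.single) (auto simp: std_form_sets_def le_less)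
  next
    case both
    define x where "x = Min B"
    define y where "y = Max A"
    have x: "x \<in> B" "x \<in> A" "\<forall>b\<in>B. x \<le> b" using both fin by (auto simp: x_def)
    have y: "y \<in> A" "y \<in> B" "\<forall>a\<in>A. a \<le> y" using both fin by (auto simp: y_def)
    have fill: "{x..y} \<subseteq> A \<union> B" using con x y unfolding connected_pair_def by blast
    have xAB: "x \<in> A \<inter> B" using x by simp
    show ?thesis
    proof (cases "{x..y} \<subseteq> A")
      case True
      have eq: "(A - {x}) \<inter> (B - {x}) = A \<inter> B - {x}" by auto
      have "connected_pair (A - {x}) (B - {x})" unfolding connected_pair_def eq
      proof (intro ballI subsetI)
        fix u v z assume u: "u \<in> A \<inter> B - {x}" and v: "v \<in> A \<inter> B - {x}" and z: "z \<in> {u..v}"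
        have "z \<noteq> x" using z u x by force
        then show "z \<in> A - {x} \<union> (B - {x})" using con u v z unfolding connected_pair_def by blast
      qed
      moreover have "card (A - {x}) + card (B - {x}) < card A + card B"
        using x fin by (intro add_strict_mono card_Diff1_less)
      ultimately have "\<exists>w. paired w (card ((A - {x}) \<inter> (B - {x}))) \<and> std_form_sets w (A - {x}) (B - {x})"
        using less.hyps[of "A - {x}" "B - {x}"] fin by simp
      then obtain w where w: "paired w (card (A \<inter> B - {x}))" "std_form_sets w (A - {x}) (B - {x})"
        unfolding eq by blast
      note std = w(2)[unfolded std_form_sets_def]
      have xy: "x \<le> y" using x y by auto
      \<comment> \<open>Without \<open>x\<close> the row has the string \<open>y, \<dots>, x + 1\<close>, so the \<open>del\<close> of the pair ends at \<open>x\<close>.\<close>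
      have run: "{x<..y} \<subseteq> A - {x}" using True by (auto simp: subset_iff)
      have pc: "fst (pass y (fst (std_form w))) = x" "sorted_wrt (>) (snd (pass y (fst (std_form w))))"
         "set (snd (pass y (fst (std_form w)))) = (if x = y then A - {x} else insert x (A - {x} - {y}))"
        using pass_chain[of "fst (std_form w)" x y] xy run std by simp_all
      have "paired (EpsAt y # DelAt y # w) (card (A \<inter> B))"
        using paired.pair[OF w(1)] card_Suc_Diff1[OF _ xAB] fin by simp
      moreover have below: "\<forall>a\<in>set (snd (pass y (fst (std_form w)))). a < y"
        using pc(3) y(3) xy by (force simp: le_less split: if_splits)
      moreover have "insert y (set (snd (pass y (fst (std_form w))))) = A"
        unfolding pc(3) using x y by auto
      moreover have "\<forall>b\<in>B - {x}. x < b" using x by (auto simp: le_less)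
      ultimately show ?thesis
        using std pc(1,2) x(1)
        by (intro exI[of _ "EpsAt y # DelAt y # w"]) (simp add: std_form_sets_def insert_absorb)
    next
      case False
      \<comment> \<open>The smallest gap \<open>d\<close> of \<open>A\<close> above \<open>x\<close>. The row \<open>A0\<close> has the string \<open>d, \<dots>, x + 1\<close>.\<close>
      define F where "F = {x..y} - A"
      have "F \<noteq> {}" "finite F" using False by (auto simp: F_def)
      define d where "d = Min F"
      have "d \<in> F" and dm: "\<forall>u\<in>F. d \<le> u" using \<open>F \<noteq> {}\<close> \<open>finite F\<close> by (auto simp: d_def)
      then have "d \<notin> A" "x \<le> d" "d \<le> y" by (simp_all add: F_def)
      moreover have "x \<noteq> d" using x(2) calculation(1) by blast
      ultimately have d: "d \<notin> A" "x < d" "d \<le> y" by simp_all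
      have run: "{x..<d} \<subseteq> A"
      proof
        fix u assume u: "u \<in> {x..<d}"
        then have "u \<notin> F" using dm by force
        then show "u \<in> A" using u d unfolding F_def by auto
      qed
      have dB: "d \<in> B" using subsetD[OF fill, of d] d by simp
      define A0 where "A0 = insert d (A - {x})"
      have eq: "A0 \<inter> (B - {x}) = insert d (A \<inter> B - {x})" using dB d by (auto simp: A0_def)
      have "connected_pair A0 (B - {x})" unfolding connected_pair_def eq
      proof (intro ballI subsetI)
        fix u v z assume u: "u \<in> insert d (A \<inter> B - {x})" and v: "v \<in> insert d (A \<inter> B - {x})"
          and z: "z \<in> {u..v}"
        have "x < u" using u x d by force
        moreover have "v \<le> y" using v y d by auto
        ultimately have "z \<in> {x..y}" "z \<noteq> x" using z by auto
        then have "z \<in> A \<union> B" "z \<noteq> x" using subsetD[OF fill] by simp_all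
        then show "z \<in> A0 \<union> (B - {x})" by (auto simp: A0_def)
      qed
      moreover have "card A0 = card A" 
        using d(1) fin card_Suc_Diff1[OF fin(1) x(2)] by (simp add: A0_def)
      moreover have "card (B - {x}) < card B" using x fin by (intro card_Diff1_less)
      moreover have cd: "card (A0 \<inter> (B - {x})) = card (A \<inter> B)"
        unfolding eq using d fin card_Suc_Diff1[OF _ xAB] by simp
      moreover have "finite A0" using fin by (simp add: A0_def)
      ultimately have "\<exists>w. paired w (card (A \<inter> B)) \<and> std_form_sets w A0 (B - {x})"
        using less.hyps[of "A0" "B - {x}"] fin by simp
      then obtain w where w: "paired w (card (A \<inter> B))" "std_form_sets w A0 (B - {x})" by blast
      note std = w(2)[unfolded std_form_sets_def]
      have "{x<..d} \<subseteq> A0" "x \<notin> A0" using run d by (auto simp: A0_def)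
      then have pc: "fst (pass d (fst (std_form w))) = x" "sorted_wrt (>) (snd (pass d (fst (std_form w))))"
         "set (snd (pass d (fst (std_form w)))) = A"
        using pass_chain[of "fst (std_form w)" x d] std d x by (auto simp: A0_def)
      show ?thesis
        using w(1) std x pc
        by (intro exI[of _ "DelAt d # w"] conjI paired.single) (auto simp: std_form_sets_def le_less)
    qed
  qed
qed

text \<open>
  The largest number of disjoint pairs of letters of different type with equal labels,
  counted value by value.
\<close>

definition match_number :: "letter list \<Rightarrow> nat" where
  "match_number w =
    (\<Sum>v\<in>{v. EpsAt v \<in> set w}. min (count_list w (EpsAt v)) (count_list w (DelAt v)))"

definition core :: "letter list \<Rightarrow> int \<Rightarrow> int" where
  "core w v = int (count_list w (EpsAt v)) - int (count_list w (DelAt v))"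

text \<open>A crossing changes the label of one \<open>eps\<close> and of the \<open>del\<close> simultaneously from \<open>d\<close> to \<open>d - 1\<close>.\<close>

lemma core_pass:
  "int (count_list (snd (pass d A)) v) - of_bool (fst (pass d A) = v) =
   int (count_list A v) - of_bool (d = v)"
proof (induction A arbitrary: d)
  case (Cons a A)
  show ?case using Cons.IH[of d] Cons.IH[of "d - 1"] by (auto split: if_splits)
qed simp

lemma core_std_form: "core w v = int (count_list (fst (std_form w)) v) - int (count_list (snd (std_form w)) v)"
proof (induction w rule: std_form.induct)
  case (3 d w)
  then show ?case using core_pass[of d "fst (std_form w)" v] by (auto simp: core_def split: if_splits)
qed (auto simp: core_def)

lemma finite_eps_values: "finite {v. EpsAt v \<in> set w}"
  by (rule finite_subset[of _ "(\<lambda>x. case x of EpsAt v \<Rightarrow> v | DelAt v \<Rightarrow> v) ` set w"])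
    (auto intro!: image_eqI[where x = "EpsAt _"])

lemma sum_count_eps:
  assumes "finite R" "{v. EpsAt v \<in> set w} \<subseteq> R"
  shows "(\<Sum>v\<in>R. count_list w (EpsAt v)) = length (filter is_eps w)"
  using assms
proof (induction w)
  case (Cons x w)
  show ?case
  proof (cases x)
    case (EpsAt a)
    then have "a \<in> R" using Cons.prems by auto
    have "(\<Sum>v\<in>R. count_list (x # w) (EpsAt v)) = (\<Sum>v\<in>R. count_list w (EpsAt v) + (if v = a then 1 else 0))"
      by (rule sum.cong) (auto simp: EpsAt)
    also have "\<dots> = (\<Sum>v\<in>R. count_list w (EpsAt v)) + 1"
      using \<open>a \<in> R\<close> Cons.prems by (simp add: sum.distrib)
    also have "(\<Sum>v\<in>R. count_list w (EpsAt v)) = length (filter is_eps w)"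
      by (rule Cons.IH) (use Cons.prems in auto)
    finally show ?thesis by (simp add: EpsAt)
  next
    case (DelAt d)
    have "(\<Sum>v\<in>R. count_list w (EpsAt v)) = length (filter is_eps w)"
      by (rule Cons.IH) (use Cons.prems in auto)
    then show ?thesis by (simp add: DelAt)
  qed
qed simp

text \<open>
  The number of matches is determined by the number of \<open>eps\<close> and by the core, because
  \<open>min c d = c - max 0 (c - d)\<close>. This makes it invariant under odd reflections.
\<close>

lemma match_number_core:
  assumes "finite R" "{v. EpsAt v \<in> set w} \<subseteq> R"
  shows "int (match_number w) = int (length (filter is_eps w)) - (\<Sum>v\<in>R. max 0 (core w v))"
proof -
  have "int (match_number w) =
      (\<Sum>v\<in>R. int (min (count_list w (EpsAt v)) (count_list w (DelAt v))))"
    unfolding match_number_def of_nat_sum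
    by (rule sum.mono_neutral_left) (use assms in \<open>auto simp: count_list_0_iff\<close>)
  also have "\<dots> = (\<Sum>v\<in>R. int (count_list w (EpsAt v)) - max 0 (core w v))"
    by (rule sum.cong) (auto simp: core_def)
  also have "\<dots> = int (\<Sum>v\<in>R. count_list w (EpsAt v)) - (\<Sum>v\<in>R. max 0 (core w v))"
    by (simp add: sum_subtractf)
  finally show ?thesis using sum_count_eps[OF assms] by simp
qed

lemma count_list_distinct: "distinct xs \<Longrightarrow> count_list xs x = (if x \<in> set xs then 1 else 0)"
  by (induction xs) auto

lemma match_number_std_form:
  assumes "std_form w = (A, B)" "distinct A" "distinct B"
  shows "match_number w = card (set A \<inter> set B)"
proof -
  define R where "R = {v. EpsAt v \<in> set w} \<union> set A"
  have R: "finite R" "{v. EpsAt v \<in> set w} \<subseteq> R" "set A \<subseteq> R"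
    by (auto simp: R_def finite_eps_values)
  have "max 0 (core w v) = (if v \<in> set A - set B then 1 else 0)" for v
    using assms by (simp add: core_std_form count_list_distinct)
  moreover have "R \<inter> {v \<in> set A. v \<notin> set B} = set A - set B" using R(3) by blast
  ultimately have "(\<Sum>v\<in>R. max 0 (core w v)) = int (card (set A - set B))"
    using R(1) \<open>R \<inter> {v \<in> set A. v \<notin> set B} = set A - set B\<close> by (simp add: sum.If_cases)
  moreover have "length (filter is_eps w) = card (set A)"
    using length_std_form(1)[of w] assms by (simp add: distinct_card)
  moreover have "card (set A - set B) = card (set A) - card (set A \<inter> set B)"
    by (simp add: card_Diff_subset_Int)
  moreover have "card (set A \<inter> set B) \<le> card (set A)" by (simp add: card_mono)
  ultimately show ?thesis using match_number_core[OF R(1,2)] by simp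
qed

section \<open>Highest weight vectors and odd reflections in modules\<close>

definition mat_unit :: "'m + 'n \<Rightarrow> 'm + 'n \<Rightarrow> ('m::finite, 'n::finite) gl" where
  "mat_unit p q = (\<chi> i j. if i = p \<and> j = q then 1 else 0)"

definition bvec :: "'m + 'n \<Rightarrow> ('m::finite, 'n::finite) weight" where
  "bvec p = axis p 1"

lemma bvec_nth: "bvec p $ i = (if i = p then 1 else 0)"
  by (simp add: bvec_def axis_def)

lemma mat_unit_mult:
  "mat_unit p q ** mat_unit r s = (if q = r then mat_unit p s else 0)"
proof -
  have "(\<Sum>k\<in>UNIV. (if i = p \<and> k = q then 1 else 0) * (if k = r \<and> j = s then 1 else 0 :: complex)) =
      (if q = r \<and> i = p \<and> j = s then 1 else 0)" for i j
  proof -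
    have "(\<Sum>k\<in>UNIV. (if i = p \<and> k = q then 1 else 0) * (if k = r \<and> j = s then 1 else 0 :: complex)) =
        (\<Sum>k\<in>UNIV. if k = q then (if i = p \<and> q = r \<and> j = s then 1 else 0) else 0)"
      by (rule sum.cong) auto
    then show ?thesis by simp
  qed
  then show ?thesis by (auto simp: vec_eq_iff matrix_matrix_mult_def mat_unit_def)
qed

lemma diagonal_mult_mat_unit:
  assumes "H \<in> cartan"
  shows "H ** mat_unit p q = map_matrix ((*) (H $ p $ p)) (mat_unit p q)"
    "mat_unit p q ** H = map_matrix ((*) (H $ q $ q)) (mat_unit p q)"
proof -
  have "(\<Sum>k\<in>UNIV. H $ i $ k * (if k = p \<and> j = q then 1 else 0)) =
      H $ p $ p * (if i = p \<and> j = q then 1 else 0)" for i j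
  proof -
    have "(\<Sum>k\<in>UNIV. H $ i $ k * (if k = p \<and> j = q then 1 else 0)) =
        (\<Sum>k\<in>UNIV. if k = p then H $ i $ p * (if j = q then 1 else 0) else 0)"
      by (rule sum.cong) auto
    then show ?thesis using assms by (auto simp: cartan_def)
  qed
  then show "H ** mat_unit p q = map_matrix ((*) (H $ p $ p)) (mat_unit p q)"
    by (simp add: vec_eq_iff matrix_matrix_mult_def mat_unit_def map_matrix_def)
  have "(\<Sum>k\<in>UNIV. (if i = p \<and> k = q then 1 else 0) * H $ k $ j) =
      H $ q $ q * (if i = p \<and> j = q then 1 else 0)" for i j
  proof -
    have "(\<Sum>k\<in>UNIV. (if i = p \<and> k = q then 1 else 0) * H $ k $ j) =
        (\<Sum>k\<in>UNIV. if k = q then H $ q $ j * (if i = p then 1 else 0) else 0)"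
      by (rule sum.cong) auto
    then show ?thesis using assms by (auto simp: cartan_def)
  qed
  then show "mat_unit p q ** H = map_matrix ((*) (H $ q $ q)) (mat_unit p q)"
    by (simp add: vec_eq_iff matrix_matrix_mult_def mat_unit_def map_matrix_def)
qed

lemma mat_unit_gl_part: "mat_unit p q \<in> gl_part (parity p + parity q)"
  by (auto simp: gl_part_def mat_unit_def)

lemma matrix_expand:
  "X = (\<Sum>p\<in>UNIV. \<Sum>q\<in>UNIV. map_matrix ((*) (X $ p $ q)) (mat_unit p q))"
proof -
  have "(\<Sum>p\<in>UNIV. \<Sum>q\<in>UNIV. X $ p $ q * (if i = p \<and> j = q then 1 else 0)) = X $ i $ j" for i j
  proof -
    have "(\<Sum>p\<in>UNIV. \<Sum>q\<in>UNIV. X $ p $ q * (if i = p \<and> j = q then 1 else 0)) =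
        (\<Sum>p\<in>UNIV. \<Sum>q\<in>UNIV. if q = j then (if p = i then X $ i $ j else 0) else 0)"
      by (intro sum.cong) auto
    then show ?thesis by simp
  qed
  then show ?thesis by (simp add: vec_eq_iff mat_unit_def map_matrix_def)
qed

context gl_module
begin

lemma act_zero_left [simp]: "act 0 v = 0"
  using act_add_left[of 0 0 v] by simp

lemma act_zero_right [simp]: "act X 0 = 0"
  using act_add_right[of X 0 0] by simp

lemma act_uminus_left: "act (- X) v = - act X v"
  using act_add_left[of X "- X" v] by (simp add: eq_neg_iff_add_eq_0 add.commute)

lemma act_diff_left: "act (X - Y) v = act X v - act Y v"
  using act_add_left[of X "- Y" v] by (simp add: act_uminus_left)

lemma act_sum_left: "act (\<Sum>a\<in>A. f a) v = (\<Sum>a\<in>A. act (f a) v)"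
  by (induction A rule: infinite_finite_induct) (auto simp: act_add_left)

lemma act_sum_right: "act X (\<Sum>a\<in>A. f a) = (\<Sum>a\<in>A. act X (f a))"
  by (induction A rule: infinite_finite_induct) (auto simp: act_add_right)

lemma act_expand:
  "act X v = (\<Sum>p\<in>UNIV. \<Sum>q\<in>UNIV. scale (X $ p $ q) (act (mat_unit p q) v))"
  by (subst matrix_expand[of X]) (simp only: act_sum_left act_scale_left)

lemma act_cartan:
  assumes "H \<in> cartan"
  shows "act H v = (\<Sum>p\<in>UNIV. scale (H $ p $ p) (act (mat_unit p p) v))"
proof -
  have "(\<Sum>q\<in>UNIV. scale (H $ p $ q) (act (mat_unit p q) v)) = scale (H $ p $ p) (act (mat_unit p p) v)" for p
  proof -
    have "(\<Sum>q\<in>UNIV. scale (H $ p $ q) (act (mat_unit p q) v)) =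
        (\<Sum>q\<in>UNIV. if q = p then scale (H $ p $ p) (act (mat_unit p p) v) else 0)"
      by (rule sum.cong) (use assms in \<open>auto simp: cartan_def\<close>)
    then show ?thesis by simp
  qed
  then show ?thesis by (simp add: act_expand[of H])
qed

definition super_sign :: "'m + 'n \<Rightarrow> 'm + 'n \<Rightarrow> 'm + 'n \<Rightarrow> 'm + 'n \<Rightarrow> complex" where
  "super_sign p q r s = (if parity p + parity q = 1 \<and> parity r + parity s = 1 then - 1 else 1)"

text \<open>All supercommutation rules of matrix units in one equation, as a rewriting rule that moves the left factor to the right.\<close>

lemma act_mat_unit_commute:
  "act (mat_unit p q) (act (mat_unit r s) v) =
     scale (super_sign p q r s) (act (mat_unit r s) (act (mat_unit p q) v))
     + (if q = r then act (mat_unit p s) v else 0)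
     - scale (super_sign p q r s) (if s = p then act (mat_unit r q) v else 0)"
proof (cases "parity p + parity q = 1 \<and> parity r + parity s = 1")
  case True
  then have "act (mat_unit p q) (act (mat_unit r s) v) + act (mat_unit r s) (act (mat_unit p q) v) =
      act (mat_unit p q ** mat_unit r s) v + act (mat_unit r s ** mat_unit p q) v"
    using act_sbracket[OF mat_unit_gl_part[of p q] mat_unit_gl_part[of r s], of v]
    by (simp add: sbracket_def act_add_left)
  moreover have "super_sign p q r s = - 1" using True by (simp add: super_sign_def)
  ultimately have eq: "act (mat_unit p q) (act (mat_unit r s) v) =
      act (mat_unit p q ** mat_unit r s) v + act (mat_unit r s ** mat_unit p q) v
      - act (mat_unit r s) (act (mat_unit p q) v)" and "super_sign p q r s = - 1"
    by (simp_all only: eq_diff_eq)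
  then show ?thesis unfolding eq by (simp add: mat_unit_mult)
next
  case False
  then have "act (mat_unit p q) (act (mat_unit r s) v) - act (mat_unit r s) (act (mat_unit p q) v) =
      act (mat_unit p q ** mat_unit r s) v - act (mat_unit r s ** mat_unit p q) v"
    using act_sbracket[OF mat_unit_gl_part[of p q] mat_unit_gl_part[of r s], of v]
    by (simp add: sbracket_def act_diff_left del: de_Morgan_conj)
  moreover have "super_sign p q r s = 1" using False by (simp add: super_sign_def)
  ultimately have eq: "act (mat_unit p q) (act (mat_unit r s) v) =
      act (mat_unit p q ** mat_unit r s) v - act (mat_unit r s ** mat_unit p q) v
      + act (mat_unit r s) (act (mat_unit p q) v)" and "super_sign p q r s = 1"
    by (simp_all only: diff_eq_eq)
  then show ?thesis unfolding eq by (simp add: mat_unit_mult)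
qed

lemma act_cartan_mat_unit:
  assumes "H \<in> cartan"
  shows "act H (act (mat_unit p q) v) =
    act (mat_unit p q) (act H v) + scale (H $ p $ p - H $ q $ q) (act (mat_unit p q) v)"
proof -
  have "H \<in> gl_part 0"
  proof -
    have "parity i + parity i = 0" for i :: "'m + 'n" by (cases i) auto
    then have "parity i + parity j = 0" if "H $ i $ j \<noteq> 0" for i j
      using assms that unfolding cartan_def mem_Collect_eq by metis
    then show ?thesis by (simp add: gl_part_def)
  qed
  from act_sbracket[OF this mat_unit_gl_part[of p q], of v]
  have "act H (act (mat_unit p q) v) - act (mat_unit p q) (act H v) =
      act (H ** mat_unit p q) v - act (mat_unit p q ** H) v"
    by (simp add: sbracket_def act_diff_left)
  then show ?thesis
    by (simp add: diagonal_mult_mat_unit[OF assms] act_scale_left algebra_simps)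
qed

text \<open>
  Highest weight vectors with respect to the Borel subalgebra spanned by the matrix units with
  \<open>P p \<le> P q\<close>, where \<open>P\<close> gives the positions of the indices in some order.
\<close>

definition hw :: "('m + 'n \<Rightarrow> nat) \<Rightarrow> ('m, 'n) weight \<Rightarrow> 'v \<Rightarrow> bool" where
  "hw P \<Lambda> v \<longleftrightarrow> v \<noteq> 0 \<and> (v \<in> V 0 \<or> v \<in> V 1) \<and>
     (\<forall>p. act (mat_unit p p) v = scale (\<Lambda> $ p) v) \<and>
     (\<forall>p q. P p < P q \<longrightarrow> act (mat_unit p q) v = 0)"

text \<open>
  Products of lowering operators applied to \<open>v\<close>. The number is the sum of the distances of the positions of
  their row and column indices; it is zero only for \<open>v\<close> itself.
\<close>

inductive monomial :: "('m + 'n \<Rightarrow> nat) \<Rightarrow> 'v \<Rightarrow> nat \<Rightarrow> 'v \<Rightarrow> bool" for P v where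
  base: "monomial P v 0 v"
| lower: "monomial P v k w \<Longrightarrow> P p < P q \<Longrightarrow>
    monomial P v (k + (P q - P p)) (act (mat_unit q p) w)"

definition monomial_span :: "('m + 'n \<Rightarrow> nat) \<Rightarrow> 'v \<Rightarrow> 'v set" where
  "monomial_span P v = span {w. \<exists>k. monomial P v k w}"

lemma act_mat_unit_homogeneous:
  assumes "w \<in> V 0 \<or> w \<in> V 1"
  shows "act (mat_unit p q) w \<in> V 0 \<or> act (mat_unit p q) w \<in> V 1"
proof -
  obtain b where "w \<in> V b" using assms by blast
  then have "act (mat_unit p q) w \<in> V (parity p + parity q + b)"
    by (rule act_parity[OF mat_unit_gl_part])
  then show ?thesis by (cases "parity p + parity q + b") auto
qed

lemma act_mem_subspace:
  assumes "subspace W" "\<And>p q. act (mat_unit p q) w \<in> W"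
  shows "act X w \<in> W"
  unfolding act_expand[of X] by (intro subspace_sum subspace_scale assms)

lemma linear_image_span:
  assumes "\<And>w. w \<in> S \<Longrightarrow> act X w \<in> W" "subspace W" "w \<in> span S"
  shows "act X w \<in> W"
  using assms(3)
proof (induction rule: span_induct_alt)
  case base then show ?case using assms(2) by (simp add: subspace_0)
next
  case (step c x y)
  then show ?case using assms by (simp add: act_add_right act_scale_right subspace_add subspace_scale)
qed

text \<open>
  No ordering of the monomials is needed for the invariance of their span under all of gl(m|n): an arbitrary matrix unit can be
  moved past the outermost lowering operator, and the commutator is again a combination of matrix units acting on a
  shorter monomial.
\<close>

lemma submodule_monomial_span:
  assumes hw: "hw P \<Lambda> v" and P: "inj P"
  shows "submodule (monomial_span P v)"
proof -
  define S where "S = {w. \<exists>k. monomial P v k w}"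
  have N: "monomial_span P v = span S" by (simp add: monomial_span_def S_def)
  have lower: "act (mat_unit q p) w \<in> span S" if "P p < P q" "w \<in> span S" for p q w
  proof (rule linear_image_span[OF _ subspace_span that(2)])
    fix x assume "x \<in> S"
    then have "act (mat_unit q p) x \<in> S" using monomial.lower[OF _ that(1)] unfolding S_def by blast
    then show "act (mat_unit q p) x \<in> span S" by (rule span_base)
  qed
  have closed: "\<forall>r s. act (mat_unit r s) w \<in> span S" if "monomial P v k w" for k w
    using that
  proof (induction rule: monomial.induct)
    case base
    have v: "v \<in> span S" by (auto simp: S_def intro!: span_base monomial.base)
    show ?case
    proof (intro allI)
      fix r s
      consider "P r < P s" | "P s < P r" | "r = s" using P by (metis injD linorder_less_linear)
      then show "act (mat_unit r s) v \<in> span S"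
      proof cases
        case 1 then show ?thesis using hw by (simp add: hw_def span_zero)
      next
        case 2 then show ?thesis using lower v by blast
      next
        case 3 then show ?thesis using hw v by (simp add: hw_def span_scale)
      qed
    qed
  next
    case (lower k w p q)
    show ?case
    proof (intro allI)
      fix r s
      have "act (mat_unit q p) (act (mat_unit r s) w) \<in> span S"
        using \<open>\<And>w q p. P p < P q \<Longrightarrow> w \<in> span S \<Longrightarrow> act (mat_unit q p) w \<in> span S\<close> lower by blast
      then show "act (mat_unit r s) (act (mat_unit q p) w) \<in> span S"
        unfolding act_mat_unit_commute[of r s q p]
        using lower.IH by (auto intro!: span_add span_diff span_scale span_zero)
    qed
  qed
  have homog: "w \<in> V 0 \<or> w \<in> V 1" if "monomial P v k w" for k w
    using that by (induction rule: monomial.induct)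
      (use hw act_mat_unit_homogeneous in \<open>auto simp: hw_def\<close>)
  show ?thesis unfolding submodule_def N
  proof (intro conjI allI ballI)
    show "subspace (span S)" by simp
    fix w assume w: "w \<in> span S"
    show "act X w \<in> span S" for X
    proof (rule linear_image_span[OF _ subspace_span w])
      fix x assume "x \<in> S"
      then have "\<forall>r s. act (mat_unit r s) x \<in> span S" using closed by (auto simp: S_def)
      then show "act X x \<in> span S" by (simp add: act_mem_subspace)
    qed
    show "\<exists>x\<in>span S \<inter> V 0. \<exists>y\<in>span S \<inter> V 1. w = x + y"
      using w
    proof (induction rule: span_induct_alt)
      case base
      show ?case by (rule bexI[of _ 0], rule bexI[of _ 0]) (auto simp: span_zero subspace_0 subspace_V)
    next
      case (step c x y)
      obtain y0 y1 where y: "y0 \<in> span S \<inter> V 0" "y1 \<in> span S \<inter> V 1" "y = y0 + y1"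
        using step by blast
      have x: "x \<in> span S" using step by (simp add: span_base)
      have "x \<in> V 0 \<or> x \<in> V 1" using step homog by (auto simp: S_def)
      then show ?case
      proof
        assume "x \<in> V 0"
        then have "scale c x + y0 \<in> span S \<inter> V 0" using x y
          by (auto intro!: span_add span_scale subspace_add subspace_scale subspace_V)
        then show ?thesis using y by (metis add.assoc)
      next
        assume "x \<in> V 1"
        then have "scale c x + y1 \<in> span S \<inter> V 1" using x y
          by (auto intro!: span_add span_scale subspace_add subspace_scale subspace_V)
        then show ?thesis using y by (metis add.left_commute)
      qed
    qed
  qed
qed

lemma eigenvectors_independent:
  assumes "finite K" "inj_on \<mu> K" "\<And>k. k \<in> K \<Longrightarrow> act H (u k) = scale (\<mu> k) (u k)"
    "(\<Sum>k\<in>K. u k) = 0" "k \<in> K"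
  shows "u k = 0"
  using assms
proof (induction K arbitrary: u k rule: finite_induct)
  case (insert a K)
  have rest: "u k = 0" if "k \<in> K" for k
  proof -
    have "(\<Sum>k\<in>insert a K. scale (\<mu> k) (u k)) = act H (\<Sum>k\<in>insert a K. u k)"
      unfolding act_sum_right by (rule sum.cong) (use insert.prems in auto)
    also have "\<dots> = 0" using insert.prems by simp
    finally have "(\<Sum>k\<in>insert a K. scale (\<mu> k - \<mu> a) (u k)) = 0"
      using insert.prems(3) by (simp only: scale_left_diff_distrib sum_subtractf scale_sum_right[symmetric]) simp
    then have "(\<Sum>k\<in>K. scale (\<mu> k - \<mu> a) (u k)) = 0" using insert.hyps by simp
    then have "scale (\<mu> k - \<mu> a) (u k) = 0"
      using that insert.prems by (intro insert.IH[of "\<lambda>k. scale (\<mu> k - \<mu> a) (u k)"])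
        (auto simp: act_scale_right scale_left_commute)
    moreover have "\<mu> k \<noteq> \<mu> a" using insert.prems(1) insert.hyps that by (auto simp: inj_on_def)
    ultimately show ?thesis by simp
  qed
  then have "(\<Sum>k\<in>K. u k) = 0" by simp
  then have "u a = 0" using insert.prems(3) insert.hyps by simp
  then show ?case using rest insert.prems(4) by auto
qed simp

text \<open>
  This diagonal matrix grades the monomials, since its commutator with a lowering operator
  is the operator times the negative of the distance of its two positions.
\<close>

definition height :: "('m + 'n \<Rightarrow> nat) \<Rightarrow> ('m, 'n) gl" where
  "height P = (\<chi> i j. if i = j then - of_nat (P i) else 0)"

lemma height_cartan: "height P \<in> cartan"
  by (simp add: height_def cartan_def)

lemma act_height_hw:
  assumes "hw P \<Lambda> v"
  shows "act (height P) v = scale (weight_eval \<Lambda> (height P)) v"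
  using assms unfolding act_cartan[OF height_cartan] weight_eval_def scale_sum_left
  by (simp add: hw_def mult.commute)

lemma act_height_monomial:
  assumes "hw P \<Lambda> v" "monomial P v k w"
  shows "act (height P) w = scale (weight_eval \<Lambda> (height P) - of_nat k) w"
  using assms(2)
proof (induction rule: monomial.induct)
  case base then show ?case using act_height_hw[OF assms(1)] by simp
next
  case (lower k w p q)
  have "height P $ q $ q - height P $ p $ p = - of_nat (P q - P p)"
    using lower.hyps by (simp add: height_def of_nat_diff)
  then show ?case
    unfolding act_cartan_mat_unit[OF height_cartan] lower.IH
    by (simp add: act_scale_right scale_left_distrib[symmetric] diff_diff_eq del: scale_minus_left)
qed

lemma monomial_0: "monomial P v k w \<Longrightarrow> k = 0 \<Longrightarrow> w = v"
  by (induction rule: monomial.induct) auto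

text \<open>
  The monomials are grouped by their degree. Degree \<open>0\<close> contains no other monomial than \<open>v\<close>.
\<close>

lemma height_decomposition:
  assumes "hw P \<Lambda> v" "w \<in> monomial_span P v"
  shows "\<exists>n u. w = (\<Sum>k\<le>n. u k) \<and> (\<forall>k>n. u k = 0) \<and> u 0 \<in> span {v} \<and>
    (\<forall>k. act (height P) (u k) = scale (weight_eval \<Lambda> (height P) - of_nat k) (u k))"
  using assms(2) unfolding monomial_span_def
proof (induction rule: span_induct_alt)
  case base
  show ?case by (rule exI[of _ 0], rule exI[of _ "\<lambda>_. 0"]) (simp add: span_zero)
next
  case (step c x y)
  then obtain k where k: "monomial P v k x" by blast
  obtain n u where u: "y = (\<Sum>k\<le>n. u k)" "\<forall>k>n. u k = 0" "u 0 \<in> span {v}"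
     "\<forall>k. act (height P) (u k) = scale (weight_eval \<Lambda> (height P) - of_nat k) (u k)"
    using step by blast
  define u' where "u' j = (if j = k then scale c x else 0) + u j" for j
  have "(\<Sum>j\<le>max n k. u' j) = scale c x + (\<Sum>j\<le>max n k. u j)"
    by (simp add: u'_def sum.distrib)
  also have "(\<Sum>j\<le>max n k. u j) = (\<Sum>j\<le>n. u j)"
    by (rule sum.mono_neutral_right) (use u in auto)
  finally have "scale c x + y = (\<Sum>j\<le>max n k. u' j)" using u by simp
  moreover have "\<forall>j>max n k. u' j = 0" using u by (simp add: u'_def)
  moreover have "u' 0 \<in> span {v}"
  proof (cases "k = 0")
    case True
    then have "x = v" using monomial_0[OF k] by simp
    then have "u' 0 = scale c v + u 0" using True by (simp add: u'_def)
    moreover have "scale c v \<in> span {v}" by (simp add: span_base span_scale)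
    ultimately show ?thesis using u(3) by (simp only: span_add)
  qed (use u(3) in \<open>simp add: u'_def\<close>)
  moreover have "act (height P) (u' j) = scale (weight_eval \<Lambda> (height P) - of_nat j) (u' j)" for j
    using u(4) act_height_monomial[OF assms(1) k]
    by (simp add: u'_def act_add_right act_scale_right scale_right_distrib scale_left_commute)
  ultimately show ?case by blast
qed

lemma hw_monomial_span:
  assumes "simple" "hw P \<Lambda> v" "inj P"
  shows "w \<in> monomial_span P v"
proof -
  have v: "v \<in> monomial_span P v"
    unfolding monomial_span_def by (auto intro!: span_base monomial.base)
  moreover have "v \<noteq> 0" using assms by (simp add: hw_def)
  ultimately have "monomial_span P v = UNIV"
    using submodule_monomial_span[OF assms(2,3)] assms(1) unfolding simple_def by blast
  then show ?thesis by simp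
qed

text \<open>
  As eigenvectors for different eigenvalues are independent, an eigenvector of the grading element
  lies in a single degree.
\<close>

lemma eigenvector_component:
  assumes "simple" "hw P \<Lambda> v" "inj P" "w \<noteq> 0" "act (height P) w = scale c w"
  shows "\<exists>k::nat. c = weight_eval \<Lambda> (height P) - of_nat k \<and> (k = 0 \<longrightarrow> w \<in> span {v})"
proof -
  let ?\<mu> = "\<lambda>k::nat. weight_eval \<Lambda> (height P) - of_nat k"
  obtain n u where u: "w = (\<Sum>k\<le>n. u k)" "u 0 \<in> span {v}"
     "\<forall>k. act (height P) (u k) = scale (?\<mu> k) (u k)"
    using height_decomposition[OF assms(2) hw_monomial_span[OF assms(1-3), of w]] by blast
  have "(\<Sum>k\<le>n. scale (?\<mu> k - c) (u k)) = act (height P) w - scale c w"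
    unfolding u(1) act_sum_right using u(3) by (simp add: scale_left_diff_distrib sum_subtractf scale_sum_right)
  then have "(\<Sum>k\<le>n. scale (?\<mu> k - c) (u k)) = 0" using assms by simp
  then have zero: "scale (?\<mu> k - c) (u k) = 0" if "k \<le> n" for k
    using that u(3) by (intro eigenvectors_independent[of "{..n}" ?\<mu> "height P" "\<lambda>k. scale (?\<mu> k - c) (u k)"])
      (auto simp: inj_on_def act_scale_right scale_left_commute)
  obtain k where k: "k \<le> n" "u k \<noteq> 0" using u(1) assms(4) by (metis (no_types, lifting) atMost_iff sum.neutral)
  have c: "c = ?\<mu> k" using zero[OF k(1)] k(2) by simp
  have "w \<in> span {v}" if "k = 0"
  proof -
    have "u j = 0" if "j \<in> {..n} - {0}" for j
      using zero[of j] that c \<open>k = 0\<close> by simp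
    then have "w = u 0" unfolding u(1) by (subst sum.remove[of _ 0]) auto
    then show ?thesis using u(2) by simp
  qed
  then show ?thesis using c by blast
qed

text \<open>
  Each of two highest weight vectors of a simple module has its eigenvalue below that of the
  other one, at a distance that is a natural number. Hence both lie in degree \<open>0\<close>, which is one-dimensional.
\<close>

lemma hw_unique:
  assumes "simple" "inj P" "hw P \<Lambda> v" "hw P \<Lambda>' v'"
  shows "\<Lambda>' = \<Lambda>"
proof -
  have nz: "v \<noteq> 0" "v' \<noteq> 0" using assms by (auto simp: hw_def)
  obtain k where k: "weight_eval \<Lambda>' (height P) = weight_eval \<Lambda> (height P) - of_nat k"
      "k = 0 \<longrightarrow> v' \<in> span {v}"
    using eigenvector_component[OF assms(1,3,2) nz(2) act_height_hw[OF assms(4)]] by blast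
  obtain k' where k': "weight_eval \<Lambda> (height P) = weight_eval \<Lambda>' (height P) - of_nat k'"
    using eigenvector_component[OF assms(1,4,2) nz(1) act_height_hw[OF assms(3)]] by blast
  have "of_nat k = weight_eval \<Lambda> (height P) - weight_eval \<Lambda>' (height P)"
    using k(1) by simp
  moreover have "of_nat k' = weight_eval \<Lambda>' (height P) - weight_eval \<Lambda> (height P)"
    by (subst k') simp
  ultimately have "of_nat (k + k') = (0::complex)" by simp
  then have "k = 0" by (simp only: of_nat_eq_0_iff add_eq_0_iff_both_eq_0)
  then obtain c where c: "v' = scale c v" using k by (auto simp: span_singleton)
  have "scale (\<Lambda>' $ p) v' = scale (\<Lambda> $ p) v'" for p
    using assms(3,4) unfolding hw_def c act_scale_right by (metis scale_left_commute)
  then show ?thesis using nz by (simp add: vec_eq_iff)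
qed

text \<open>
  Let \<open>f\<close> be the root vector of the negative of the simple odd root that is reflected, and \<open>e\<close> the opposite
  one. Then \<open>e f v = (\<Lambda>\<^sub>p + \<Lambda>\<^sub>q) v\<close>. If this is nonzero, \<open>f v\<close> is the new highest weight vector. If it
  is zero, \<open>f v\<close> would be another highest weight vector for the old order and thus vanishes by
  uniqueness; then \<open>v\<close> itself is a highest weight vector for the new order.
\<close>

lemma odd_reflection:
  assumes "simple" "inj P" "hw P \<Lambda> v" "P q = Suc (P p)" "parity p \<noteq> parity q"
    and P': "P' = P(p := P q, q := P p)"
  shows "\<exists>v'. hw P' (if \<Lambda> $ p + \<Lambda> $ q = 0 then \<Lambda> else \<Lambda> - (bvec p - bvec q)) v'"
proof -
  define f where "f = act (mat_unit q p) v"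
  have pq: "p \<noteq> q" using assms by auto
  have odd: "parity q + parity p = 1" using assms(5) by (cases p; cases q) auto
  have hwv: "v \<noteq> 0" "v \<in> V 0 \<or> v \<in> V 1" "\<And>r. act (mat_unit r r) v = scale (\<Lambda> $ r) v"
    "\<And>r s. P r < P s \<Longrightarrow> act (mat_unit r s) v = 0"
    using assms(3) by (auto simp: hw_def)
  \<comment> \<open>No index lies between \<open>p\<close> and \<open>q\<close>.\<close>
  have below: "P r < P p" if "P r < P q" "r \<noteq> p" for r
    using that assms(2,4) by (metis injD less_antisym)
  have above: "P q < P s" if "P p < P s" "s \<noteq> q" for s
    using that assms(2,4) by (metis Suc_lessI injD)
  have P'_less: "(P r < P s \<and> (r, s) \<noteq> (p, q)) \<or> (r = q \<and> s = p)" if "P' r < P' s" for r s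
  proof -
    have "r \<noteq> s" using that by auto
    then show ?thesis using that below[of r] above[of s] below[of s] above[of r] pq assms(4)
      unfolding P' by (auto split: if_splits)
  qed
  have diag: "act (mat_unit r r) f = scale ((\<Lambda> - (bvec p - bvec q)) $ r) f" for r
  proof -
    have "super_sign r r q p = 1" by (cases r) (auto simp: super_sign_def)
    then show ?thesis unfolding f_def act_mat_unit_commute[of r r q p]
      using pq by (auto simp: hwv(3) act_scale_right bvec_nth algebra_simps)
  qed
  \<comment> \<open>The root vector \<open>f\<close> acts with square zero, because it anticommutes with itself.\<close>
  have ff: "act (mat_unit q p) f = 0"
  proof -
    have "super_sign q p q p = - 1" using odd by (simp add: super_sign_def)
    then have "f' = - f'" if "f' = act (mat_unit q p) f" for f'
      using act_mat_unit_commute[of q p q p v] pq that by (simp add: f_def)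
    then have "act (mat_unit q p) f + act (mat_unit q p) f = 0"
      by (metis add.right_inverse)
    then have "scale 2 (act (mat_unit q p) f) = 0"
      using scale_left_distrib[of 1 1 "act (mat_unit q p) f"] by simp
    then show ?thesis by simp
  qed
  have pos: "act (mat_unit r s) f = 0" if "P r < P s" "(r, s) \<noteq> (p, q)" for r s
  proof -
    have "act (mat_unit r p) v = 0" if "s = q"
      using that \<open>P r < P s\<close> \<open>(r, s) \<noteq> (p, q)\<close> below[of r] hwv(4) by auto
    moreover have "act (mat_unit q s) v = 0" if "p = r"
      using that \<open>P r < P s\<close> \<open>(r, s) \<noteq> (p, q)\<close> above[of s] hwv(4) by auto
    moreover have "act (mat_unit r s) v = 0" using hwv(4) that by simp
    ultimately show ?thesis unfolding f_def act_mat_unit_commute[of r s q p] by auto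
  qed
  have ef: "act (mat_unit p q) f = scale (\<Lambda> $ p + \<Lambda> $ q) v"
  proof -
    have "super_sign p q q p = - 1" using odd by (simp add: super_sign_def add.commute)
    moreover have "act (mat_unit p q) v = 0" using hwv(4) assms(4) by simp
    ultimately show ?thesis unfolding f_def act_mat_unit_commute[of p q q p]
      by (simp add: hwv(3) scale_left_distrib)
  qed
  have fhom: "f \<in> V 0 \<or> f \<in> V 1" unfolding f_def by (rule act_mat_unit_homogeneous[OF hwv(2)])
  show ?thesis
  proof (cases "\<Lambda> $ p + \<Lambda> $ q = 0")
    case True
    have "f = 0"
    proof (rule ccontr)
      assume "f \<noteq> 0"
      then have "hw P (\<Lambda> - (bvec p - bvec q)) f"
        using fhom diag pos ef True unfolding hw_def by (metis Pair_inject scale_zero_left)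
      then have "\<Lambda> - (bvec p - bvec q) = \<Lambda>" by (rule hw_unique[OF assms(1,2,3)])
      then have "(bvec p - bvec q) $ p = 0" by simp
      then show False using pq by (simp add: bvec_nth)
    qed
    then have "act (mat_unit q p) v = 0" by (simp add: f_def)
    then have "hw P' \<Lambda> v" unfolding hw_def using hwv P'_less by blast
    then show ?thesis using True by auto
  next
    case False
    have "f \<noteq> 0" using ef hwv(1) False by auto
    moreover have "act (mat_unit r s) f = 0" if "P' r < P' s" for r s
      using P'_less[OF that] pos[of r s] ff by auto
    ultimately have "hw P' (\<Lambda> - (bvec p - bvec q)) f"
      unfolding hw_def using fhom diag by blast
    then show ?thesis using False by auto
  qed
qed

end

section \<open>Roots and orders of the indices\<close>

lemma eps_bvec: "eps i = bvec (Inl i)" and del_bvec: "del j = bvec (Inr j)"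
  by (simp_all add: eps_def del_def bvec_def)

lemma bvec_diff_eq_iff:
  assumes "p \<noteq> q"
  shows "bvec p - bvec q = bvec r - bvec s \<longleftrightarrow> p = r \<and> q = s"
proof
  assume eq: "bvec p - bvec q = bvec r - bvec s"
  have "(bvec p - bvec q) $ i = (bvec r - bvec s) $ i" for i by (simp only: eq)
  from this[of p] this[of q] show "p = r \<and> q = s"
    using assms by (auto simp: bvec_nth split: if_splits)
qed simp

lemma bvec_diff_mem_iff:
  "p \<noteq> q \<Longrightarrow> bvec p - bvec q \<in> {bvec p' - bvec q' | p' q'. Q p' q'} \<longleftrightarrow> Q p q"
  by (auto simp: bvec_diff_eq_iff)

lemma even_roots_conv: "even_roots = {bvec p - bvec q | p q. p \<noteq> q \<and> isl p = isl q}"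
proof (rule set_eqI)
  fix \<alpha> :: "('m::finite, 'n::finite) weight"
  have "\<alpha> \<in> even_roots \<longleftrightarrow> (\<exists>i j. i \<noteq> j \<and> \<alpha> = bvec (Inl i) - bvec (Inl j)) \<or>
      (\<exists>i j. i \<noteq> j \<and> \<alpha> = bvec (Inr i) - bvec (Inr j))"
    unfolding even_roots_def eps_bvec del_bvec Un_iff mem_Collect_eq by auto
  also have "\<dots> \<longleftrightarrow> (\<exists>p q. p \<noteq> q \<and> isl p = isl q \<and> \<alpha> = bvec p - bvec q)"
    by (simp add: split_sum_ex)
  finally show "\<alpha> \<in> even_roots \<longleftrightarrow> \<alpha> \<in> {bvec p - bvec q | p q. p \<noteq> q \<and> isl p = isl q}" by blast
qed

lemma odd_roots_conv: "odd_roots = {bvec p - bvec q | p q. isl p \<noteq> isl q}"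
proof (rule set_eqI)
  fix \<alpha> :: "('m::finite, 'n::finite) weight"
  have "\<alpha> \<in> odd_roots \<longleftrightarrow> (\<exists>i j. \<alpha> = bvec (Inl i) - bvec (Inr j)) \<or>
      (\<exists>i j. \<alpha> = bvec (Inr j) - bvec (Inl i))"
    unfolding odd_roots_def eps_bvec del_bvec minus_diff_eq by blast
  also have "\<dots> \<longleftrightarrow> (\<exists>p q. isl p \<noteq> isl q \<and> \<alpha> = bvec p - bvec q)"
    unfolding split_sum_ex by auto
  finally show "\<alpha> \<in> odd_roots \<longleftrightarrow> \<alpha> \<in> {bvec p - bvec q | p q. isl p \<noteq> isl q}" by blast
qed

lemma roots_conv: "roots = {bvec p - bvec q | p q. p \<noteq> q}"
  unfolding roots_def even_roots_conv odd_roots_conv by auto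

lemma bvec_diff_root: "p \<noteq> q \<Longrightarrow> bvec p - bvec q \<in> roots"
  unfolding roots_conv by (subst bvec_diff_mem_iff) simp_all

lemma bvec_diff_even_iff: "p \<noteq> q \<Longrightarrow> bvec p - bvec q \<in> even_roots \<longleftrightarrow> isl p = isl q"
  unfolding even_roots_conv by (subst bvec_diff_mem_iff) simp_all

lemma bvec_diff_odd_iff: "p \<noteq> q \<Longrightarrow> bvec p - bvec q \<in> odd_roots \<longleftrightarrow> isl p \<noteq> isl q"
  unfolding odd_roots_conv by (subst bvec_diff_mem_iff) simp_all

lemma even_pos_roots_conv:
  "even_pos_roots = {bvec p - bvec q | p q. (\<exists>i j. i < j \<and> p = Inl i \<and> q = Inl j) \<or>
     (\<exists>i j. i < j \<and> p = Inr i \<and> q = Inr j)}"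
  unfolding even_pos_roots_def eps_bvec del_bvec by blast

lemma finite_roots: "finite (roots :: ('m::finite, 'n::finite) weight set)"
proof -
  have "roots \<subseteq> (\<lambda>(p, q). bvec p - bvec q) ` (UNIV :: (('m + 'n) \<times> ('m + 'n)) set)"
    unfolding roots_conv by auto
  then show ?thesis by (rule finite_subset) simp
qed

text \<open>
  A criterion for linear independence by separating subspaces; below these are always kernels of sums of coordinates.
\<close>

lemma independentI_separating:
  fixes S :: "('m::finite, 'n::finite) weight set"
  assumes "\<And>a. a \<in> S \<Longrightarrow> \<exists>W. vec.subspace W \<and> S - {a} \<subseteq> W \<and> a \<notin> W"
  shows "vec.independent S"
proof
  assume "vec.dependent S"
  then obtain a where a: "a \<in> S" "a \<in> vec.span (S - {a})" unfolding vec.dependent_def by blast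
  obtain W where "vec.subspace W" "S - {a} \<subseteq> W" "a \<notin> W" using assms a(1) by blast
  then show False using a(2) vec.span_minimal by blast
qed

lemma subspace_coordinate_sum: "vec.subspace {x :: ('m::finite, 'n::finite) weight. (\<Sum>r\<in>R. x $ r) = 0}"
  unfolding vec.subspace_def
  by (auto simp: sum.distrib sum_distrib_left[symmetric])

lemma nat_combs_add:
  assumes "x \<in> nat_combs B" "y \<in> nat_combs B"
  shows "x + y \<in> nat_combs B"
proof -
  obtain c d :: "_ \<Rightarrow> nat" where "x = (\<Sum>\<beta>\<in>B. of_nat (c \<beta>) *s \<beta>)" "y = (\<Sum>\<beta>\<in>B. of_nat (d \<beta>) *s \<beta>)"
    using assms unfolding nat_combs_def by blast
  then have "x + y = (\<Sum>\<beta>\<in>B. of_nat (c \<beta> + d \<beta>) *s \<beta>)"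
    by (simp add: sum.distrib vec.scale_left_distrib)
  then show ?thesis unfolding nat_combs_def by (intro CollectI exI[of _ "\<lambda>\<beta>. c \<beta> + d \<beta>"]) simp
qed

lemma nat_combs_mem:
  assumes "finite B" "\<beta> \<in> B"
  shows "\<beta> \<in> nat_combs B"
proof -
  have "(\<Sum>\<gamma>\<in>B. of_nat (if \<gamma> = \<beta> then 1 else 0) *s \<gamma>) = (\<Sum>\<gamma>\<in>B. if \<gamma> = \<beta> then \<beta> else 0)"
    by (rule sum.cong) auto
  also have "\<dots> = \<beta>" using assms by simp
  finally show ?thesis unfolding nat_combs_def by (intro CollectI exI[of _ "\<lambda>\<gamma>. if \<gamma> = \<beta> then 1 else 0"]) simp
qed

primrec pos :: "'a list \<Rightarrow> 'a \<Rightarrow> nat" where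
  "pos [] p = 0"
| "pos (x # l) p = (if x = p then 0 else Suc (pos l p))"

lemma pos_append: "pos (u @ v) p = (if p \<in> set u then pos u p else length u + pos v p)"
  by (induction u) auto

lemma pos_less_length: "p \<in> set l \<Longrightarrow> pos l p < length l"
  by (induction l) auto

lemma nth_pos: "p \<in> set l \<Longrightarrow> l ! pos l p = p"
  by (induction l) auto

lemma pos_nth: "distinct l \<Longrightarrow> i < length l \<Longrightarrow> pos l (l ! i) = i"
  by (metis distinct_conv_nth nth_mem nth_pos pos_less_length)

lemma inj_on_pos: "inj_on (pos l) (set l)"
  by (metis inj_onI nth_pos)

lemma sorted_wrt_pos:
  "sorted_wrt R l \<Longrightarrow> q \<in> set l \<Longrightarrow> pos l p < pos l q \<Longrightarrow> R p q"
  by (induction l) (auto split: if_splits simp: )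

lemma pos_filter:
  "P p \<Longrightarrow> P q \<Longrightarrow> p \<in> set l \<Longrightarrow> q \<in> set l \<Longrightarrow>
    pos (filter P l) p < pos (filter P l) q \<longleftrightarrow> pos l p < pos l q"
  by (induction l) auto

definition adjacent :: "'a list \<Rightarrow> 'a \<Rightarrow> 'a \<Rightarrow> bool" where
  "adjacent l p q \<longleftrightarrow> (\<exists>u t. l = u @ p # q # t)"

lemma adjacent_pos:
  assumes "distinct l" "set l = UNIV"
  shows "adjacent l p q \<longleftrightarrow> pos l q = Suc (pos l p)"
proof
  assume "adjacent l p q"
  then show "pos l q = Suc (pos l p)" using assms(1) by (auto simp: adjacent_def pos_append)
next
  assume eq: "pos l q = Suc (pos l p)"
  define i where "i = pos l p"
  have "p \<in> set l" "q \<in> set l" using assms by auto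
  then have "Suc i < length l" "l ! i = p" "l ! Suc i = q"
    using pos_less_length[of q l] nth_pos[of p l] nth_pos[of q l] eq by (auto simp: i_def)
  then have "l = take i l @ p # q # drop (Suc (Suc i)) l"
    by (metis Cons_nth_drop_Suc Suc_lessD append_take_drop_id)
  then show "adjacent l p q" unfolding adjacent_def by blast
qed

definition standard_order :: "('m::{finite,linorder} + 'n::{finite,linorder}) list" where
  "standard_order = map Inl (sorted_list_of_set UNIV) @ map Inr (sorted_list_of_set UNIV)"

text \<open>
  The orders of the indices that correspond to sets of simple roots. They are the shuffles of the
  even and the odd indices, since the order within each parity is prescribed by the even roots.
\<close>

definition index_order :: "('m::{finite,linorder} + 'n::{finite,linorder}) list \<Rightarrow> bool" where
  "index_order l \<longleftrightarrow>
     l \<in> shuffles (map Inl (sorted_list_of_set UNIV)) (map Inr (sorted_list_of_set UNIV))"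

lemma append_in_shuffles: "xs @ ys \<in> shuffles xs ys"
  by (induction xs) (auto intro: Cons_in_shuffles_leftI)

lemma index_order_standard: "index_order standard_order"
  unfolding index_order_def standard_order_def by (rule append_in_shuffles)

lemma index_order_set:
  assumes "index_order l"
  shows "set l = UNIV" "distinct l" "inj (pos l)"
proof -
  show s: "set l = UNIV" using set_shuffles[OF assms[unfolded index_order_def]] by (simp add: UNIV_sum)
  show "distinct l"
    by (rule distinct_disjoint_shuffles[OF _ _ _ assms[unfolded index_order_def]])
      (auto simp: distinct_map)
  show "inj (pos l)" using inj_on_pos[of l] s by simp
qed

lemma index_order_filter:
  assumes "index_order l"
  shows "filter isl l = map Inl (sorted_list_of_set UNIV)"
    "filter (\<lambda>p. \<not> isl p) l = map Inr (sorted_list_of_set UNIV)"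
proof -
  let ?E = "map Inl (sorted_list_of_set (UNIV :: 'a set)) :: ('a + 'b) list"
  let ?D = "map Inr (sorted_list_of_set (UNIV :: 'b set)) :: ('a + 'b) list"
  have "filter isl ?E = ?E" "filter isl ?D = []" "filter (\<lambda>p. \<not> isl p) ?E = []"
     "filter (\<lambda>p. \<not> isl p) ?D = ?D"
    by (auto simp: filter_map comp_def)
  moreover have "filter P l \<in> shuffles (filter P ?E) (filter P ?D)" for P
    using assms unfolding index_order_def by (metis filter_shuffles imageI)
  ultimately show "filter isl l = ?E" "filter (\<lambda>p. \<not> isl p) l = ?D"
    by (metis shuffles.simps(2) singletonD, metis shuffles.simps(1) singletonD)
qed

lemma pos_sorted_list:
  "pos (sorted_list_of_set (UNIV :: 'a::{finite,linorder} set)) i < pos (sorted_list_of_set UNIV) j \<longleftrightarrow> i < j"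
proof -
  let ?l = "sorted_list_of_set (UNIV :: 'a set)"
  have less: "i < j" if "pos ?l i < pos ?l j" for i j
    by (rule sorted_wrt_pos[OF _ _ that]) auto
  have "pos ?l i \<noteq> pos ?l j" if "i \<noteq> j"
    using inj_on_pos[of ?l] that by (auto simp: inj_on_def)
  then show ?thesis using less[of i j] less[of j i] by (metis less_irrefl linorder_neqE_nat order.asym)
qed

lemma pos_map: "inj f \<Longrightarrow> pos (map f l) (f p) = pos l p"
  by (induction l) (auto dest: injD)

lemma index_order_pos:
  assumes "index_order l"
  shows "pos l (Inl i) < pos l (Inl j) \<longleftrightarrow> i < j" "pos l (Inr k) < pos l (Inr k') \<longleftrightarrow> k < k'"
proof -
  note s = index_order_set(1)[OF assms] and f = index_order_filter[OF assms]
  have "pos l (Inl i) < pos l (Inl j) \<longleftrightarrow> pos (filter isl l) (Inl i) < pos (filter isl l) (Inl j)"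
    by (rule pos_filter[symmetric]) (simp_all add: s)
  then show "pos l (Inl i) < pos l (Inl j) \<longleftrightarrow> i < j" unfolding f by (simp add: pos_map pos_sorted_list)
  have "pos l (Inr k) < pos l (Inr k') \<longleftrightarrow>
      pos (filter (\<lambda>p. \<not> isl p) l) (Inr k) < pos (filter (\<lambda>p. \<not> isl p) l) (Inr k')"
    by (rule pos_filter[symmetric]) (simp_all add: s)
  then show "pos l (Inr k) < pos l (Inr k') \<longleftrightarrow> k < k'" unfolding f by (simp add: pos_map pos_sorted_list)
qed

definition positive :: "('m + 'n \<Rightarrow> nat) \<Rightarrow> ('m::finite, 'n::finite) weight set" where
  "positive P = {bvec p - bvec q | p q. P p < P q}"

lemma bvec_diff_positive_iff: "p \<noteq> q \<Longrightarrow> bvec p - bvec q \<in> positive P \<longleftrightarrow> P p < P q"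
  unfolding positive_def by (subst bvec_diff_mem_iff) simp_all

definition simple_of :: "('m + 'n) list \<Rightarrow> ('m::finite, 'n::finite) weight set" where
  "simple_of l = {bvec p - bvec q | p q. adjacent l p q}"

lemma adjacent_neq: "distinct l \<Longrightarrow> adjacent l p q \<Longrightarrow> p \<noteq> q"
  by (auto simp: adjacent_def)

lemma simple_of_subset_roots: "distinct l \<Longrightarrow> simple_of l \<subseteq> roots"
proof
  fix \<beta> :: "('a, 'b) weight" assume d: "distinct l" and "\<beta> \<in> simple_of l"
  then obtain p q where pq: "\<beta> = bvec p - bvec q" "adjacent l p q" unfolding simple_of_def by auto
  then show "\<beta> \<in> roots" using adjacent_neq[OF d pq(2)] by (simp add: bvec_diff_root)
qed

lemma bvec_diff_sum:
  fixes p q :: "'m::finite + 'n::finite"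
  shows "(\<Sum>r\<in>R. (bvec p - bvec q) $ r) = (if p \<in> R then 1 else 0) - (if q \<in> R then 1 else 0)"
  by (simp add: bvec_nth sum_subtractf)

text \<open>
  The sum of the coordinates at all positions up to that of \<open>p\<close> vanishes on every difference of
  neighbours except on the one that starts at \<open>p\<close>.
\<close>

lemma independent_simple_of:
  assumes "distinct l" "set l = UNIV"
  shows "vec.independent (simple_of l)"
proof (rule independentI_separating)
  fix a :: "('a, 'b) weight" assume "a \<in> simple_of l"
  then obtain p q where a: "a = bvec p - bvec q" "pos l q = Suc (pos l p)"
    unfolding simple_of_def using adjacent_pos[OF assms] by blast
  define R where "R = {r. pos l r \<le> pos l p}"
  have "simple_of l - {a} \<subseteq> {x. (\<Sum>r\<in>R. x $ r) = 0}"
  proof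
    fix b assume b: "b \<in> simple_of l - {a}"
    then obtain p' q' where b': "b = bvec p' - bvec q'" "pos l q' = Suc (pos l p')"
      unfolding simple_of_def using adjacent_pos[OF assms] by blast
    have "pos l p' \<noteq> pos l p"
    proof
      assume *: "pos l p' = pos l p"
      then have "p' = p" "q' = q"
        using inj_on_pos[of l] assms(2) a(2) b'(2) by (auto intro: injD[of "pos l"])
      then show False using b a b' by simp
    qed
    then show "b \<in> {x. (\<Sum>r\<in>R. x $ r) = 0}"
      unfolding b'(1) mem_Collect_eq bvec_diff_sum by (simp add: R_def b'(2) Suc_le_eq le_less)
  qed
  moreover have "(\<Sum>r\<in>R. a $ r) = 1" unfolding a(1) bvec_diff_sum by (simp add: R_def a(2))
  ultimately show "\<exists>W. vec.subspace W \<and> simple_of l - {a} \<subseteq> W \<and> a \<notin> W"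
    by (intro exI[of _ "{x. (\<Sum>r\<in>R. x $ r) = 0}"]) (simp add: subspace_coordinate_sum)
qed

text \<open>The linear functional with value \<open>1\<close> on all simple roots of the order given by the positions \<open>P\<close>.\<close>

definition ht :: "('m + 'n \<Rightarrow> nat) \<Rightarrow> ('m::finite, 'n::finite) weight \<Rightarrow> complex" where
  "ht P x = (\<Sum>r\<in>UNIV. - of_nat (P r) * x $ r)"

lemma ht_bvec_diff: "ht P (bvec p - bvec q) = of_nat (P q) - of_nat (P p)"
proof -
  have "ht P (bvec p - bvec q) = (\<Sum>r\<in>UNIV. (if r = q then of_nat (P q) else 0) - (if r = p then of_nat (P p) else 0))"
    unfolding ht_def by (rule sum.cong) (auto simp: bvec_nth)
  then show ?thesis by (simp add: sum_subtractf)
qed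

lemma ht_sum: "ht P (\<Sum>\<beta>\<in>B. c \<beta> *s \<beta>) = (\<Sum>\<beta>\<in>B. c \<beta> * ht P \<beta>)"
  unfolding ht_def
  by (simp add: sum_distrib_left sum_distrib_right algebra_simps)
    (subst sum.swap, simp)

lemma ht_simple_of:
  assumes "distinct l" "set l = UNIV" "\<beta> \<in> simple_of l"
  shows "ht (pos l) \<beta> = 1"
  using assms adjacent_pos[OF assms(1,2)] by (auto simp: simple_of_def ht_bvec_diff)

lemma pos_roots_simple_of:
  assumes "distinct l" "set l = UNIV"
  shows "positive (pos l) \<subseteq> nat_combs (simple_of l)" "pos_roots (simple_of l) = positive (pos l)"
proof -
  have fin: "finite (simple_of l)" using simple_of_subset_roots[OF assms(1)] finite_roots finite_subset by blast
  have "bvec p - bvec q \<in> nat_combs (simple_of l)" if "pos l q = pos l p + Suc k" for p q k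
    using that
  proof (induction k arbitrary: q)
    case 0
    then have "bvec p - bvec q \<in> simple_of l" unfolding simple_of_def using adjacent_pos[OF assms] by auto
    then show ?case by (rule nat_combs_mem[OF fin])
  next
    case (Suc k)
    define r where "r = l ! (pos l p + Suc k)"
    have "pos l p + Suc k < length l" using Suc.prems pos_less_length[of q l] assms(2) by simp
    then have r: "pos l r = pos l p + Suc k" using pos_nth[OF assms(1)] by (simp add: r_def)
    then have "bvec r - bvec q \<in> simple_of l"
      unfolding simple_of_def using adjacent_pos[OF assms, of r q] Suc.prems by auto
    then show ?case using nat_combs_add[OF Suc.IH[OF r] nat_combs_mem[OF fin], of "bvec r - bvec q"] by simp
  qed
  then show sub: "positive (pos l) \<subseteq> nat_combs (simple_of l)"
    unfolding positive_def by (auto dest!: less_imp_Suc_add)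
  have "positive (pos l) \<subseteq> roots" unfolding positive_def roots_conv by blast
  moreover have "pos l p < pos l q" if pq: "p \<noteq> q" "bvec p - bvec q \<in> nat_combs (simple_of l)" for p q
  proof -
    obtain c where c: "bvec p - bvec q = (\<Sum>\<beta>\<in>simple_of l. of_nat (c \<beta>) *s \<beta>)"
      using pq(2) unfolding nat_combs_def by blast
    have "of_nat (pos l q) - of_nat (pos l p) = (\<Sum>\<beta>\<in>simple_of l. of_nat (c \<beta>) * (1::complex))"
      unfolding ht_bvec_diff[symmetric] c ht_sum by (rule sum.cong) (simp_all add: ht_simple_of[OF assms])
    then have "complex_of_nat (pos l q) = of_nat (pos l p + (\<Sum>\<beta>\<in>simple_of l. c \<beta>))"
      by (simp add: algebra_simps)
    then have "pos l q = pos l p + (\<Sum>\<beta>\<in>simple_of l. c \<beta>)" by (simp only: of_nat_eq_iff)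
    moreover have "pos l p \<noteq> pos l q" using pq(1) inj_on_pos[of l] assms(2) by (auto simp: inj_on_def)
    ultimately show ?thesis by simp
  qed
  ultimately show "pos_roots (simple_of l) = positive (pos l)"
    using sub unfolding pos_roots_def roots_conv positive_def by blast
qed

lemma simple_roots_simple_of:
  assumes "index_order l"
  shows "simple_roots (simple_of l)"
proof -
  note s = index_order_set[OF assms]
  have "\<alpha> \<in> nat_combs (simple_of l) \<or> - \<alpha> \<in> nat_combs (simple_of l)" if "\<alpha> \<in> roots" for \<alpha>
  proof -
    obtain p q where pq: "p \<noteq> q" "\<alpha> = bvec p - bvec q" using \<open>\<alpha> \<in> roots\<close> unfolding roots_conv by auto
    then have "pos l p < pos l q \<or> pos l q < pos l p" using s(3) by (metis injD linorder_neqE_nat)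
    then have "\<alpha> \<in> positive (pos l) \<or> - \<alpha> \<in> positive (pos l)"
      unfolding pq positive_def minus_diff_eq by blast
    then show ?thesis using pos_roots_simple_of(1)[OF s(2,1)] by blast
  qed
  moreover have "even_roots \<inter> positive (pos l) = even_pos_roots"
  proof -
    have "bvec p - bvec q \<in> even_pos_roots" if "isl p = isl q" "pos l p < pos l q" for p q
    proof -
      have "p \<noteq> q" using that by auto
      then show ?thesis
        using that index_order_pos[OF assms] unfolding even_pos_roots_conv
        by (subst bvec_diff_mem_iff) (cases p; cases q; auto)+
    qed
    then have "even_roots \<inter> positive (pos l) \<subseteq> even_pos_roots"
      unfolding even_roots_conv positive_def by (auto simp: bvec_diff_eq_iff)
    moreover have "even_pos_roots \<subseteq> even_roots \<inter> positive (pos l)"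
    proof
      fix \<alpha> :: "('a, 'b) weight" assume "\<alpha> \<in> even_pos_roots"
      then obtain p q where pq: "\<alpha> = bvec p - bvec q" "p \<noteq> q" "isl p = isl q" "pos l p < pos l q"
        unfolding even_pos_roots_conv using index_order_pos[OF assms] by auto
      then show "\<alpha> \<in> even_roots \<inter> positive (pos l)"
        by (simp add: bvec_diff_even_iff bvec_diff_positive_iff)
    qed
    ultimately show ?thesis by blast
  qed
  ultimately show ?thesis unfolding simple_roots_def
    using simple_of_subset_roots[OF s(2)] independent_simple_of[OF s(2,1)] pos_roots_simple_of(2)[OF s(2,1)]
    by simp
qed

lemma bvec_diff_even_pos_iff:
  "i \<noteq> j \<Longrightarrow> bvec (Inl i) - bvec (Inl j) \<in> even_pos_roots \<longleftrightarrow> i < j"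
  "k \<noteq> k' \<Longrightarrow> bvec (Inr k) - bvec (Inr k') \<in> even_pos_roots \<longleftrightarrow> k < k'"
  unfolding even_pos_roots_conv by (subst bvec_diff_mem_iff; simp)+

text \<open>
  Comparison of coefficients leaves one summand with all coefficients zero. Hence a
  simple root is not the sum of two positive roots.
\<close>

lemma nat_combs_decomposition:
  assumes "finite B" "vec.independent B" "\<beta> \<in> B" "\<beta> = x + y" "x \<in> nat_combs B" "y \<in> nat_combs B"
  shows "x = 0 \<or> y = 0"
proof -
  obtain c d :: "_ \<Rightarrow> nat" where cd: "x = (\<Sum>\<gamma>\<in>B. of_nat (c \<gamma>) *s \<gamma>)" "y = (\<Sum>\<gamma>\<in>B. of_nat (d \<gamma>) *s \<gamma>)"
    using assms(5,6) unfolding nat_combs_def by blast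
  have "(\<Sum>\<gamma>\<in>B. (if \<gamma> = \<beta> then 1 else 0) *s \<gamma>) = (\<Sum>\<gamma>\<in>B. if \<gamma> = \<beta> then \<beta> else 0)"
    by (rule sum.cong) auto
  then have "(\<Sum>\<gamma>\<in>B. (if \<gamma> = \<beta> then 1 else 0) *s \<gamma>) = x + y" using assms(1,3,4) by simp
  moreover have "(\<Sum>\<gamma>\<in>B. of_nat (c \<gamma> + d \<gamma>) *s \<gamma>) = x + y"
    unfolding cd by (simp add: sum.distrib vec.scale_left_distrib)
  ultimately have "(\<Sum>\<gamma>\<in>B. (of_nat (c \<gamma> + d \<gamma>) - (if \<gamma> = \<beta> then 1 else 0)) *s \<gamma>) = 0"
    by (simp only: sum_subtractf vec.scale_left_diff_distrib) simp
  then have coeff: "of_nat (c \<gamma> + d \<gamma>) - (if \<gamma> = \<beta> then 1 else 0) = (0::complex)" if "\<gamma> \<in> B" for \<gamma>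
    using vec.independentD[OF assms(2,1) subset_refl, of "\<lambda>\<gamma>. of_nat (c \<gamma> + d \<gamma>) - (if \<gamma> = \<beta> then 1 else 0)"] that by blast
  have sum: "c \<gamma> + d \<gamma> = (if \<gamma> = \<beta> then 1 else 0)" if "\<gamma> \<in> B" for \<gamma>
  proof -
    have "complex_of_nat (c \<gamma> + d \<gamma>) = of_nat (if \<gamma> = \<beta> then 1 else 0)"
      using coeff[OF that] by (cases "\<gamma> = \<beta>") simp_all
    then show ?thesis by (simp only: of_nat_eq_iff)
  qed
  then have "c \<beta> = 0 \<or> d \<beta> = 0" using assms(3) by fastforce
  moreover have "c \<gamma> = 0 \<and> d \<gamma> = 0" if "\<gamma> \<in> B" "\<gamma> \<noteq> \<beta>" for \<gamma> using sum[OF that(1)] that(2) by simp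
  ultimately have "(\<forall>\<gamma>\<in>B. c \<gamma> = 0) \<or> (\<forall>\<gamma>\<in>B. d \<gamma> = 0)" by metis
  then show ?thesis unfolding cd by auto
qed

lemma nat_combs_antisym:
  assumes "finite B" "vec.independent B" "x \<in> nat_combs B" "- x \<in> nat_combs B"
  shows "x = 0"
proof -
  obtain c d :: "_ \<Rightarrow> nat" where cd: "x = (\<Sum>\<gamma>\<in>B. of_nat (c \<gamma>) *s \<gamma>)" "- x = (\<Sum>\<gamma>\<in>B. of_nat (d \<gamma>) *s \<gamma>)"
    using assms(3,4) unfolding nat_combs_def by blast
  have "(\<Sum>\<gamma>\<in>B. of_nat (c \<gamma> + d \<gamma>) *s \<gamma>) = x + - x"
    unfolding cd(2) unfolding cd(1) by (simp add: sum.distrib vec.scale_left_distrib)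
  then have "(\<Sum>\<gamma>\<in>B. of_nat (c \<gamma> + d \<gamma>) *s \<gamma>) = 0" by simp
  then have "of_nat (c \<gamma> + d \<gamma>) = (0::complex)" if "\<gamma> \<in> B" for \<gamma>
    using vec.independentD[OF assms(2,1) subset_refl, of "\<lambda>\<gamma>. of_nat (c \<gamma> + d \<gamma>)"] that by blast
  then have "c \<gamma> = 0" if "\<gamma> \<in> B" for \<gamma> using that by (simp only: of_nat_eq_0_iff) simp
  then show ?thesis unfolding cd(1) by simp
qed

text \<open>
  Putting \<open>p\<close> before \<open>q\<close> if \<open>e\<^sub>p - e\<^sub>q\<close> is a nonnegative combination of \<open>B\<close> gives a strict linear order of
  the indices. A simple root is a difference of neighbours, since otherwise an index in between would
  decompose it.
\<close>

lemma simple_roots_index_order: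
  fixes B :: "('m::{finite,linorder}, 'n::{finite,linorder}) weight set"
  assumes "simple_roots B"
  obtains l where "index_order l" "B \<subseteq> simple_of l" "pos_roots B = positive (pos l)"
proof -
  have B: "B \<subseteq> roots" "vec.independent B" "even_roots \<inter> pos_roots B = even_pos_roots"
    and tot: "\<And>\<alpha>. \<alpha> \<in> roots \<Longrightarrow> \<alpha> \<in> nat_combs B \<or> - \<alpha> \<in> nat_combs B"
    using assms unfolding simple_roots_def by auto
  have fin: "finite B" using B(1) finite_roots finite_subset by blast
  define R where "R p q \<longleftrightarrow> p \<noteq> q \<and> bvec p - bvec q \<in> nat_combs B" for p q :: "'m + 'n"
  have R_total: "R p q \<or> R q p" if "p \<noteq> q" for p q
    using tot[OF bvec_diff_root[OF that]] that by (auto simp: R_def)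
  have R_asym: "\<not> R q p" if "R p q" for p q
  proof
    assume "R q p"
    then have "bvec p - bvec q = bvec p - bvec p"
      using nat_combs_antisym[OF fin B(2), of "bvec p - bvec q"] that by (simp add: R_def)
    then show False using that bvec_diff_eq_iff[of p q p p] by (auto simp: R_def)
  qed
  have R_trans: "R p r" if "R p q" "R q r" for p q r
  proof -
    have "bvec p - bvec r \<in> nat_combs B"
      using nat_combs_add[of "bvec p - bvec q" B "bvec q - bvec r"] that by (simp add: R_def)
    moreover have "p \<noteq> r" using that R_asym by blast
    ultimately show ?thesis by (simp add: R_def)
  qed
  \<comment> \<open>A numbering of the indices that is increasing for the strict order \<open>R\<close>.\<close>
  define rank where "rank p = card {r. R r p}" for p
  have rank: "rank p < rank q" if "R p q" for p q
    unfolding rank_def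
  proof (rule psubset_card_mono)
    show "{r. R r p} \<subset> {r. R r q}" using R_trans[OF _ that] that R_asym[of p p] by auto
  qed simp
  obtain xs :: "('m + 'n) list" where xs: "set xs = UNIV" "distinct xs"
    using finite_distinct_list[OF finite[of "UNIV :: ('m + 'n) set"]] by blast
  define l where "l = sort_key rank xs"
  have l: "set l = UNIV" "distinct l" by (simp_all add: l_def xs)
  have "sorted_wrt (\<lambda>x y. rank x \<le> rank y) l"
    using sorted_sort_key[of rank xs] by (simp add: l_def sorted_map)
  then have Rpos1: "R p q" if "pos l p < pos l q" for p q
  proof -
    have "rank p \<le> rank q" by (rule sorted_wrt_pos[OF \<open>sorted_wrt _ l\<close> _ that]) (simp add: l)
    moreover have "p \<noteq> q" using that by auto
    ultimately show ?thesis using R_total[of p q] rank[of q p] by fastforce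
  qed
  have Rpos: "R p q \<longleftrightarrow> pos l p < pos l q" for p q
  proof
    assume pq: "R p q"
    then have "p \<noteq> q" by (simp add: R_def)
    then have "pos l p \<noteq> pos l q" using inj_on_pos[of l] l by (auto simp: inj_on_def)
    then show "pos l p < pos l q" using Rpos1[of q p] R_asym[OF pq] by fastforce
  qed (rule Rpos1)
  have pr: "pos_roots B = positive (pos l)"
    unfolding pos_roots_def roots_conv positive_def Rpos[symmetric] R_def by blast
  have even: "pos l p < pos l q \<longleftrightarrow> bvec p - bvec q \<in> even_pos_roots" if "isl p = isl q" "p \<noteq> q" for p q
    using B(3) that bvec_diff_even_iff[OF that(2)] bvec_diff_positive_iff[OF that(2), of "pos l"] pr by blast
  have posE: "pos l (Inl i) < pos l (Inl j) \<longleftrightarrow> i < j" for i j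
  proof (cases "i = j")
    case False
    then show ?thesis
      using even[of "Inl i" "Inl j"] by (simp add: bvec_diff_even_pos_iff)
  qed simp
  have posD: "pos l (Inr i) < pos l (Inr j) \<longleftrightarrow> i < j" for i j
  proof (cases "i = j")
    case False
    then show ?thesis
      using even[of "Inr i" "Inr j"] by (simp add: bvec_diff_even_pos_iff)
  qed simp
  have sl: "sorted_wrt (\<lambda>p q. pos l p < pos l q) l"
    using l(2) pos_nth[of l] by (auto simp: sorted_wrt_iff_nth_less)
  define es where "es = map projl (filter isl l)"
  have es: "filter isl l = map Inl es" unfolding es_def map_map
    by (rule map_idI[symmetric]) auto
  have "sorted_wrt (\<lambda>p q. pos l p < pos l q) (map Inl es)" unfolding es[symmetric] by (rule sorted_wrt_filter[OF sl])
  then have "sorted_wrt (<) es" by (simp add: sorted_wrt_map posE)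
  moreover have "Inl i \<in> set (filter isl l)" for i using l(1) by simp
  then have "set es = UNIV" unfolding es by auto
  ultimately have es': "es = sorted_list_of_set UNIV" by (intro strict_sorted_equal) simp_all
  define ds where "ds = map projr (filter (\<lambda>p. \<not> isl p) l)"
  have ds: "filter (\<lambda>p. \<not> isl p) l = map Inr ds" unfolding ds_def map_map
    by (rule map_idI[symmetric]) auto
  have "sorted_wrt (\<lambda>p q. pos l p < pos l q) (map Inr ds)" unfolding ds[symmetric] by (rule sorted_wrt_filter[OF sl])
  then have "sorted_wrt (<) ds" by (simp add: sorted_wrt_map posD)
  moreover have "Inr i \<in> set (filter (\<lambda>p. \<not> isl p) l)" for i using l(1) by simp
  then have "set ds = UNIV" unfolding ds by auto
  ultimately have ds': "ds = sorted_list_of_set UNIV" by (intro strict_sorted_equal) simp_all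
  have "index_order l"
    unfolding index_order_def es'[symmetric] ds'[symmetric] es[symmetric] ds[symmetric]
    by (rule partition_in_shuffles)
  moreover have "B \<subseteq> simple_of l"
  proof
    fix \<beta> assume b: "\<beta> \<in> B"
    then have "\<beta> \<in> pos_roots B" using B(1) nat_combs_mem[OF fin b] by (auto simp: pos_roots_def)
    then obtain p q where pq: "\<beta> = bvec p - bvec q" "pos l p < pos l q" unfolding pr positive_def by blast
    have "pos l q = Suc (pos l p)"
    proof (rule ccontr)
      assume "pos l q \<noteq> Suc (pos l p)"
      then have lt: "Suc (pos l p) < pos l q" using pq(2) by simp
      define r where "r = l ! Suc (pos l p)"
      have "Suc (pos l p) < length l" using lt pos_less_length[of q l] l by simp
      then have r: "pos l r = Suc (pos l p)" using pos_nth[OF l(2)] by (simp add: r_def)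
      then have "R p r" "R r q" using lt by (simp_all add: Rpos)
      then have "bvec p - bvec r = 0 \<or> bvec r - bvec q = 0"
        using nat_combs_decomposition[OF fin B(2) b, of "bvec p - bvec r" "bvec r - bvec q"] pq(1)
        by (simp add: R_def)
      then have "bvec p - bvec r = bvec p - bvec p \<or> bvec r - bvec q = bvec r - bvec r" by simp
      then show False using \<open>R p r\<close> \<open>R r q\<close> bvec_diff_eq_iff[of p r p p] bvec_diff_eq_iff[of r q r r]
        by (auto simp: R_def)
    qed
    then show "\<beta> \<in> simple_of l" unfolding simple_of_def using pq(1) adjacent_pos[OF l(2,1)] by blast
  qed
  ultimately show thesis using pr that by blast
qed

lemma adjacent_append_iff:
  "adjacent (xs @ ys) p q \<longleftrightarrow> adjacent xs p q \<or> adjacent ys p q \<or>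
     (xs \<noteq> [] \<and> ys \<noteq> [] \<and> p = last xs \<and> q = hd ys)"
proof
  assume "adjacent (xs @ ys) p q"
  then obtain u t where "xs @ ys = u @ p # q # t" unfolding adjacent_def by blast
  then consider v where "xs = u @ v" "v @ ys = p # q # t" | v where "ys = v @ p # q # t"
    unfolding append_eq_append_conv2 by blast
  then show "adjacent xs p q \<or> adjacent ys p q \<or> (xs \<noteq> [] \<and> ys \<noteq> [] \<and> p = last xs \<and> q = hd ys)"
  proof cases
    case 1
    show ?thesis
    proof (cases v)
      case Nil
      then have "ys = [] @ p # q # t" using 1 by simp
      then show ?thesis unfolding adjacent_def by blast
    next
      case (Cons p' v')
      show ?thesis
      proof (cases v')
        case Nil then show ?thesis using 1 Cons by auto
      next
        case (Cons q' v'')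
        then have "xs = u @ p # q # v''" using 1 \<open>v = p' # v'\<close> by simp
        then show ?thesis unfolding adjacent_def by blast
      qed
    qed
  next
    case 2
    then show ?thesis unfolding adjacent_def by blast
  qed
next
  assume "adjacent xs p q \<or> adjacent ys p q \<or> (xs \<noteq> [] \<and> ys \<noteq> [] \<and> p = last xs \<and> q = hd ys)"
  then consider (l) u t where "xs = u @ p # q # t" | (r) u t where "ys = u @ p # q # t"
    | (m) "xs \<noteq> []" "ys \<noteq> []" "p = last xs" "q = hd ys"
    unfolding adjacent_def by blast
  then show "adjacent (xs @ ys) p q"
  proof cases
    case l
    then have "xs @ ys = u @ p # q # (t @ ys)" by simp
    then show ?thesis unfolding adjacent_def by blast
  next
    case r
    then have "xs @ ys = (xs @ u) @ p # q # t" by simp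
    then show ?thesis unfolding adjacent_def by blast
  next
    case m
    have "butlast xs @ [p] = xs" using m by simp
    moreover have "q # tl ys = ys" using m by simp
    ultimately have "xs @ ys = butlast xs @ p # q # tl ys" by (metis append.assoc append_Cons append_Nil)
    then show ?thesis unfolding adjacent_def by blast
  qed
qed

lemma adjacent_map:
  "adjacent (map f xs) p q \<longleftrightarrow> (\<exists>i j. adjacent xs i j \<and> p = f i \<and> q = f j)"
proof
  assume "adjacent (map f xs) p q"
  then obtain u t where "map f xs = u @ p # q # t" unfolding adjacent_def by blast
  then obtain u' i j t' where "xs = u' @ i # j # t'" "p = f i" "q = f j"
    by (auto simp: map_eq_append_conv map_eq_Cons_conv)
  then show "\<exists>i j. adjacent xs i j \<and> p = f i \<and> q = f j" unfolding adjacent_def by blast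
next
  assume "\<exists>i j. adjacent xs i j \<and> p = f i \<and> q = f j"
  then obtain u i j t where "xs = u @ i # j # t" "p = f i" "q = f j" unfolding adjacent_def by blast
  then have "map f xs = map f u @ p # q # map f t" by simp
  then show "adjacent (map f xs) p q" unfolding adjacent_def by blast
qed

lemma adjacent_sorted_list:
  "adjacent (sorted_list_of_set (UNIV :: 'a::{finite,linorder} set)) i j \<longleftrightarrow> i < j \<and> {i<..<j} = {}"
proof -
  let ?l = "sorted_list_of_set (UNIV :: 'a set)"
  have "pos ?l j = Suc (pos ?l i) \<longleftrightarrow> pos ?l i < pos ?l j \<and> (\<forall>k. \<not> (pos ?l i < pos ?l k \<and> pos ?l k < pos ?l j))"
  proof (intro iffI conjI; (elim conjE)?)
    assume lt: "pos ?l i < pos ?l j" and no: "\<forall>k. \<not> (pos ?l i < pos ?l k \<and> pos ?l k < pos ?l j)"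
    have "pos ?l j < length ?l" by (rule pos_less_length) simp
    then have "pos ?l (?l ! Suc (pos ?l i)) = Suc (pos ?l i)" using lt by (intro pos_nth) auto
    then show "pos ?l j = Suc (pos ?l i)" using no[rule_format, of "?l ! Suc (pos ?l i)"] lt by simp
  qed auto
  then show ?thesis unfolding adjacent_pos[of ?l, simplified] pos_sorted_list by auto
qed

lemma pi_st_simple_of: "pi_st = simple_of standard_order"
proof -
  let ?E = "sorted_list_of_set (UNIV :: 'a set)" and ?D = "sorted_list_of_set (UNIV :: 'b set)"
  have last: "last ?E = Max UNIV"
  proof (rule Max_eqI[symmetric])
    fix i :: 'a
    have "i \<le> last xs" if "sorted xs" "i \<in> set xs" for xs
      using that by (induction xs) auto
    then show "i \<le> last ?E" by simp
  qed simp_all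
  have hd: "hd ?D = Min UNIV" by (subst sorted_list_of_set_nonempty) simp_all
  have ne: "map Inl ?E \<noteq> []" "map Inr ?D \<noteq> []" by auto
  have adj: "adjacent standard_order p q \<longleftrightarrow> (\<exists>i j. (i < j \<and> {i<..<j} = {}) \<and> p = Inl i \<and> q = Inl j) \<or>
      (\<exists>i j. (i < j \<and> {i<..<j} = {}) \<and> p = Inr i \<and> q = Inr j) \<or> (p = Inl (Max UNIV) \<and> q = Inr (Min UNIV))" for p q :: "'a + 'b"
    unfolding standard_order_def adjacent_append_iff adjacent_map
      adjacent_sorted_list using ne last hd by (simp add: last_map hd_map)
  show ?thesis unfolding pi_st_def simple_of_def adj eps_bvec del_bvec by blast
qed

section \<open>Labels of shifted weights\<close>

text \<open>The square length \<open>(e\<^sub>p, e\<^sub>p)\<close> of the basis vector with index \<open>p\<close>.\<close>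

definition sgn_idx :: "'a + 'b \<Rightarrow> int" where
  "sgn_idx p = (if isl p then 1 else - 1)"

definition lab :: "('m::finite, 'n::finite) weight \<Rightarrow> 'm + 'n \<Rightarrow> complex" where
  "lab \<nu> p = of_int (sgn_idx p) * \<nu> $ p"

text \<open>The inverse of \<open>lab\<close> on integral labels.\<close>

definition wt :: "('m + 'n \<Rightarrow> int) \<Rightarrow> ('m::finite, 'n::finite) weight" where
  "wt x = (\<chi> p. of_int (sgn_idx p * x p))"

lemma lab_wt [simp]: "lab (wt x) p = of_int (x p)"
  by (simp add: lab_def wt_def sgn_idx_def)

lemma lab_diff: "lab (\<mu> - \<nu>) p = lab \<mu> p - lab \<nu> p"
  by (simp add: lab_def algebra_simps)

lemma lab_add: "lab (\<mu> + \<nu>) p = lab \<mu> p + lab \<nu> p"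
  by (simp add: lab_def algebra_simps)

lemma weight_eq_iff_lab: "\<mu> = \<nu> \<longleftrightarrow> (\<forall>p. lab \<mu> p = lab \<nu> p)"
  by (auto simp: lab_def vec_eq_iff sgn_idx_def)

lemma form_bvec: "form \<nu> (bvec p) = lab \<nu> p"
proof (cases p)
  case (Inl i)
  have "(\<Sum>k\<in>UNIV. \<nu> $ Inl k * bvec p $ Inl k) = (\<Sum>k\<in>UNIV. if k = i then \<nu> $ Inl i else 0)"
    by (rule sum.cong) (auto simp: bvec_nth Inl)
  then show ?thesis by (simp add: form_def lab_def sgn_idx_def bvec_nth Inl)
next
  case (Inr i)
  have "(\<Sum>k\<in>UNIV. \<nu> $ Inr k * bvec p $ Inr k) = (\<Sum>k\<in>UNIV. if k = i then \<nu> $ Inr i else 0)"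
    by (rule sum.cong) (auto simp: bvec_nth Inr)
  then show ?thesis by (simp add: form_def lab_def sgn_idx_def bvec_nth Inr)
qed

lemma form_diff_right: "form \<nu> (x - y) = form \<nu> x - form \<nu> y"
  by (simp add: form_def algebra_simps sum_subtractf)

lemma form_bvec_diff: "form \<nu> (bvec p - bvec q) = lab \<nu> p - lab \<nu> q"
  by (simp add: form_diff_right form_bvec)

text \<open>
  Twice the label of \<open>rho\<close> at \<open>r\<close>, because a positive root \<open>e\<^sub>p - e\<^sub>q\<close> enters \<open>rho\<close> with the coefficient
  \<open>sgn_idx p * sgn_idx q / 2\<close>, whether it is even or odd.
\<close>

definition rho2 :: "('m + 'n \<Rightarrow> nat) \<Rightarrow> ('m::finite + 'n::finite) \<Rightarrow> int" where
  "rho2 P r = (\<Sum>q | P r < P q. sgn_idx q) - (\<Sum>q | P q < P r. sgn_idx q)"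

lemma lab_rho:
  fixes B :: "('m::finite, 'n::finite) weight set"
  assumes "pos_roots B = positive P"
  shows "lab (rho B) r = of_int (rho2 P r) / 2"
proof -
  let ?f = "\<lambda>(p, q). bvec p - bvec q :: ('m, 'n) weight"
  define D where "D = {(p, q). P p < P q}"
  have inj: "inj_on ?f D"
  proof (rule inj_onI)
    fix z z' assume "z \<in> D" and eq: "?f z = ?f z'"
    then have "fst z \<noteq> snd z" by (auto simp: D_def)
    then show "z = z'" using eq bvec_diff_eq_iff[of "fst z" "snd z" "fst z'" "snd z'"]
      by (simp add: split_def prod_eq_iff)
  qed
  have e: "even_roots \<inter> positive P = ?f ` {(p, q)\<in>D. isl p = isl q}"
  proof
    show "?f ` {(p, q)\<in>D. isl p = isl q} \<subseteq> even_roots \<inter> positive P"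
    proof
      fix \<alpha> :: "('m, 'n) weight" assume "\<alpha> \<in> ?f ` {(p, q)\<in>D. isl p = isl q}"
      then obtain p q where "\<alpha> = bvec p - bvec q" "P p < P q" "isl p = isl q" by (auto simp: D_def)
      moreover from this have "p \<noteq> q" by auto
      ultimately show "\<alpha> \<in> even_roots \<inter> positive P"
        by (simp add: bvec_diff_even_iff bvec_diff_positive_iff)
    qed
    show "even_roots \<inter> positive P \<subseteq> ?f ` {(p, q)\<in>D. isl p = isl q}"
    proof
      fix \<alpha> :: "('m, 'n) weight" assume a: "\<alpha> \<in> even_roots \<inter> positive P"
      then obtain p q where pq: "\<alpha> = bvec p - bvec q" "P p < P q" unfolding positive_def by auto
      then have "isl p = isl q" using a bvec_diff_even_iff[of p q] by auto
      then show "\<alpha> \<in> ?f ` {(p, q)\<in>D. isl p = isl q}"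
        using pq by (intro image_eqI[of _ _ "(p, q)"]) (simp_all add: D_def)
    qed
  qed
  have o: "odd_roots \<inter> positive P = ?f ` {(p, q)\<in>D. isl p \<noteq> isl q}"
  proof
    show "?f ` {(p, q)\<in>D. isl p \<noteq> isl q} \<subseteq> odd_roots \<inter> positive P"
    proof
      fix \<alpha> :: "('m, 'n) weight" assume "\<alpha> \<in> ?f ` {(p, q)\<in>D. isl p \<noteq> isl q}"
      then obtain p q where "\<alpha> = bvec p - bvec q" "P p < P q" "isl p \<noteq> isl q" by (auto simp: D_def)
      moreover from this have "p \<noteq> q" by auto
      ultimately show "\<alpha> \<in> odd_roots \<inter> positive P"
        by (simp add: bvec_diff_odd_iff bvec_diff_positive_iff)
    qed
    show "odd_roots \<inter> positive P \<subseteq> ?f ` {(p, q)\<in>D. isl p \<noteq> isl q}"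
    proof
      fix \<alpha> :: "('m, 'n) weight" assume a: "\<alpha> \<in> odd_roots \<inter> positive P"
      then obtain p q where pq: "\<alpha> = bvec p - bvec q" "P p < P q" unfolding positive_def by auto
      then have "isl p \<noteq> isl q" using a bvec_diff_odd_iff[of p q] by auto
      then show "\<alpha> \<in> ?f ` {(p, q)\<in>D. isl p \<noteq> isl q}"
        using pq by (intro image_eqI[of _ _ "(p, q)"]) (simp_all add: D_def)
    qed
  qed
  have sE: "(\<Sum>\<alpha>\<in>even_roots \<inter> positive P. \<alpha>) = (\<Sum>z\<in>{(p, q)\<in>D. isl p = isl q}. ?f z)"
    unfolding e by (subst sum.reindex) (auto intro: inj_on_subset[OF inj])
  have sO: "(\<Sum>\<alpha>\<in>odd_roots \<inter> positive P. \<alpha>) = (\<Sum>z\<in>{(p, q)\<in>D. isl p \<noteq> isl q}. ?f z)"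
    unfolding o by (subst sum.reindex) (auto intro: inj_on_subset[OF inj])
  define s :: "'m + 'n \<Rightarrow> complex" where "s p = of_int (sgn_idx p)" for p
  have "rho B $ r = 1/2 * ((\<Sum>z\<in>{(p, q)\<in>D. isl p = isl q}. ?f z $ r) - (\<Sum>z\<in>{(p, q)\<in>D. isl p \<noteq> isl q}. ?f z $ r))"
    unfolding rho_def assms sE sO by (simp add: algebra_simps)
  also have "(\<Sum>z\<in>{(p, q)\<in>D. isl p = isl q}. ?f z $ r) - (\<Sum>z\<in>{(p, q)\<in>D. isl p \<noteq> isl q}. ?f z $ r) =
     (\<Sum>z\<in>{(p, q)\<in>D. isl p = isl q}. s (fst z) * s (snd z) * ?f z $ r) +
     (\<Sum>z\<in>{(p, q)\<in>D. isl p \<noteq> isl q}. s (fst z) * s (snd z) * ?f z $ r)"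
    unfolding diff_conv_add_uminus sum_negf[symmetric]
    by (intro arg_cong2[where f = "(+)"] sum.cong) (auto simp: s_def sgn_idx_def)
  also have "\<dots> = (\<Sum>z\<in>{(p, q)\<in>D. isl p = isl q} \<union> {(p, q)\<in>D. isl p \<noteq> isl q}. s (fst z) * s (snd z) * ?f z $ r)"
    by (rule sum.union_disjoint[symmetric]) auto
  also have "{(p, q)\<in>D. isl p = isl q} \<union> {(p, q)\<in>D. isl p \<noteq> isl q} = D" by auto
  also have "(\<Sum>z\<in>D. s (fst z) * s (snd z) * ?f z $ r) =
      (\<Sum>z\<in>UNIV \<times> UNIV. if P (fst z) < P (snd z) then s (fst z) * s (snd z) * ?f z $ r else 0)"
    by (rule sum.mono_neutral_cong_left) (auto simp: D_def)
  also have "\<dots> = (\<Sum>p\<in>UNIV. \<Sum>q\<in>UNIV. if P p < P q then s p * s q * ((if r = p then 1 else 0) - (if r = q then 1 else 0)) else 0)"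
    unfolding sum.cartesian_product by (rule sum.cong) (auto simp: bvec_nth)
  also have "\<dots> = (\<Sum>p\<in>UNIV. \<Sum>q\<in>UNIV. if p = r then (if P r < P q then s r * s q else 0) else 0) -
      (\<Sum>p\<in>UNIV. \<Sum>q\<in>UNIV. if q = r then (if P p < P r then s p * s r else 0) else 0)"
    unfolding sum_subtractf[symmetric] by (intro sum.cong) auto
  also have "(\<Sum>p\<in>UNIV. \<Sum>q\<in>UNIV. if p = r then (if P r < P q then s r * s q else 0) else 0) =
      (\<Sum>q\<in>UNIV. if P r < P q then s r * s q else 0)"
    by (subst sum.swap) simp
  also have "\<dots> = s r * (\<Sum>q | P r < P q. s q)"
    by (simp add: sum_distrib_left sum.inter_filter[symmetric] cong: if_cong)
  also have "(\<Sum>p\<in>UNIV. \<Sum>q\<in>UNIV. if q = r then (if P p < P r then s p * s r else 0) else 0) =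
      (\<Sum>p\<in>UNIV. if P p < P r then s r * s p else 0)"
    by (intro sum.cong) (auto simp: mult.commute)
  also have "\<dots> = s r * (\<Sum>q | P q < P r. s q)"
    by (simp add: sum_distrib_left sum.inter_filter[symmetric] cong: if_cong)
  also have "s r * (\<Sum>q | P r < P q. s q) - s r * (\<Sum>q | P q < P r. s q) = s r * of_int (rho2 P r)"
    by (simp add: rho2_def s_def algebra_simps)
  finally have "rho B $ r = 1/2 * (s r * of_int (rho2 P r))" .
  moreover have "s r * s r = 1" by (simp add: s_def sgn_idx_def)
  ultimately show ?thesis unfolding lab_def s_def[symmetric] by simp (metis mult.assoc mult.left_neutral)
qed

lemma rho2_split:
  fixes u t :: "('m::finite + 'n::finite) list"
  assumes "distinct (u @ r # t)" "set (u @ r # t) = UNIV"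
  shows "rho2 (pos (u @ r # t)) r = sum_list (map sgn_idx t) - sum_list (map sgn_idx u)"
proof -
  let ?l = "u @ r # t"
  have r: "pos ?l r = length u" using assms(1) by (simp add: pos_append)
  have "{q. pos ?l r < pos ?l q} = set t"
  proof (intro set_eqI)
    fix q
    have "q \<in> set u \<or> q = r \<or> q \<in> set t" using assms(2) by auto
    then show "q \<in> {q. pos ?l r < pos ?l q} \<longleftrightarrow> q \<in> set t"
      unfolding mem_Collect_eq r using assms(1) pos_less_length[of q u] by (auto simp: pos_append)
  qed
  moreover have "{q. pos ?l q < pos ?l r} = set u"
  proof (intro set_eqI)
    fix q
    show "q \<in> {q. pos ?l q < pos ?l r} \<longleftrightarrow> q \<in> set u"
      unfolding mem_Collect_eq r using pos_less_length[of q u] by (auto simp: pos_append)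
  qed
  moreover have "distinct u" "distinct t" using assms(1) by auto
  ultimately show ?thesis by (simp add: rho2_def sum_list_distinct_conv_sum_set)
qed

lemma weight_eval_bvec_diff: "weight_eval (bvec p - bvec q) H = H $ p $ p - H $ q $ q"
proof -
  have "weight_eval (bvec p - bvec q) H =
      (\<Sum>i\<in>UNIV. (if i = p then H $ p $ p else 0) - (if i = q then H $ q $ q else 0))"
    unfolding weight_eval_def by (rule sum.cong) (auto simp: bvec_nth)
  then show ?thesis by (simp add: sum_subtractf)
qed

lemma mat_unit_root_space: "mat_unit p q \<in> root_space (bvec p - bvec q)"
  unfolding root_space_def weight_eval_bvec_diff
  by (auto simp: diagonal_mult_mat_unit map_matrix_def vec_eq_iff algebra_simps)

lemma root_space_entry:
  assumes X: "X \<in> root_space (bvec p - bvec q)" and "p \<noteq> q" "X $ i $ j \<noteq> 0"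
  shows "i = p \<and> j = q"
proof -
  have comm: "h i - h j = h p - h q" for h :: "_ \<Rightarrow> complex"
  proof -
    define H :: "('a, 'b) gl" where "H = (\<chi> i j. if i = j then h i else 0)"
    have "H \<in> cartan" by (simp add: H_def cartan_def)
    then have "H ** X - X ** H = map_matrix ((*) (h p - h q)) X"
      using X by (simp add: root_space_def weight_eval_bvec_diff H_def)
    then have "(H ** X - X ** H) $ i $ j = (h p - h q) * X $ i $ j" by (simp add: map_matrix_def)
    moreover have "(H ** X) $ i $ j = (\<Sum>k\<in>UNIV. if k = i then h i * X $ i $ j else 0)"
      unfolding matrix_matrix_mult_def vec_lambda_beta by (rule sum.cong) (auto simp: H_def)
    moreover have "(X ** H) $ i $ j = (\<Sum>k\<in>UNIV. if k = j then h j * X $ i $ j else 0)"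
      unfolding matrix_matrix_mult_def vec_lambda_beta by (rule sum.cong) (auto simp: H_def)
    ultimately have "(h i - h j) * X $ i $ j = (h p - h q) * X $ i $ j" by (simp add: algebra_simps)
    then show ?thesis using assms(3) by simp
  qed
  show ?thesis using comm[of "\<lambda>k. if k = p then 1 else 0"] comm[of "\<lambda>k. if k = q then 1 else 0"] \<open>p \<noteq> q\<close>
    by (auto split: if_splits)
qed

text \<open>
  This is how odd reflections lead from the standard order to any other one: whenever the shuffle
  continues with an element of the second list, this element is moved in front of all that is
  left of the first list.
\<close>

lemma shuffle_reachable:
  assumes step: "\<And>u x y t. x \<in> set xs \<Longrightarrow> y \<in> set ys \<Longrightarrow> Q (u @ x # y # t) \<Longrightarrow> Q (u @ y # x # t)"
    and "z \<in> shuffles xs ys" "Q (u @ xs @ ys)"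
  shows "Q (u @ z)"
proof -
  \<comment> \<open>One element of the second list moves past a part of the first list.\<close>
  have move: "Q (u @ y # xs' @ t)" if "set xs' \<subseteq> set xs" "y \<in> set ys" "Q (u @ xs' @ y # t)" for u xs' y t
    using that
  proof (induction xs' arbitrary: u)
    case (Cons x xs')
    have "Q ((u @ [x]) @ y # xs' @ t)" using Cons.IH[of "u @ [x]"] Cons.prems by simp
    then show ?case using step[of x y u "xs' @ t"] Cons.prems by simp
  qed simp
  have "Q (u @ z)" if "set xs' \<subseteq> set xs" "set ys' \<subseteq> set ys" "z \<in> shuffles xs' ys'" "Q (u @ xs' @ ys')" for xs' ys' u
    using that
  proof (induction xs' ys' arbitrary: u z rule: shuffles.induct)
    case (3 x xs' y ys')
    from "3.prems"(3) consider z' where "z = x # z'" "z' \<in> shuffles xs' (y # ys')"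
      | z' where "z = y # z'" "z' \<in> shuffles (x # xs') ys'" by (auto simp: Cons_in_shuffles_iff)
    then show ?case
    proof cases
      case 1
      then show ?thesis using "3.IH"(1)[of z' "u @ [x]"] "3.prems" by simp
    next
      case 2
      have "Q (u @ y # (x # xs') @ ys')" using move[of "x # xs'" y u ys'] "3.prems" by simp
      then show ?thesis using "3.IH"(2)[of z' "u @ [y]"] "3.prems" 2 by simp
    qed
  qed auto
  then show ?thesis using assms(2,3) by blast
qed

definition word :: "('m + 'n) list \<Rightarrow> ('m + 'n \<Rightarrow> int) \<Rightarrow> letter list" where
  "word l x = map (\<lambda>p. if isl p then EpsAt (x p) else DelAt (x p)) l"

text \<open>The labels after the odd reflection that moves \<open>q\<close> in front of its neighbour \<open>p\<close>, for even \<open>p\<close> and odd \<open>q\<close>.\<close>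

definition reflect :: "('m + 'n) \<Rightarrow> ('m + 'n) \<Rightarrow> ('m + 'n \<Rightarrow> int) \<Rightarrow> 'm + 'n \<Rightarrow> int" where
  "reflect p q x = (if x p = x q then x(p := x p + 1, q := x q + 1) else x)"

lemma std_form_reflect:
  assumes "distinct (u @ p # q # t)" "isl p" "\<not> isl q"
  shows "std_form (word (u @ q # p # t) (reflect p q x)) = std_form (word (u @ p # q # t) x)"
proof -
  have w: "word u (reflect p q x) = word u x" "word t (reflect p q x) = word t x"
    using assms(1) by (auto simp: word_def reflect_def)
  show ?thesis
  proof (cases "x p = x q")
    case True
    then have "word (u @ q # p # t) (reflect p q x) = word u x @ DelAt (x p + 1) # EpsAt (x p + 1) # word t x"
      using w assms by (auto simp: word_def reflect_def)
    moreover have "word (u @ p # q # t) x = word u x @ EpsAt (x p) # DelAt (x p) # word t x"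
      using True assms by (simp add: word_def)
    ultimately show ?thesis using std_form_swap_equal[of "word u x" "x p + 1" "word t x"] by simp
  next
    case False
    then have "word (u @ q # p # t) (reflect p q x) = word u x @ DelAt (x q) # EpsAt (x p) # word t x"
      using assms by (simp add: word_def reflect_def)
    moreover have "word (u @ p # q # t) x = word u x @ EpsAt (x p) # DelAt (x q) # word t x"
      using assms by (simp add: word_def)
    ultimately show ?thesis using std_form_swap_distinct[OF False] by simp
  qed
qed

lemma index_order_swap:
  assumes "index_order (u @ Inl i # Inr j # t)"
  shows "index_order (u @ Inr j # Inl i # t)"
proof -
  let ?l = "u @ Inl i # Inr j # t" and ?l' = "u @ Inr j # Inl i # t"
  have "filter isl ?l' = filter isl ?l" "filter (\<lambda>p. \<not> isl p) ?l' = filter (\<lambda>p. \<not> isl p) ?l" by simp_all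
  then show ?thesis
    using partition_in_shuffles[of ?l' isl] index_order_filter[OF assms] unfolding index_order_def by simp
qed

context gl_module
begin

lemma highest_weight_vector_iff_hw:
  assumes "pos_roots B = positive P" "inj P"
  shows "highest_weight_vector B \<Lambda> v \<longleftrightarrow> hw P \<Lambda> v"
proof -
  have "(\<forall>H\<in>cartan. act H v = scale (weight_eval \<Lambda> H) v) \<longleftrightarrow> (\<forall>p. act (mat_unit p p) v = scale (\<Lambda> $ p) v)"
  proof (intro iffI allI ballI)
    fix p :: "'m + 'n" assume *: "\<forall>H\<in>cartan. act H v = scale (weight_eval \<Lambda> H) v"
    have "(mat_unit p p :: ('m, 'n) gl) \<in> cartan" by (auto simp: mat_unit_def cartan_def)
    moreover have "weight_eval \<Lambda> (mat_unit p p) = \<Lambda> $ p"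
      by (simp add: weight_eval_def mat_unit_def if_distrib[of "(*) _"] cong: if_cong)
    ultimately show "act (mat_unit p p) v = scale (\<Lambda> $ p) v" using * by metis
  next
    fix H :: "('m, 'n) gl" assume *: "\<forall>p. act (mat_unit p p) v = scale (\<Lambda> $ p) v" and "H \<in> cartan"
    then show "act H v = scale (weight_eval \<Lambda> H) v"
      by (simp add: act_cartan weight_eval_def scale_sum_left mult.commute)
  qed
  moreover have "(\<forall>\<alpha>\<in>positive P. \<forall>X\<in>root_space \<alpha>. act X v = 0) \<longleftrightarrow>
      (\<forall>p q. P p < P q \<longrightarrow> act (mat_unit p q) v = 0)"
  proof (intro iffI allI impI ballI)
    fix p q assume "\<forall>\<alpha>\<in>positive P. \<forall>X\<in>root_space \<alpha>. act X v = 0" "P p < P q"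
    then show "act (mat_unit p q) v = 0" using mat_unit_root_space[of p q] unfolding positive_def by blast
  next
    fix \<alpha> X assume *: "\<forall>p q. P p < P q \<longrightarrow> act (mat_unit p q) v = 0"
      and "\<alpha> \<in> positive P" and X: "X \<in> root_space \<alpha>"
    then obtain p q where pq: "\<alpha> = bvec p - bvec q" "P p < P q" unfolding positive_def by blast
    then have "p \<noteq> q" by auto
    then have "scale (X $ i $ j) (act (mat_unit i j) v) = 0" for i j
      using root_space_entry[OF X[unfolded pq(1)], of i j] * pq(2) by (cases "X $ i $ j = 0") auto
    then show "act X v = 0" unfolding act_expand[of X] by (intro sum.neutral ballI)
  qed
  ultimately show ?thesis unfolding highest_weight_vector_def hw_def assms(1) by simp
qed

lemma is_L_iff_hw:
  assumes "pos_roots B = positive P" "inj P"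
  shows "is_L B \<Lambda> \<longleftrightarrow> simple \<and> (\<exists>v. hw P \<Lambda> v)"
proof -
  have "W = UNIV" if "simple" "submodule W" "v \<in> W" "hw P \<Lambda> v" for v W
    using that unfolding simple_def hw_def by blast
  then have "highest_weight_module B \<Lambda> \<longleftrightarrow> (\<exists>v. hw P \<Lambda> v)" if "simple"
    using that unfolding highest_weight_module_def highest_weight_vector_iff_hw[OF assms] by metis
  then show ?thesis unfolding is_L_def by argo
qed

definition has_labels :: "('m + 'n) list \<Rightarrow> ('m + 'n \<Rightarrow> int) \<Rightarrow> bool" where
  "has_labels l x \<longleftrightarrow> (\<exists>v. hw (pos l) (wt x - rho (simple_of l)) v)"

text \<open>
  Exchanging \<open>p\<close> and \<open>q\<close> adds the root \<open>e\<^sub>p - e\<^sub>q\<close> to \<open>rho\<close>. If the labels differ, the highest weight loses this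
  root, and the shifted weight stays the same. If they agree, the highest weight stays, and both
  labels grow by one.
\<close>

lemma has_labels_reflect:
  assumes "simple" and l: "index_order (u @ Inl i # Inr j # t)"
    and "has_labels (u @ Inl i # Inr j # t) x"
  shows "has_labels (u @ Inr j # Inl i # t) (reflect (Inl i) (Inr j) x)"
proof -
  let ?p = "Inl i" and ?q = "Inr j"
  let ?l = "u @ ?p # ?q # t" and ?l' = "u @ ?q # ?p # t"
  note s = index_order_set[OF l] and s' = index_order_set[OF index_order_swap[OF l]]
  have lr: "lab (rho (simple_of ?l)) r = of_int (rho2 (pos ?l) r) / 2" for r
    by (rule lab_rho[OF pos_roots_simple_of(2)[OF s(2,1)]])
  have lr': "lab (rho (simple_of ?l')) r = of_int (rho2 (pos ?l') r) / 2" for r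
    by (rule lab_rho[OF pos_roots_simple_of(2)[OF s'(2,1)]])
  let ?S = "\<lambda>xs. sum_list (map sgn_idx (xs :: ('m + 'n) list))"
  have p: "rho2 (pos ?l) ?p = ?S t - ?S u - 1"
    using rho2_split[of u ?p "?q # t"] s by (simp add: sgn_idx_def)
  have q: "rho2 (pos ?l) ?q = ?S t - ?S u - 1"
    using rho2_split[of "u @ [?p]" ?q t] s by (simp add: sgn_idx_def)
  have p': "rho2 (pos ?l') ?p = ?S t - ?S u + 1"
    using rho2_split[of "u @ [?q]" ?p t] s' by (simp add: sgn_idx_def)
  have q': "rho2 (pos ?l') ?q = ?S t - ?S u + 1"
    using rho2_split[of u ?q "?p # t"] s' by (simp add: sgn_idx_def)
  have other: "rho2 (pos ?l') r = rho2 (pos ?l) r" if "r \<noteq> ?p" "r \<noteq> ?q" for r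
  proof -
    have "r \<in> set u \<or> r \<in> set t" using s(1) that by auto
    then show ?thesis
    proof
      assume "r \<in> set u"
      then obtain u1 u2 where u: "u = u1 @ r # u2" by (meson split_list)
      show ?thesis using rho2_split[of u1 r "u2 @ ?p # ?q # t"] rho2_split[of u1 r "u2 @ ?q # ?p # t"] s s'
        by (simp add: u)
    next
      assume "r \<in> set t"
      then obtain t1 t2 where t: "t = t1 @ r # t2" by (meson split_list)
      show ?thesis using rho2_split[of "u @ ?p # ?q # t1" r t2] rho2_split[of "u @ ?q # ?p # t1" r t2] s s'
        by (simp add: t)
    qed
  qed
  have rho': "rho (simple_of ?l') = rho (simple_of ?l) + (bvec ?p - bvec ?q)"
    unfolding weight_eq_iff_lab lab_add lab_diff lr lr'
  proof
    fix r
    have "lab (bvec ?p) r - lab (bvec ?q) r = (if r = ?p \<or> r = ?q then 1 else 0)"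
      by (auto simp: lab_def bvec_nth sgn_idx_def)
    moreover have "rho2 (pos ?l') r = rho2 (pos ?l) r + (if r = ?p \<or> r = ?q then 2 else 0)"
      using other[of r] p q p' q' by auto
    ultimately show "complex_of_int (rho2 (pos ?l') r) / 2 = of_int (rho2 (pos ?l) r) / 2 + (lab (bvec ?p) r - lab (bvec ?q) r)"
      by simp
  qed
  define \<Lambda> where "\<Lambda> = wt x - rho (simple_of ?l)"
  obtain v where v: "hw (pos ?l) \<Lambda> v" using assms(3) unfolding has_labels_def \<Lambda>_def by blast
  have "\<Lambda> $ ?p + \<Lambda> $ ?q = lab \<Lambda> ?p - lab \<Lambda> ?q" by (simp add: lab_def sgn_idx_def)
  also have "\<dots> = of_int (x ?p) - of_int (x ?q)" unfolding \<Lambda>_def lab_diff lab_wt lr p q by simp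
  finally have z: "\<Lambda> $ ?p + \<Lambda> $ ?q = 0 \<longleftrightarrow> x ?p = x ?q" by simp
  have pu: "?p \<notin> set u" "?q \<notin> set u" "?p \<notin> set t" "?q \<notin> set t" using s(2) by auto
  have pos_swap: "pos ?l' = (pos ?l)(?p := pos ?l ?q, ?q := pos ?l ?p)"
    using pu by (auto simp: fun_eq_iff pos_append)
  have "pos ?l ?q = Suc (pos ?l ?p)" using pu by (simp add: pos_append)
  from odd_reflection[OF assms(1) s(3) v this _ pos_swap]
  obtain v' where v': "hw (pos ?l') (if \<Lambda> $ ?p + \<Lambda> $ ?q = 0 then \<Lambda> else \<Lambda> - (bvec ?p - bvec ?q)) v'"
    by auto
  have "(if \<Lambda> $ ?p + \<Lambda> $ ?q = 0 then \<Lambda> else \<Lambda> - (bvec ?p - bvec ?q)) =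
      wt (reflect ?p ?q x) - rho (simple_of ?l')"
  proof (cases "x ?p = x ?q")
    case True
    have "wt (reflect ?p ?q x) = wt x + (bvec ?p - bvec ?q)"
      by (auto simp: vec_eq_iff wt_def reflect_def True bvec_nth sgn_idx_def)
    then show ?thesis using True z by (simp add: \<Lambda>_def rho')
  next
    case False
    then show ?thesis using z by (simp add: \<Lambda>_def rho' reflect_def)
  qed
  then have "hw (pos ?l') (wt (reflect ?p ?q x) - rho (simple_of ?l')) v'" using v' by (simp only:)
  then show ?thesis unfolding has_labels_def by blast
qed

text \<open>
  The labels of the module for another order are not computed. It is enough that odd reflections lead there and
  keep the standard form, which determines the labels by \<open>std_form_inj\<close>.
\<close>

lemma has_labels_exists:
  assumes "simple" "has_labels standard_order x0" "index_order l"
  shows "\<exists>x. has_labels l x \<and> std_form (word l x) = std_form (word standard_order x0)"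
proof -
  define Q where "Q l \<longleftrightarrow> index_order l \<and> (\<exists>x. has_labels l x \<and> std_form (word l x) = std_form (word standard_order x0))" for l
  have "Q ([] @ l)"
  proof (rule shuffle_reachable[of "map Inl (sorted_list_of_set UNIV)" "map Inr (sorted_list_of_set UNIV)"])
    show "l \<in> shuffles (map Inl (sorted_list_of_set UNIV)) (map Inr (sorted_list_of_set UNIV))"
      using assms(3) by (simp add: index_order_def)
    have "Q standard_order" using assms(2) index_order_standard unfolding Q_def by blast
    then show "Q ([] @ map Inl (sorted_list_of_set UNIV) @ map Inr (sorted_list_of_set UNIV))"
      by (simp add: standard_order_def)
    fix u t and p q :: "'m + 'n"
    assume "p \<in> set (map Inl (sorted_list_of_set UNIV))" "q \<in> set (map Inr (sorted_list_of_set UNIV))"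
      and Q: "Q (u @ p # q # t)"
    then obtain i j where pq: "p = Inl i" "q = Inr j" by auto
    obtain x where x: "index_order (u @ p # q # t)" "has_labels (u @ p # q # t) x"
        "std_form (word (u @ p # q # t) x) = std_form (word standard_order x0)"
      using Q unfolding Q_def by blast
    have "std_form (word (u @ q # p # t) (reflect p q x)) = std_form (word (u @ p # q # t) x)"
      by (rule std_form_reflect) (use index_order_set(2)[OF x(1)] pq in auto)
    then show "Q (u @ q # p # t)"
      using has_labels_reflect[OF assms(1), of u i j t x] index_order_swap[of u i j t] x
      unfolding Q_def pq by metis
  qed
  then show ?thesis by (simp add: Q_def)
qed

lemma has_labels_unique:
  assumes "simple" "index_order l" "has_labels l x" "hw (pos l) \<Lambda> v"
  shows "\<Lambda> + rho (simple_of l) = wt x"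
proof -
  obtain v' where "hw (pos l) (wt x - rho (simple_of l)) v'" using assms(3) unfolding has_labels_def by blast
  then have "\<Lambda> = wt x - rho (simple_of l)"
    using hw_unique[OF assms(1) index_order_set(3)[OF assms(2)] _ assms(4)] by blast
  then show ?thesis by simp
qed

end

section \<open>Isotropic sets and matchings\<close>

definition matching :: "('m + 'n \<Rightarrow> int) \<Rightarrow> ('m \<times> 'n) set \<Rightarrow> bool" where
  "matching x T \<longleftrightarrow> (\<forall>(i, j)\<in>T. x (Inl i) = x (Inr j)) \<and> inj_on fst T \<and> inj_on snd T"

definition root_set :: "('m \<times> 'n) set \<Rightarrow> ('m::finite, 'n::finite) weight set" where
  "root_set T = {eps i - del j | i j. (i, j) \<in> T}"

lemma lab_bvec: "lab (bvec p) q = (if p = q then of_int (sgn_idx p) else 0)"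
  by (simp add: lab_def bvec_nth)

lemma form_bvec_diff_bvec_diff:
  "form (bvec p - bvec q) (bvec r - bvec s) =
     (if p = r then of_int (sgn_idx p) else 0) - (if q = r then of_int (sgn_idx q) else 0)
     - (if p = s then of_int (sgn_idx p) else 0) + (if q = s then of_int (sgn_idx q) else 0)"
  by (simp add: form_bvec_diff lab_diff lab_bvec)

lemma form_uminus: "form (- x) y = - form x y" "form x (- y) = - form x y"
  by (simp_all add: form_def sum_negf)

lemma root_set_conv: "root_set T = (\<lambda>(i, j). bvec (Inl i) - bvec (Inr j)) ` T"
  unfolding root_set_def eps_bvec del_bvec by auto

lemma card_root_set: "card (root_set T) = card T"
  unfolding root_set_conv by (rule card_image) (auto simp: inj_on_def bvec_diff_eq_iff)

lemma matching_isotropic: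
  fixes T :: "('m::finite \<times> 'n::finite) set"
  assumes "matching x T"
  shows "isotropic_set (wt x) (root_set T)"
proof -
  have inj: "fst z = fst z' \<longleftrightarrow> snd z = snd z'" if "z \<in> T" "z' \<in> T" for z z'
    using assms that unfolding matching_def inj_on_def by metis
  have "vec.independent (root_set T)"
  proof (rule independentI_separating)
    fix a :: "('m, 'n) weight" assume "a \<in> root_set T"
    then obtain i j where a: "a = bvec (Inl i) - bvec (Inr j)" "(i, j) \<in> T" unfolding root_set_conv by auto
    let ?W = "{y :: ('m, 'n) weight. (\<Sum>r\<in>{Inl i}. y $ r) = 0}"
    have "root_set T - {a} \<subseteq> ?W"
    proof
      fix b assume b: "b \<in> root_set T - {a}"
      then obtain k l where kl: "b = bvec (Inl k) - bvec (Inr l)" "(k, l) \<in> T" unfolding root_set_conv by auto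
      have "k \<noteq> i" using inj[OF kl(2) a(2)] b kl a by auto
      then show "b \<in> ?W" by (simp add: kl bvec_nth)
    qed
    moreover have "a \<notin> ?W" by (simp add: a bvec_nth)
    ultimately show "\<exists>W. vec.subspace W \<and> root_set T - {a} \<subseteq> W \<and> a \<notin> W"
      using subspace_coordinate_sum by blast
  qed
  moreover have "root_set T \<subseteq> roots" unfolding root_set_conv by (auto simp: bvec_diff_root)
  moreover have "form (wt x) \<beta> = 0" if "\<beta> \<in> root_set T" for \<beta>
    using that assms unfolding root_set_conv matching_def by (auto simp: form_bvec_diff)
  moreover have "form \<beta> \<gamma> = 0" if "\<beta> \<in> root_set T" "\<gamma> \<in> root_set T" for \<beta> \<gamma>
  proof -
    obtain z z' where z: "z \<in> T" "z' \<in> T" "\<beta> = bvec (Inl (fst z)) - bvec (Inr (snd z))"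
        "\<gamma> = bvec (Inl (fst z')) - bvec (Inr (snd z'))"
      using \<open>\<beta> \<in> root_set T\<close> \<open>\<gamma> \<in> root_set T\<close> unfolding root_set_conv by (auto simp: split_def)
    show ?thesis using inj[OF z(1,2)] by (auto simp: z(3,4) form_bvec_diff_bvec_diff sgn_idx_def)
  qed
  ultimately show ?thesis unfolding isotropic_set_def by blast
qed

lemma isotropic_root_odd:
  assumes "\<beta> \<in> roots" "form \<beta> \<beta> = 0"
  obtains i j where "\<beta> = bvec (Inl i) - bvec (Inr j) \<or> \<beta> = - (bvec (Inl i) - bvec (Inr j))"
proof -
  obtain p q where pq: "\<beta> = bvec p - bvec q" "p \<noteq> q" using assms(1) unfolding roots_conv by auto
  then have "(of_int (sgn_idx p + sgn_idx q) :: complex) = 0"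
    using assms(2) by (simp add: form_bvec_diff_bvec_diff)
  then have "isl p \<noteq> isl q" by (auto simp: sgn_idx_def split: if_splits)
  then show thesis using pq(1) that by (cases p; cases q) auto
qed

text \<open>
  An isotropic root is odd. Two different roots \<open>eps i - del j\<close> are orthogonal if and only if they have no
  index in common, and linear independence excludes a root together with its negative.
\<close>

lemma isotropic_matching:
  fixes S :: "('m::finite, 'n::finite) weight set"
  assumes "isotropic_set (wt x) S"
  shows "\<exists>T. matching x T \<and> card T = card S"
proof -
  have S: "S \<subseteq> roots" "vec.independent S" "\<And>\<beta>. \<beta> \<in> S \<Longrightarrow> form (wt x) \<beta> = 0"
    "\<And>\<beta> \<gamma>. \<beta> \<in> S \<Longrightarrow> \<gamma> \<in> S \<Longrightarrow> form \<beta> \<gamma> = 0"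
    using assms unfolding isotropic_set_def by auto
  define root :: "'m \<times> 'n \<Rightarrow> ('m, 'n) weight" where "root z = bvec (Inl (fst z)) - bvec (Inr (snd z))" for z
  have neq: "root z \<noteq> - root z'" for z z'
  proof
    assume "root z = - root z'"
    then have "root z $ Inl (fst z) = - root z' $ Inl (fst z)" by simp
    then show False by (auto simp: root_def bvec_nth split: if_splits)
  qed
  have root_inj: "z = z'" if "root z = root z'" for z z'
    using that by (simp add: root_def bvec_diff_eq_iff prod_eq_iff)
  \<comment> \<open>A root and its negative are linearly dependent.\<close>
  have not_both: "- root z \<notin> S" if "root z \<in> S" for z
  proof
    assume neg: "- root z \<in> S"
    have "- root z \<in> vec.span {root z}" by (simp add: vec.span_base vec.span_neg)
    moreover have "{root z} \<subseteq> S - {- root z}" using that neq[of z z] by auto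
    ultimately have "- root z \<in> vec.span (S - {- root z})" using vec.span_mono by blast
    then show False using S(2) neg unfolding vec.dependent_def by blast
  qed
  define T where "T = {z. root z \<in> S \<or> - root z \<in> S}"
  define g where "g z = (if root z \<in> S then root z else - root z)" for z
  have "bij_betw g T S"
  proof (rule bij_betw_imageI)
    show "inj_on g T"
      unfolding inj_on_def g_def using root_inj neq by (metis minus_equation_iff)
    show "g ` T = S"
    proof
      show "g ` T \<subseteq> S" by (auto simp: g_def T_def)
      show "S \<subseteq> g ` T"
      proof
        fix \<beta> assume b: "\<beta> \<in> S"
        obtain i j where "\<beta> = bvec (Inl i) - bvec (Inr j) \<or> \<beta> = - (bvec (Inl i) - bvec (Inr j))"
          using isotropic_root_odd[of \<beta>] b S(1,4) by blast
        then have "\<beta> = root (i, j) \<or> \<beta> = - root (i, j)" by (simp add: root_def)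
        then show "\<beta> \<in> g ` T"
          using b not_both[of "(i, j)"] by (intro image_eqI[of _ _ "(i, j)"]) (auto simp: g_def T_def)
      qed
    qed
  qed
  then have "card T = card S" by (rule bij_betw_same_card)
  moreover have "form (root z) (root z') = 0" if "z \<in> T" "z' \<in> T" for z z'
  proof -
    have "form (g z) (g z') = 0" using that S(4) by (auto simp: g_def T_def)
    then show ?thesis by (simp add: g_def form_uminus split: if_splits)
  qed
  then have inj: "fst z = fst z' \<longleftrightarrow> snd z = snd z'" if "z \<in> T" "z' \<in> T" for z z'
    using that by (fastforce simp: root_def form_bvec_diff_bvec_diff sgn_idx_def split: if_splits)
  have "form (wt x) (root z) = 0" if "z \<in> T" for z
  proof -
    have "form (wt x) (g z) = 0" using that S(3) by (auto simp: g_def T_def)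
    then show ?thesis by (simp add: g_def form_uminus split: if_splits)
  qed
  then have "x (Inl (fst z)) = x (Inr (snd z))" if "z \<in> T" for z
    using that by (simp add: root_def form_bvec_diff)
  ultimately show ?thesis using inj unfolding matching_def inj_on_def
    by (intro exI[of _ T]) (auto simp: split_def prod_eq_iff)
qed

lemma count_word:
  assumes "distinct l" "set l = UNIV"
  shows "count_list (word l x) (EpsAt v) = card {i. x (Inl i) = v}"
    "count_list (word l x) (DelAt v) = card {j. x (Inr j) = v}"
proof -
  have gen: "count_list (map f l) y = card {p. f p = y}" for f :: "_ \<Rightarrow> letter" and y
  proof -
    have "count_list (map f l) y = length (filter (\<lambda>p. f p = y) l)" by (induction l) auto
    also have "\<dots> = card (set (filter (\<lambda>p. f p = y) l))"
      using distinct_card[OF distinct_filter[OF assms(1)]] by metis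
    finally show ?thesis using assms(2) by simp
  qed
  have "{p. (if isl p then EpsAt (x p) else DelAt (x p)) = EpsAt v} = Inl ` {i. x (Inl i) = v}"
    by (auto simp: isl_def image_iff)
  then show "count_list (word l x) (EpsAt v) = card {i. x (Inl i) = v}"
    unfolding word_def gen by (simp add: card_image)
  have "{p. (if isl p then EpsAt (x p) else DelAt (x p)) = DelAt v} = Inr ` {j. x (Inr j) = v}"
  proof (intro set_eqI)
    fix p show "p \<in> {p. (if isl p then EpsAt (x p) else DelAt (x p)) = DelAt v} \<longleftrightarrow> p \<in> Inr ` {j. x (Inr j) = v}"
      by (cases p) auto
  qed
  then show "count_list (word l x) (DelAt v) = card {j. x (Inr j) = v}"
    unfolding word_def gen by (simp add: card_image)
qed

text \<open>
  The pairs of a matching with value \<open>v\<close> use each \<open>eps\<close> and each \<open>del\<close> with label \<open>v\<close> at most once.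
  If the matching cannot be extended, they exhaust one of the two types.
\<close>

lemma card_matching:
  fixes T :: "('m::{finite,linorder} \<times> 'n::{finite,linorder}) set"
  assumes "index_order l" "matching x T"
  shows "card T \<le> match_number (word l x)"
    "(\<And>i j. i \<notin> fst ` T \<Longrightarrow> j \<notin> snd ` T \<Longrightarrow> x (Inl i) \<noteq> x (Inr j)) \<Longrightarrow>
       card T = match_number (word l x)"
proof -
  note s = index_order_set(2,1)[OF assms(1)]
  have T: "x (Inl (fst z)) = x (Inr (snd z))" if "z \<in> T" for z
    using assms(2) that by (auto simp: matching_def)
  have inj: "inj_on fst T" "inj_on snd T" using assms(2) by (auto simp: matching_def)
  define R where "R = range (\<lambda>i. x (Inl i))"
  have R: "{v. EpsAt v \<in> set (word l x)} = R"
  proof (intro set_eqI)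
    fix v show "v \<in> {v. EpsAt v \<in> set (word l x)} \<longleftrightarrow> v \<in> R"
      unfolding mem_Collect_eq word_def R_def set_map s image_iff by (auto simp: split_sum_ex)
  qed
  define Tv where "Tv v = {z\<in>T. x (Inl (fst z)) = v}" for v
  have "card T = (\<Sum>v\<in>R. card (Tv v))"
  proof -
    have "T = (\<Union>v\<in>R. Tv v)" by (auto simp: Tv_def R_def)
    then have "card T = card (\<Union>v\<in>R. Tv v)" by simp
    also have "\<dots> = (\<Sum>v\<in>R. card (Tv v))" by (rule card_UN_disjoint) (auto simp: R_def Tv_def)
    finally show ?thesis .
  qed
  moreover have mn: "match_number (word l x) = (\<Sum>v\<in>R. min (card {i. x (Inl i) = v}) (card {j. x (Inr j) = v}))"
    by (simp add: match_number_def R count_word[OF s])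
  have f: "card (Tv v) = card (fst ` Tv v)" "fst ` Tv v \<subseteq> {i. x (Inl i) = v}"
    "card (Tv v) = card (snd ` Tv v)" "snd ` Tv v \<subseteq> {j. x (Inr j) = v}" for v
    using T inj by (auto simp: Tv_def intro!: card_image[symmetric] inj_on_subset[of _ T])
  have le: "card (Tv v) \<le> min (card {i. x (Inl i) = v}) (card {j. x (Inr j) = v})" for v
    using card_mono[OF _ f(2)[of v]] card_mono[OF _ f(4)[of v]] f(1,3)[of v] by simp
  ultimately show "card T \<le> match_number (word l x)" unfolding mn by (simp add: sum_mono)
  assume max: "\<And>i j. i \<notin> fst ` T \<Longrightarrow> j \<notin> snd ` T \<Longrightarrow> x (Inl i) \<noteq> x (Inr j)"
  have "card (Tv v) = min (card {i. x (Inl i) = v}) (card {j. x (Inr j) = v})" for v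
  proof -
    have "fst ` Tv v = {i. x (Inl i) = v} \<or> snd ` Tv v = {j. x (Inr j) = v}"
    proof (rule ccontr)
      assume "\<not> ?thesis"
      then obtain i j where ij: "x (Inl i) = v" "i \<notin> fst ` Tv v" "x (Inr j) = v" "j \<notin> snd ` Tv v"
        using f(2,4)[of v] by blast
      have "i \<notin> fst ` T" using ij(1,2) by (auto simp: Tv_def)
      moreover have "j \<notin> snd ` T" using ij(3,4) T by (auto simp: Tv_def image_iff)
      ultimately show False using max ij by metis
    qed
    then have "card (Tv v) = card {i. x (Inl i) = v} \<or> card (Tv v) = card {j. x (Inr j) = v}"
      using f(1,3)[of v] by auto
    then show ?thesis using le[of v] by auto
  qed
  then show "card T = match_number (word l x)" using \<open>card T = (\<Sum>v\<in>R. card (Tv v))\<close> mn by simp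
qed

lemma isotropic_card_le:
  assumes "index_order l" "isotropic_set (wt x) S"
  shows "card S \<le> match_number (word l x)"
  using isotropic_matching[OF assms(2)] card_matching(1)[OF assms(1)] by metis

text \<open>
  Adding one more pair of equal labels to the matching of a maximal set is impossible, and that
  suffices for the largest cardinality by \<open>card_matching\<close>.
\<close>

lemma maximal_isotropic_card:
  assumes "index_order l" "maximal_isotropic_set (wt x) S"
  shows "card S = match_number (word l x)"
proof -
  obtain T where T: "matching x T" "card T = card S"
    using isotropic_matching assms(2) unfolding maximal_isotropic_set_def by blast
  have "x (Inl i) \<noteq> x (Inr j)" if "i \<notin> fst ` T" "j \<notin> snd ` T" for i j
  proof
    assume eq: "x (Inl i) = x (Inr j)"
    have "matching x (insert (i, j) T)" using T(1) eq that by (auto simp: matching_def)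
    then have "card (insert (i, j) T) \<le> card S"
      using matching_isotropic card_root_set assms(2) unfolding maximal_isotropic_set_def by metis
    moreover have "(i, j) \<notin> T" using that by force
    ultimately show False using T(2) by simp
  qed
  then show ?thesis using card_matching(2)[OF assms(1) T(1)] T(2) by simp
qed

lemma maximal_isotropicI:
  assumes "index_order l" "isotropic_set (wt x) S" "card S = match_number (word l x)"
  shows "maximal_isotropic_set (wt x) S"
  using assms isotropic_card_le unfolding maximal_isotropic_set_def by metis

lemma adjacent_Nil: "\<not> adjacent [] p q"
  by (simp add: adjacent_def)

lemma adjacent_Cons_iff: "adjacent (x # l) p q \<longleftrightarrow> adjacent l p q \<or> (l \<noteq> [] \<and> p = x \<and> q = hd l)"
proof -
  have "\<not> adjacent [x] p q" by (simp add: adjacent_def append_eq_Cons_conv Cons_eq_append_conv)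
  then show ?thesis using adjacent_append_iff[of "[x]" l p q] by simp
qed

text \<open>
  Orthogonality makes the neighbouring pairs of an isotropic set of simple roots disjoint. A pair \<open>del eps\<close> is
  replaced by the pair \<open>eps del\<close> with labels lowered by one, which does not change the standard form.
\<close>

lemma isotropic_paired:
  fixes l :: "('m::finite + 'n::finite) list"
  assumes "distinct l" "S \<subseteq> simple_of l" "finite S" "\<And>\<beta>. \<beta> \<in> S \<Longrightarrow> form (wt x) \<beta> = 0"
    "\<And>\<beta> \<gamma>. \<beta> \<in> S \<Longrightarrow> \<gamma> \<in> S \<Longrightarrow> form \<beta> \<gamma> = 0"
  shows "\<exists>w. std_form w = std_form (word l x) \<and> paired w (card S)"
  using assms
proof (induction "length l" arbitrary: l S rule: less_induct)
  case less
  show ?case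
  proof (cases l)
    case Nil
    then have "S = {}" using less.prems(2) by (auto simp: simple_of_def adjacent_Nil)
    then show ?thesis using Nil by (intro exI[of _ "[]"]) (simp add: word_def paired.Nil)
  next
    case (Cons p l1)
    define c where "c = (if isl p then EpsAt (x p) else DelAt (x p))"
    have wl: "word l x = c # word l1 x" by (simp add: word_def Cons c_def)
    show ?thesis
    proof (cases "S \<subseteq> simple_of l1")
      case True
      obtain w where w: "std_form w = std_form (word l1 x)" "paired w (card S)"
        using less.hyps[of l1 S] less.prems True Cons by auto
      have "std_form (c # w) = std_form (word l x)" using std_form_append_cong[OF w(1), of "[c]"] wl by simp
      then show ?thesis using paired.single[OF w(2)] by blast
    next
      case False
      then obtain p' q' where new: "bvec p' - bvec q' \<in> S" "adjacent l p' q'" "\<not> adjacent l1 p' q'"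
        using less.prems(2) unfolding simple_of_def by blast
      then obtain q t where l1: "l1 = q # t" and \<beta>S: "bvec p - bvec q \<in> S"
        unfolding Cons by (cases l1) (auto simp: adjacent_Cons_iff)
      define \<beta> :: "('m, 'n) weight" where "\<beta> = bvec p - bvec q"
      have pq: "p \<noteq> q" "p \<notin> set t" "q \<notin> set t" "distinct t" using less.prems(1) by (auto simp: Cons l1)
      have "S - {\<beta>} \<subseteq> simple_of t"
      proof
        fix \<gamma> assume \<gamma>: "\<gamma> \<in> S - {\<beta>}"
        then obtain p' q' where pq': "\<gamma> = bvec p' - bvec q'" "adjacent l p' q'"
          using less.prems(2) unfolding simple_of_def by blast
        then consider "\<gamma> = \<beta>" | "t \<noteq> []" "\<gamma> = bvec q - bvec (hd t)" | "adjacent t p' q'"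
          by (auto simp: Cons l1 adjacent_Cons_iff \<beta>_def)
        then show "\<gamma> \<in> simple_of t"
        proof cases
          case 2
          have "hd t \<in> set t" using 2 by simp
          then have "form \<beta> \<gamma> = - of_int (sgn_idx q)" using pq by (auto simp: 2 \<beta>_def form_bvec_diff_bvec_diff)
          moreover have "form \<beta> \<gamma> = 0" using less.prems(5) \<beta>S \<gamma> by (simp add: \<beta>_def)
          ultimately show ?thesis by (simp add: sgn_idx_def split: if_splits)
        qed (use \<gamma> pq' in \<open>auto simp: simple_of_def\<close>)
      qed
      then obtain w where w: "std_form w = std_form (word t x)" "paired w (card (S - {\<beta>}))"
        using less.hyps[of t "S - {\<beta>}"] less.prems pq(4) by (auto simp: Cons l1)
      have card: "card S = Suc (card (S - {\<beta>}))" using card_Suc_Diff1[OF less.prems(3) \<beta>S] by (simp add: \<beta>_def)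
      have "form (wt x) \<beta> = 0" using less.prems(4) \<beta>S by (simp add: \<beta>_def)
      then have xpq: "x p = x q" by (simp add: \<beta>_def form_bvec_diff)
      have "form \<beta> \<beta> = 0" using less.prems(5) \<beta>S by (simp add: \<beta>_def)
      then have "(of_int (sgn_idx p + sgn_idx q) :: complex) = 0" using pq(1) by (simp add: \<beta>_def form_bvec_diff_bvec_diff)
      then have opp: "isl p \<noteq> isl q" by (auto simp: sgn_idx_def split: if_splits)
      show ?thesis
      proof (cases "isl p")
        case True
        then have "word l x = [EpsAt (x p), DelAt (x p)] @ word t x" using opp xpq by (simp add: word_def Cons l1)
        then have "std_form (EpsAt (x p) # DelAt (x p) # w) = std_form (word l x)" using w(1) by simp
        then show ?thesis using paired.pair[OF w(2), of "x p"] card by metis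
      next
        case False
        then have "word l x = [DelAt (x p), EpsAt (x p)] @ word t x" using opp xpq by (simp add: word_def Cons l1)
        then have "std_form (EpsAt (x p - 1) # DelAt (x p - 1) # w) = std_form (word l x)" using w(1) by simp
        then show ?thesis using paired.pair[OF w(2), of "x p - 1"] card by metis
      qed
    qed
  qed
qed

lemma paired_matching:
  fixes l :: "('m::finite + 'n::finite) list"
  assumes "paired w k" "w = word l x" "distinct l"
  shows "\<exists>T. matching x T \<and> card T = k \<and> (\<forall>(i, j)\<in>T. Inl i \<in> set l \<and> Inr j \<in> set l \<and> adjacent l (Inl i) (Inr j))"
  using assms
proof (induction arbitrary: l rule: paired.induct)
  case Nil
  then show ?case by (intro exI[of _ "{}"]) (simp add: matching_def)
next
  case (single w k c)
  then obtain p t where l: "l = p # t" "w = word t x" by (cases l) (auto simp: word_def)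
  obtain T where T: "matching x T" "card T = k"
      "\<forall>(i, j)\<in>T. Inl i \<in> set t \<and> Inr j \<in> set t \<and> adjacent t (Inl i) (Inr j)"
    using single.IH[OF l(2)] single.prems l by auto
  then show ?case by (intro exI[of _ T]) (auto simp: l adjacent_Cons_iff)
next
  case (pair w k y)
  from pair.prems(1) obtain p q t where l: "l = p # q # t" "w = word t x"
    "(if isl p then EpsAt (x p) else DelAt (x p)) = EpsAt y" "(if isl q then EpsAt (x q) else DelAt (x q)) = DelAt y"
    unfolding word_def by (cases l; cases "tl l") auto
  from l(3,4) obtain i j where pq: "p = Inl i" "q = Inr j" "x (Inl i) = y" "x (Inr j) = y"
    by (cases p; cases q) auto
  obtain T where T: "matching x T" "card T = k"
      "\<forall>(i, j)\<in>T. Inl i \<in> set t \<and> Inr j \<in> set t \<and> adjacent t (Inl i) (Inr j)"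
    using pair.IH[OF l(2)] pair.prems l by auto
  have new: "i \<notin> fst ` T" "j \<notin> snd ` T" using T(3) pair.prems(2) l pq by fastforce+
  then have "matching x (insert (i, j) T)" using T(1) pq by (auto simp: matching_def)
  moreover have "(i, j) \<notin> T" using new by force
  then have "card (insert (i, j) T) = Suc k" using T(2) by simp
  ultimately show ?case using T(3)
    by (intro exI[of _ "insert (i, j) T"]) (auto simp: l pq adjacent_Cons_iff)
qed

section \<open>The standard order and the theorem\<close>

lemma shuffle_with_shape:
  assumes "length (filter id bs) = length xs" "length (filter Not bs) = length ys"
    "\<forall>x\<in>set xs. P x" "\<forall>y\<in>set ys. \<not> P y"
  shows "\<exists>z\<in>shuffles xs ys. map P z = bs"
  using assms
proof (induction bs arbitrary: xs ys)
  case Nil then show ?case by simp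
next
  case (Cons b bs)
  show ?case
  proof (cases b)
    case True
    then obtain x xs' where xs: "xs = x # xs'" using Cons.prems(1) by (cases xs) auto
    then obtain z where "z \<in> shuffles xs' ys" "map P z = bs" using Cons.IH[of xs' ys] Cons.prems True by auto
    then show ?thesis using Cons.prems True xs by (intro bexI[of _ "x # z"]) (auto intro: Cons_in_shuffles_leftI)
  next
    case False
    then obtain y ys' where ys: "ys = y # ys'" using Cons.prems(2) by (cases ys) auto
    then obtain z where "z \<in> shuffles xs ys'" "map P z = bs" using Cons.IH[of xs ys'] Cons.prems False by auto
    then show ?thesis using Cons.prems False ys by (intro bexI[of _ "y # z"]) (auto intro: Cons_in_shuffles_rightI)
  qed
qed

lemma std_form_standard: "std_form (map EpsAt a @ map DelAt b) = (a, b)"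
proof -
  have "std_form (map DelAt b) = ([], b)" by (induction b) auto
  then show ?thesis by (induction a) auto
qed

lemma std_form_word_standard:
  "std_form (word standard_order x) =
     (map (\<lambda>i. x (Inl i)) (sorted_list_of_set UNIV), map (\<lambda>j. x (Inr j)) (sorted_list_of_set UNIV))"
proof -
  have "word standard_order x = map EpsAt (map (\<lambda>i. x (Inl i)) (sorted_list_of_set UNIV)) @
      map DelAt (map (\<lambda>j. x (Inr j)) (sorted_list_of_set UNIV))"
    by (simp add: word_def standard_order_def)
  then show ?thesis by (simp only: std_form_standard)
qed

lemma sorted_list_split:
  fixes i j :: "'a::{finite,linorder}"
  assumes "i < j"
  obtains a b c where "sorted_list_of_set UNIV = a @ i # b @ j # c"
proof -
  have "i \<in> set (sorted_list_of_set UNIV)" by simp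
  then obtain a d where ad: "sorted_list_of_set UNIV = a @ i # d" by (meson split_list)
  have "sorted_wrt (<) (a @ i # d)" unfolding ad[symmetric] by simp
  then have "j \<notin> set a" using assms by (auto simp: sorted_wrt_append)
  moreover have "j \<in> set (a @ i # d)" unfolding ad[symmetric] by simp
  ultimately have "j \<in> set d" using assms by auto
  then obtain b c where "d = b @ j # c" by (meson split_list)
  then show thesis using that ad by simp
qed

lemma rho2_standard:
  fixes i j :: "'m::{finite,linorder}" and k k' :: "'n::{finite,linorder}"
  shows "i < j \<Longrightarrow> rho2 (pos (standard_order :: ('m + 'n) list)) (Inl j) < rho2 (pos (standard_order :: ('m + 'n) list)) (Inl i)"
    "k < k' \<Longrightarrow> rho2 (pos (standard_order :: ('m + 'n) list)) (Inr k) < rho2 (pos (standard_order :: ('m + 'n) list)) (Inr k')"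
proof -
  let ?l = "standard_order :: ('m + 'n) list"
  note s = index_order_set(2,1)[OF index_order_standard, where 'a = 'm and 'b = 'n]
  have L: "sum_list (map sgn_idx (map Inl xs :: ('m + 'n) list)) = int (length xs)" for xs
    by (induction xs) (auto simp: sgn_idx_def)
  have R: "sum_list (map sgn_idx (map Inr xs :: ('m + 'n) list)) = - int (length xs)" for xs
    by (induction xs) (auto simp: sgn_idx_def)
  {
    assume "i < j"
    then obtain a b c where abc: "sorted_list_of_set UNIV = a @ i # b @ j # c" by (rule sorted_list_split)
    define D where "D = (map Inr (sorted_list_of_set UNIV) :: ('m + 'n) list)"
    have l: "?l = map Inl a @ Inl i # (map Inl b @ Inl j # map Inl c @ D)"
       "?l = (map Inl a @ Inl i # map Inl b) @ Inl j # (map Inl c @ D)"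
      by (simp_all add: standard_order_def abc D_def)
    show "rho2 (pos ?l) (Inl j) < rho2 (pos ?l) (Inl i)"
      using rho2_split[OF s[unfolded l(1)]] rho2_split[OF s[unfolded l(2)]]
      unfolding l(1)[symmetric] l(2)[symmetric] by (simp add: L[unfolded map_map] sgn_idx_def)
  next
    assume "k < k'"
    then obtain a b c where abc: "sorted_list_of_set UNIV = a @ k # b @ k' # c" by (rule sorted_list_split)
    define E where "E = (map Inl (sorted_list_of_set UNIV) :: ('m + 'n) list)"
    have l: "?l = (E @ map Inr a) @ Inr k # (map Inr b @ Inr k' # map Inr c)"
       "?l = (E @ map Inr a @ Inr k # map Inr b) @ Inr k' # (map Inr c)"
      by (simp_all add: standard_order_def abc E_def)
    show "rho2 (pos ?l) (Inr k) < rho2 (pos ?l) (Inr k')"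
      using rho2_split[OF s[unfolded l(1)]] rho2_split[OF s[unfolded l(2)]]
      unfolding l(1)[symmetric] l(2)[symmetric] by (simp add: R[unfolded map_map] sgn_idx_def)
  }
qed

text \<open>
  Dominance of the highest weight gives weak monotonicity of the labels, and the labels of \<open>rho\<close>
  make it strict.
\<close>

lemma standard_labels:
  fixes \<Lambda> :: "('m::{finite,linorder}, 'n::{finite,linorder}) weight"
  assumes "\<Lambda> \<in> PP_plus pi_st"
  obtains x where "\<Lambda> + rho pi_st = wt x" "\<And>i j. i < j \<Longrightarrow> x (Inl j) < x (Inl i)"
    "\<And>k k'. k < k' \<Longrightarrow> x (Inr k) < x (Inr k')"
proof -
  have "lab (\<Lambda> + rho pi_st) p \<in> \<int>" for p
    using assms unfolding PP_plus_def by (cases p) (auto simp: eps_bvec del_bvec form_bvec)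
  then have "\<forall>p. \<exists>z. lab (\<Lambda> + rho pi_st) p = of_int z" by (metis Ints_cases)
  then obtain x where x: "\<And>p. lab (\<Lambda> + rho pi_st) p = of_int (x p)" by metis
  have "\<Lambda> + rho pi_st = wt x" by (simp add: weight_eq_iff_lab x)
  let ?P = "pos (standard_order :: ('m + 'n) list)"
  note s = index_order_set(2,1)[OF index_order_standard, where 'a = 'm and 'b = 'n]
  have rho: "lab (rho pi_st) p = of_int (rho2 ?P p) / 2" for p
    unfolding pi_st_simple_of by (rule lab_rho[OF pos_roots_simple_of(2)[OF s]])
  have lab: "lab \<Lambda> p = of_int (x p) - of_int (rho2 ?P p) / 2" for p
    using x[of p] unfolding lab_add rho by (simp add: algebra_simps)
  have lab2: "2 * complex_of_int (x p) = 2 * lab \<Lambda> p + of_int (rho2 ?P p)" for p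
    unfolding lab by (simp add: algebra_simps)
  have P: "2 * form \<Lambda> \<alpha> / form \<alpha> \<alpha> \<in> \<nat>" if "\<alpha> \<in> even_pos_roots" for \<alpha>
    using assms that unfolding PP_plus_def P_plus_def by blast
  have "x (Inl j) < x (Inl i)" if "i < j" for i j
  proof -
    have "bvec (Inl i) - bvec (Inl j) \<in> even_pos_roots" using that by (simp add: bvec_diff_even_pos_iff)
    moreover have "form (bvec (Inl i) - bvec (Inl j)) (bvec (Inl i) - bvec (Inl j) :: ('m, 'n) weight) = 2"
      using that by (auto simp: form_bvec_diff_bvec_diff sgn_idx_def)
    ultimately have "2 * (lab \<Lambda> (Inl i) - lab \<Lambda> (Inl j)) / 2 \<in> \<nat>"
      using P by (metis form_bvec_diff)
    then obtain n :: nat where "2 * (lab \<Lambda> (Inl i) - lab \<Lambda> (Inl j)) / 2 = of_nat n"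
      by (rule Nats_cases)
    moreover have "2 * z / 2 = z" for z :: complex by simp
    ultimately have "lab \<Lambda> (Inl i) - lab \<Lambda> (Inl j) = of_nat n" by (simp only:)
    then have "lab \<Lambda> (Inl i) = lab \<Lambda> (Inl j) + of_nat n" by (simp add: diff_eq_eq add.commute)
    then have "complex_of_int (2 * x (Inl i) - 2 * x (Inl j)) =
        of_int (rho2 ?P (Inl i) - rho2 ?P (Inl j) + 2 * int n)"
      by (simp add: lab2 algebra_simps)
    then have "2 * x (Inl i) - 2 * x (Inl j) = rho2 ?P (Inl i) - rho2 ?P (Inl j) + 2 * int n"
      by (simp only: of_int_eq_iff)
    then show ?thesis using rho2_standard(1)[OF that, where 'n = 'n] by linarith
  qed
  moreover have "x (Inr k) < x (Inr k')" if "k < k'" for k k'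
  proof -
    have "bvec (Inr k) - bvec (Inr k') \<in> even_pos_roots" using that by (simp add: bvec_diff_even_pos_iff)
    moreover have "form (bvec (Inr k) - bvec (Inr k')) (bvec (Inr k) - bvec (Inr k') :: ('m, 'n) weight) = - 2"
      using that by (auto simp: form_bvec_diff_bvec_diff sgn_idx_def)
    ultimately have "2 * (lab \<Lambda> (Inr k) - lab \<Lambda> (Inr k')) / - 2 \<in> \<nat>"
      using P by (metis form_bvec_diff)
    then obtain n :: nat where "2 * (lab \<Lambda> (Inr k) - lab \<Lambda> (Inr k')) / - 2 = of_nat n"
      by (rule Nats_cases)
    moreover have "2 * z / - 2 = - z" for z :: complex by simp
    ultimately have "lab \<Lambda> (Inr k') - lab \<Lambda> (Inr k) = of_nat n" by (simp only: minus_diff_eq)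
    then have "lab \<Lambda> (Inr k') = lab \<Lambda> (Inr k) + of_nat n" by (simp add: diff_eq_eq add.commute)
    then have "complex_of_int (2 * x (Inr k') - 2 * x (Inr k)) =
        of_int (rho2 ?P (Inr k') - rho2 ?P (Inr k) + 2 * int n)"
      by (simp add: lab2 algebra_simps)
    then have "2 * x (Inr k') - 2 * x (Inr k) = rho2 ?P (Inr k') - rho2 ?P (Inr k) + 2 * int n"
      by (simp only: of_int_eq_iff)
    then show ?thesis using rho2_standard(2)[OF that, where 'm = 'm] by linarith
  qed
  ultimately show thesis using that \<open>\<Lambda> + rho pi_st = wt x\<close> by blast
qed

text \<open>
  When the labels within each type are distinct, all pairs of equal labels together form the only
  maximal isotropic set of roots \<open>eps i - del j\<close>, so that its extreme labels are those of \<open>A \<inter> B\<close>.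
\<close>

lemma interval_property_iff:
  fixes x :: "'m::{finite,linorder} + 'n::{finite,linorder} \<Rightarrow> int"
  assumes "inj (\<lambda>i. x (Inl i))" "inj (\<lambda>j. x (Inr j))"
  shows "interval_property (wt x) \<longleftrightarrow> connected_pair (range (\<lambda>i. x (Inl i))) (range (\<lambda>j. x (Inr j)))"
proof -
  have a: "a_coeff (wt x) i = of_int (x (Inl i))" for i by (simp add: a_coeff_def wt_def sgn_idx_def)
  have b: "b_coeff (wt x) j = of_int (x (Inr j))" for j by (simp add: b_coeff_def wt_def sgn_idx_def)
  let ?A = "range (\<lambda>i. x (Inl i))" and ?B = "range (\<lambda>j. x (Inr j))"
  have mem: "of_int z \<in> range (a_coeff (wt x)) \<union> range (b_coeff (wt x)) \<longleftrightarrow> z \<in> ?A \<union> ?B" for z :: int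
    by (auto simp: a b image_iff)
  show ?thesis
  proof
    assume ip: "interval_property (wt x)"
    show "connected_pair ?A ?B" unfolding connected_pair_def
    proof (intro ballI subsetI)
      fix u v z assume u: "u \<in> ?A \<inter> ?B" and v: "v \<in> ?A \<inter> ?B" and z: "z \<in> {u..v}"
      define T where "T = {(i, j). x (Inl i) = x (Inr j)}"
      have T: "matching x T" using assms by (auto simp: matching_def T_def inj_on_def)
      have "x (Inl i) \<noteq> x (Inr j)" if "i \<notin> fst ` T" for i j
        using that by (force simp: T_def)
      then have "card T = match_number (word standard_order x)"
        using card_matching(2)[OF index_order_standard T] by blast
      then have max: "maximal_isotropic_set (wt x) (root_set T)"
        using maximal_isotropicI[OF index_order_standard matching_isotropic[OF T]] card_root_set[of T] by metis
      obtain qs where qs: "set qs = T" "distinct qs" using finite_distinct_list[OF finite[of T]] by blast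
      define ps where "ps = sort_key (\<lambda>z. x (Inl (fst z))) qs"
      have ps: "set ps = T" "distinct ps" by (simp_all add: ps_def qs)
      have srt: "sorted (map (\<lambda>z. x (Inl (fst z))) ps)" by (simp add: ps_def)
      obtain i j where ij: "(i, j) \<in> set ps" "x (Inl i) = u" using u unfolding ps T_def by auto
      obtain i' j' where ij': "(i', j') \<in> set ps" "x (Inl i') = v" using v unfolding ps T_def by auto
      have ne: "ps \<noteq> []" using ij by auto
      have "x (Inl (fst (hd ps))) \<le> u" using srt ij by (cases ps) auto
      moreover have "v \<le> x (Inl (fst (last ps)))"
      proof -
        have "\<forall>z\<in>set qs. f z \<le> f (last qs)" if "sorted (map f qs)" for f :: "_ \<Rightarrow> int" and qs :: "('m \<times> 'n) list"
          using that by (induction qs) auto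
        from this[OF srt] show ?thesis using ij' by auto
      qed
      moreover have "sorted (map (\<lambda>(i, j). Re (a_coeff (wt x) i)) ps)"
        using srt unfolding sorted_map by (simp add: a split_def)
      ultimately have "of_int z \<in> range (a_coeff (wt x)) \<union> range (b_coeff (wt x))"
        using ip[unfolded interval_property_def, rule_format, of ps z] ne ps max z
        by (auto simp: a root_set_def)
      then show "z \<in> ?A \<union> ?B" unfolding mem .
    qed
  next
    assume con: "connected_pair ?A ?B"
    show "interval_property (wt x)" unfolding interval_property_def
    proof (intro allI impI; elim conjE)
      fix ps :: "('m \<times> 'n) list" and z :: int
      assume ne: "ps \<noteq> []" and max: "maximal_isotropic_set (wt x) {eps i - del j | i j. (i, j) \<in> set ps}"
        and z: "Re (a_coeff (wt x) (fst (hd ps))) \<le> of_int z" "of_int z \<le> Re (a_coeff (wt x) (fst (last ps)))"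
      have "x (Inl (fst q)) \<in> ?A \<inter> ?B" if "q \<in> set ps" for q
      proof -
        have "eps (fst q) - del (snd q) \<in> {eps i - del j | i j. (i, j) \<in> set ps}"
          using that by (intro CollectI exI[of _ "fst q"] exI[of _ "snd q"]) simp
        then have "form (wt x) (eps (fst q) - del (snd q)) = 0"
          using max unfolding maximal_isotropic_set_def isotropic_set_def by blast
        then have "x (Inl (fst q)) = x (Inr (snd q))" by (simp add: eps_bvec del_bvec form_bvec_diff)
        then show ?thesis by (metis IntI rangeI)
      qed
      then have "x (Inl (fst (hd ps))) \<in> ?A \<inter> ?B" "x (Inl (fst (last ps))) \<in> ?A \<inter> ?B" using ne by auto
      moreover have "z \<in> {x (Inl (fst (hd ps)))..x (Inl (fst (last ps)))}" using z by (simp add: a)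
      ultimately show "of_int z \<in> range (a_coeff (wt x)) \<union> range (b_coeff (wt x))"
        unfolding mem using con unfolding connected_pair_def by blast
    qed
  qed
qed

lemma sorted_wrt_greater_unique:
  fixes xs ys :: "int list"
  assumes "sorted_wrt (>) xs" "sorted_wrt (>) ys" "set xs = set ys"
  shows "xs = ys"
proof -
  have "rev xs = rev ys" by (rule strict_sorted_equal) (use assms in \<open>auto simp: sorted_wrt_rev\<close>)
  then show ?thesis by simp
qed

theorem theorem20:
  fixes scale :: "complex \<Rightarrow> 'v::ab_group_add \<Rightarrow> 'v"
    and V :: "bit \<Rightarrow> 'v set"
    and act :: "('m::{finite,linorder}, 'n::{finite,linorder}) gl \<Rightarrow> 'v \<Rightarrow> 'v"
    and \<Lambda>st :: "('m, 'n) weight"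
  assumes "gl_module scale V act"
    and "gl_module.finite_dim scale"
    and "gl_module.simple scale V act"
    and "gl_module.highest_weight_module scale V act pi_st \<Lambda>st"
    and "\<Lambda>st \<in> PP_plus pi_st"
  shows "gl_module.KW_module scale V act \<longleftrightarrow> totally_connected \<Lambda>st"
proof -
  interpret gl_module scale V act by (rule assms(1))
  note std = index_order_set[OF index_order_standard, where 'a = 'm and 'b = 'n]
  obtain x0 where x0: "\<Lambda>st + rho pi_st = wt x0" "\<And>i j. i < j \<Longrightarrow> x0 (Inl j) < x0 (Inl i)"
    "\<And>k k'. k < k' \<Longrightarrow> x0 (Inr k) < x0 (Inr k')"
    using standard_labels[OF assms(5)] by blast
  define A where "A = range (\<lambda>i. x0 (Inl i))"
  define B where "B = range (\<lambda>j. x0 (Inr j))"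
  define as where "as = map (\<lambda>i. x0 (Inl i)) (sorted_list_of_set UNIV)"
  define bs where "bs = map (\<lambda>j. x0 (Inr j)) (sorted_list_of_set UNIV)"
  have std0: "std_form (word standard_order x0) = (as, bs)" by (simp add: std_form_word_standard as_def bs_def)
  have sets: "set as = A" "set bs = B" by (simp_all add: as_def bs_def A_def B_def)
  have as: "sorted_wrt (>) as" unfolding as_def sorted_wrt_map
    by (rule sorted_wrt_mono_rel[of _ "(<)"]) (auto intro: x0(2))
  have bs: "sorted_wrt (<) bs" unfolding bs_def sorted_wrt_map
    by (rule sorted_wrt_mono_rel[of _ "(<)"]) (auto intro: x0(3))
  have inj: "inj (\<lambda>i. x0 (Inl i))" "inj (\<lambda>j. x0 (Inr j))"
    by (rule linorder_injI, use x0(2) in fastforce) (rule linorder_injI, use x0(3) in fastforce)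
  have dist: "distinct as" "distinct bs" using inj by (simp_all add: as_def bs_def distinct_map)
  have tc: "totally_connected \<Lambda>st \<longleftrightarrow> connected_pair A B"
    unfolding totally_connected_def x0(1) interval_property_iff[OF inj] A_def B_def using assms(5) by simp
  have labels0: "has_labels standard_order x0"
  proof -
    obtain v where "highest_weight_vector pi_st \<Lambda>st v" using assms(4) unfolding highest_weight_module_def by blast
    then have "hw (pos standard_order) \<Lambda>st v"
      using highest_weight_vector_iff_hw[OF pos_roots_simple_of(2)[OF std(2,1)] std(3)] by (simp add: pi_st_simple_of)
    moreover have "\<Lambda>st = wt x0 - rho (simple_of standard_order)"
      using x0(1) by (simp add: pi_st_simple_of[symmetric] algebra_simps)
    ultimately show ?thesis unfolding has_labels_def by blast
  qed
  have num: "match_number (word l x) = card (A \<inter> B)" if "std_form (word l x) = (as, bs)" for l :: "('m + 'n) list" and x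
    using match_number_std_form[OF that dist] sets by simp
  show ?thesis unfolding tc
  proof
    \<comment> \<open>The word of a simple system that contains a maximal isotropic set has the standard form \<open>(as, bs)\<close>.\<close>
    assume KW_module
    then obtain C \<Lambda> S where C: "simple_roots C" "is_L C \<Lambda>" "S \<subseteq> C" "maximal_isotropic_set (\<Lambda> + rho C) S"
      unfolding KW_module_def by blast
    obtain l where l: "index_order l" "C \<subseteq> simple_of l" "pos_roots C = positive (pos l)"
      using simple_roots_index_order[OF C(1)] by blast
    note s = index_order_set[OF l(1)]
    have "rho C = rho (simple_of l)" unfolding rho_def l(3) pos_roots_simple_of(2)[OF s(2,1)] by simp
    moreover obtain v where "hw (pos l) \<Lambda> v" using C(2) is_L_iff_hw[OF l(3) s(3)] by blast
    moreover obtain x where x: "has_labels l x" "std_form (word l x) = (as, bs)"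
      using has_labels_exists[OF assms(3) labels0 l(1)] std0 by auto
    ultimately have wt: "\<Lambda> + rho C = wt x" using has_labels_unique[OF assms(3) l(1)] by metis
    have iso: "isotropic_set (wt x) S" using C(4) unfolding wt maximal_isotropic_set_def by blast
    have "finite S" using iso finite_roots finite_subset unfolding isotropic_set_def by blast
    then obtain w where w: "std_form w = std_form (word l x)" "paired w (card S)"
      using isotropic_paired[OF s(2), of S x] C(3) l(2) iso unfolding isotropic_set_def by blast
    have "card S = card (A \<inter> B)" using maximal_isotropic_card[OF l(1)] C(4) num[OF x(2)] unfolding wt by metis
    then show "connected_pair A B" using paired_connected[OF w(2) _ as bs] w(1) x(2) sets by simp
  next
    \<comment> \<open>The types in a suitable word determine the order of the indices and thereby the simple roots.\<close>
    assume "connected_pair A B"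
    then obtain w where w: "paired w (card (A \<inter> B))" "std_form_sets w A B"
      using connected_paired[of A B] by (auto simp: A_def B_def)
    have stdw: "std_form w = (as, bs)"
      using w(2) as bs sets sorted_wrt_greater_unique[of "fst (std_form w)" as] strict_sorted_equal[of "snd (std_form w)" bs]
      unfolding std_form_sets_def by (simp add: prod_eq_iff)
    have len: "length (filter id (map is_eps w)) = length (filter is_eps w)"
        "length (filter Not (map is_eps w)) = length (filter (\<lambda>c. \<not> is_eps c) w)"
      by (simp_all add: filter_map comp_def)
    obtain l where "l \<in> shuffles (map Inl (sorted_list_of_set UNIV)) (map Inr (sorted_list_of_set UNIV) :: ('m + 'n) list)"
      and shape: "map isl l = map is_eps w"
      using shuffle_with_shape[of "map is_eps w" "map Inl (sorted_list_of_set UNIV)"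
          "map Inr (sorted_list_of_set UNIV) :: ('m + 'n) list" isl]
        len length_std_form[of w] stdw by (auto simp: as_def bs_def)
    then have l: "index_order l" by (simp add: index_order_def)
    note s = index_order_set[OF l]
    obtain x where x: "has_labels l x" "std_form (word l x) = (as, bs)"
      using has_labels_exists[OF assms(3) labels0 l] std0 by auto
    have "map is_eps (word l x) = map isl l" by (auto simp: word_def)
    then have wl: "w = word l x" by (intro std_form_inj) (simp_all only: stdw x(2) shape)
    from paired_matching[OF w(1) wl s(2)] obtain T where T: "matching x T" "card T = card (A \<inter> B)"
        and adj: "\<forall>(i, j)\<in>T. Inl i \<in> set l \<and> Inr j \<in> set l \<and> adjacent l (Inl i) (Inr j)"
      by blast
    have "maximal_isotropic_set (wt x) (root_set T)"
      by (rule maximal_isotropicI[OF l matching_isotropic[OF T(1)]]) (simp add: card_root_set T(2) num[OF x(2)])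
    moreover have "root_set T \<subseteq> simple_of l"
    proof
      fix \<beta> :: "('m, 'n) weight" assume "\<beta> \<in> root_set T"
      then obtain i j where "\<beta> = bvec (Inl i) - bvec (Inr j)" "(i, j) \<in> T"
        unfolding root_set_conv by auto
      then show "\<beta> \<in> simple_of l" using adj unfolding simple_of_def by fast
    qed
    moreover have "is_L (simple_of l) (wt x - rho (simple_of l))"
      using x(1) assms(3) is_L_iff_hw[OF pos_roots_simple_of(2)[OF s(2,1)] s(3)] unfolding has_labels_def by blast
    ultimately show KW_module
      unfolding KW_module_def using assms(2,3) simple_roots_simple_of[OF l]
      by (metis diff_add_cancel)
  qed
qed

end
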